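(* Let $X$ be a downward skip-free continuous-time Markov chain on $\mathbb{N}$ satisfying the standing assumptions of the context, and assume that $X$ certainly hits $0$: $\mathbb{P}_x[\tau_0<\infty]=1$ for all $x\ge0$. Let $\mathcal{Q}$ denote the set of quasi-stationary distributions of $X$, let $\lambda_0$ be the decay parameter, and for $\lambda\in(0,\lambda_0]$ let $\nu_\lambda$ be the probability distribution $$\nu_\lambda(x):=\lambda W^{(-\lambda)}(0,x)\qquad(x\ge0).$$ Then: (i) If the boundary $\infty$ is entrance, then $\lambda_0>0$ and $\mathcal{Q}=\{\nu_{\lambda_0}\}$. (ii) If the boundary $\infty$ is non-entrance and $\lambda_0>0$, then $\mathcal{Q}=\{\nu_\lambda\}_{\lambda\in(0,\lambda_0]}$. (In each case, the $\nu_\lambda$ appearing in the description of $\mathcal{Q}$ are the distributions given by $\nu_\lambda(x)=\lambda W^{(-\lambda)}(0,x)$, $x\ge0$.)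
   Context: $\mathbb{N}=\{0,1,2,\dots\}$. $(\{X_t\}_{t\ge0},\{\mathbb{P}_x\}_{x\in\mathbb{N}})$ is a continuous-time Markov chain on $\mathbb{N}$ with càdlàg paths, whose $Q$-matrix $Q=(Q(x,y))_{x,y\ge0}$ is conservative ($\sum_{y}Q(x,y)=0$ for all $x$), killed at its explosion time $\lim_{z\to\infty}\tau_z^+$. For $A\subset\mathbb{N}$, $\tau_A:=\inf\{t>0: X_t\in A\}$ (with $\inf\emptyset=\infty$), $\tau_x:=\tau_{\{x\}}$, $\tau_z^+:=\tau_{[z,\infty)\cap\mathbb{N}}$; $Q(x):=-Q(x,x)$. $\mathbb{E}_x[Y,A]$ means $\mathbb{E}_x[Y1_A]$; $\mathbb{P}_\nu:=\sum_y\nu(y)\mathbb{P}_y$. Standing assumptions: $X$ is downward skip-free, i.e. $Q(x,y)=0$ for $0\le y\le x-2$; $X$ is irreducible on $\mathbb{N}\setminus\{0\}$: $\mathbb{P}_x[\tau_y<\infty]>0$ for $x\ge1$, $y\ge0$; $X$ is regular on $\mathbb{N}\setminus\{0\}$: $\mathbb{P}_x[\tau_{\mathbb{N}\setminus\{x\}}>0]=1$ for $x\ge1$; and $0$ is a trap: $\mathbb{P}_0[X_t=0]=1$ for all $t$. Scale function: for $z\ge1$, $n_z$ is $Q(z)$ times the law under $\mathbb{P}_z$ of the path of $X$ after its first exit time from $z$, stopped upon returning to $z$. Thus, writing $\sigma_z:=\tau_{\mathbb{N}\setminus\{z\}}$ and $R_z:=\inf\{t>\sigma_z:X_t=z\}$,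 for $x<z$, $n_z[e^{-q\tau_x},\tau_x<\infty]=Q(z)\,\mathbb{E}_z[e^{-q(\tau_x-\sigma_z)},\ \tau_x<R_z]$. For $q\ge0$, $W^{(q)}(x,z):=1/n_z[e^{-q\tau_x},\tau_x<\infty]$ for $0\le x<z$ and $W^{(q)}(x,z):=0$ for $x\ge z$; $W:=W^{(0)}$. For fixed $x,y$, $q\mapsto W^{(q)}(x,y)$ is a polynomial, $W^{(q)}(x,y)=\sum_{n\ge0}q^nW^{n+1}(x,y)$ ($W^n$ = matrix power, finite sum), and this formula defines $W^{(q)}(x,y)$ for all $q\in\mathbb{C}$. Decay parameter: $\lambda_0:=\sup\{\lambda\ge0:\mathbb{E}_x[e^{\lambda\tau_0}]<\infty\text{ for some }x\ge1\}$. The boundary $\infty$ is called entrance if $\sum_{y\ge0}W(0,y)<\infty$ and non-entrance if $\sum_{y\ge0}W(0,y)=\infty$. A probability distribution $\nu$ on $\mathbb{N}$ is a quasi-stationary distribution if $\nu(y)=\mathbb{P}_\nu[X_t=y\mid\tau_0>t]$ for every $y\ge0$, $t\ge0$. *)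

theory Defs
  imports "HOL-Probability.Probability"
begin

(* Paths take values in nat option: None is the cemetery reached at the explosion time.
   Only times t >= 0 are meaningful.  Hitting times are ereal-valued with Inf {} = \<infinity>, and
   they range over t > 0. *)

definition hitting_time :: "(real \<Rightarrow> 'w \<Rightarrow> nat option) \<Rightarrow> nat set \<Rightarrow> 'w \<Rightarrow> ereal" where
  "hitting_time X A \<omega> = Inf {ereal t | t. 0 < t \<and> X t \<omega> \<in> Some ` A}"

definition explosion_time :: "(real \<Rightarrow> 'w \<Rightarrow> nat option) \<Rightarrow> 'w \<Rightarrow> ereal" where
  "explosion_time X \<omega> = lim (\<lambda>z::nat. hitting_time X {z..} \<omega>)"

definition past_events :: "'w set \<Rightarrow> (real \<Rightarrow> 'w \<Rightarrow> nat option) \<Rightarrow> real \<Rightarrow> 'w set set" where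
  "past_events \<Omega> X s = sigma_sets \<Omega> {X u -` B \<inter> \<Omega> | u B. 0 \<le> u \<and> u \<le> s}"

(* All P x live on one measurable space.  As nat is discrete, a cadlag path is one that is
   constant on some right neighbourhood of every t >= 0 and on some left neighbourhood of every
   t > 0, for t before explosion.  The Markov property refers to the natural filtration; the
   transitions into the cemetery are determined by those into nat. *)
locale killed_markov_chain =
  fixes P :: "nat \<Rightarrow> 'w measure"
    and X :: "real \<Rightarrow> 'w \<Rightarrow> nat option"
    and Q :: "nat \<Rightarrow> nat \<Rightarrow> real"
  assumes prob_space_P: "prob_space (P x)"
    and sets_P: "sets (P x) = sets (P y)"
    and measurable_X: "0 \<le> t \<Longrightarrow> X t \<in> measurable (P x) (count_space UNIV)"
    and start: "\<P>(\<omega> in P x. X 0 \<omega> = Some x) = 1"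
    and killed: "\<lbrakk>\<omega> \<in> space (P x); 0 \<le> t\<rbrakk> \<Longrightarrow> X t \<omega> = None \<longleftrightarrow> explosion_time X \<omega> \<le> ereal t"
    and right_continuous: "\<lbrakk>\<omega> \<in> space (P x); 0 \<le> t; ereal t < explosion_time X \<omega>\<rbrakk> \<Longrightarrow>
          eventually (\<lambda>s. X s \<omega> = X t \<omega>) (at_right t)"
    and left_limits: "\<lbrakk>\<omega> \<in> space (P x); 0 < t; ereal t < explosion_time X \<omega>\<rbrakk> \<Longrightarrow>
          \<exists>y. eventually (\<lambda>s. X s \<omega> = Some y) (at_left t)"
    and markov: "\<lbrakk>0 \<le> s; 0 \<le> t; A \<in> past_events (space (P x)) X s\<rbrakk> \<Longrightarrow>
          \<P>(\<omega> in P x. \<omega> \<in> A \<and> X s \<omega> = Some y \<and> X (s + t) \<omega> = Some z) =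
          \<P>(\<omega> in P x. \<omega> \<in> A \<and> X s \<omega> = Some y) * \<P>(\<omega> in P y. X t \<omega> = Some z)"
    and Q_matrix: "((\<lambda>t. \<P>(\<omega> in P x. X t \<omega> = Some y)) has_real_derivative Q x y) (at_right 0)"
    and conservative: "Q x sums 0"

locale skip_free_chain = killed_markov_chain P X Q
  for P :: "nat \<Rightarrow> 'w measure"
    and X :: "real \<Rightarrow> 'w \<Rightarrow> nat option"
    and Q :: "nat \<Rightarrow> nat \<Rightarrow> real" +
  assumes skip_free: "y + 2 \<le> x \<Longrightarrow> Q x y = 0"
    and irreducible: "1 \<le> x \<Longrightarrow> \<P>(\<omega> in P x. hitting_time X {y} \<omega> < \<infinity>) > 0"
    and regular: "1 \<le> x \<Longrightarrow> \<P>(\<omega> in P x. hitting_time X (- {x}) \<omega> > 0) = 1"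
    and trap: "0 \<le> t \<Longrightarrow> \<P>(\<omega> in P 0. X t \<omega> = Some 0) = 1"

definition return_time :: "(real \<Rightarrow> 'w \<Rightarrow> nat option) \<Rightarrow> nat \<Rightarrow> 'w \<Rightarrow> ereal" where
  "return_time X z \<omega> = Inf {ereal t | t. hitting_time X (- {z}) \<omega> < ereal t \<and> X t \<omega> = Some z}"

(* n_z[exp(-q tau_x), tau_x < \<infinity>].  On the event in the indicator both times are finite,
   so real_of_ereal is harmless. *)
definition excursion_laplace ::
  "(nat \<Rightarrow> 'w measure) \<Rightarrow> (real \<Rightarrow> 'w \<Rightarrow> nat option) \<Rightarrow> (nat \<Rightarrow> nat \<Rightarrow> real) \<Rightarrow>
    real \<Rightarrow> nat \<Rightarrow> nat \<Rightarrow> real" where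
  "excursion_laplace P X Q q z x =
     - Q z z * (\<integral>\<omega>. exp (- q * real_of_ereal (hitting_time X {x} \<omega> - hitting_time X (- {z}) \<omega>)) *
                     indicat_real {\<omega>. hitting_time X {x} \<omega> < return_time X z \<omega>} \<omega> \<partial>P z)"

definition scale_nonneg ::
  "(nat \<Rightarrow> 'w measure) \<Rightarrow> (real \<Rightarrow> 'w \<Rightarrow> nat option) \<Rightarrow> (nat \<Rightarrow> nat \<Rightarrow> real) \<Rightarrow>
    real \<Rightarrow> nat \<Rightarrow> nat \<Rightarrow> real" where
  "scale_nonneg P X Q q x z = (if x < z then 1 / excursion_laplace P X Q q z x else 0)"

(* Powers of a strictly upper triangular matrix V: V u y = 0 for u >= y, so the sum over u < y is
   the full matrix product. *)
primrec upper_power :: "(nat \<Rightarrow> nat \<Rightarrow> real) \<Rightarrow> nat \<Rightarrow> nat \<Rightarrow> nat \<Rightarrow> real" where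
  "upper_power V 0 x y = (if x = y then 1 else 0)"
| "upper_power V (Suc n) x y = (\<Sum>u<y. upper_power V n x u * V u y)"

(* W^(q)(x,y) = sum over n of q^n W^(n+1)(x,y) with W = W^(0), for real or complex q; the terms
   with n >= y vanish because W is strictly upper triangular. *)
definition scale ::
  "(nat \<Rightarrow> 'w measure) \<Rightarrow> (real \<Rightarrow> 'w \<Rightarrow> nat option) \<Rightarrow> (nat \<Rightarrow> nat \<Rightarrow> real) \<Rightarrow>
    'k::real_normed_field \<Rightarrow> nat \<Rightarrow> nat \<Rightarrow> 'k" where
  "scale P X Q q x y =
     (\<Sum>n\<le>y. q ^ n * of_real (upper_power (scale_nonneg P X Q 0) (Suc n) x y))"

definition exp_ereal :: "ereal \<Rightarrow> ennreal" where
  "exp_ereal a = (if a = \<infinity> then \<infinity> else if a = -\<infinity> then 0 else ennreal (exp (real_of_ereal a)))"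

definition decay_parameter ::
  "(nat \<Rightarrow> 'w measure) \<Rightarrow> (real \<Rightarrow> 'w \<Rightarrow> nat option) \<Rightarrow> ereal" where
  "decay_parameter P X =
     Sup {ereal l | l. 0 \<le> l \<and>
       (\<exists>x\<ge>1. (\<integral>\<^sup>+ \<omega>. exp_ereal (ereal l * hitting_time X {0} \<omega>) \<partial>P x) < \<infinity>)}"

definition entrance_boundary ::
  "(nat \<Rightarrow> 'w measure) \<Rightarrow> (real \<Rightarrow> 'w \<Rightarrow> nat option) \<Rightarrow> (nat \<Rightarrow> nat \<Rightarrow> real) \<Rightarrow> bool" where
  "entrance_boundary P X Q \<longleftrightarrow> (\<Sum>y. ennreal (scale_nonneg P X Q 0 0 y)) < \<infinity>"

definition non_entrance_boundary ::
  "(nat \<Rightarrow> 'w measure) \<Rightarrow> (real \<Rightarrow> 'w \<Rightarrow> nat option) \<Rightarrow> (nat \<Rightarrow> nat \<Rightarrow> real) \<Rightarrow> bool" where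
  "non_entrance_boundary P X Q \<longleftrightarrow> (\<Sum>y. ennreal (scale_nonneg P X Q 0 0 y)) = \<infinity>"

definition initial_law :: "(nat \<Rightarrow> 'w measure) \<Rightarrow> nat pmf \<Rightarrow> 'w measure" where
  "initial_law P \<nu> = measure_pmf \<nu> \<bind> P"

(* Positivity of the conditioning event is explicit because division by zero is total. *)
definition quasi_stationary ::
  "(nat \<Rightarrow> 'w measure) \<Rightarrow> (real \<Rightarrow> 'w \<Rightarrow> nat option) \<Rightarrow> nat pmf set" where
  "quasi_stationary P X =
     {\<nu>. \<forall>t\<ge>0. \<P>(\<omega> in initial_law P \<nu>. ereal t < hitting_time X {0} \<omega>) > 0 \<and>
          (\<forall>y. pmf \<nu> y =
             \<P>(\<omega> in initial_law P \<nu>. X t \<omega> = Some y \<bar> ereal t < hitting_time X {0} \<omega>))}"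

definition nu ::
  "(nat \<Rightarrow> 'w measure) \<Rightarrow> (real \<Rightarrow> 'w \<Rightarrow> nat option) \<Rightarrow> (nat \<Rightarrow> nat \<Rightarrow> real) \<Rightarrow>
    real \<Rightarrow> nat \<Rightarrow> real" where
  "nu P X Q l x = l * scale P X Q (- l) 0 x"

end

(* Let p t be the transition semigroup.  Since the chain is killed at explosion, p t is the
   increasing limit of the semigroups pN N t of the chain killed on leaving {..<N}, which are
   exponentials of finite blocks of Q.  The matrix Q (y + 1) x is upper triangular with positive
   diagonal, and its inverse is the scale function W: on a grid of mesh h the probabilities that
   enter W are harmonic for the one-step kernel, and h tends to 0.  Hence V l := W^(-l) satisfies
   Q V = I - l V on the rows y >= 1 and V Q = I - l V, and a quasi-stationary distribution, being
   a left eigenvector of Q, must be l V l 0.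

   Positivity: V l (., z) is positive for l below the decay parameter, because at its first zero
   in l it is an eigenfunction of the chain killed outside {1..<z}, which bounds the survival
   probability from below.  Mass: recurrence gives sum_x l V l 0 x <= 1, and a deficit would force
   summability of W 0, so the mass is 1 in the non-entrance case.  In the entrance case
   Z l y := 1 - l * sum_u V l y u is continuous in l, and its first zero k satisfies Z k 0 = 0.
   Below k the function Z is a positive supersolution, so k is at most the decay parameter; the
   resolvent identity between V l and V k excludes that it is smaller. *)


theory Submission
  imports Defs "HOL-Real_Asymp.Real_Asymp"
begin

section \<open>Upper triangular inverse of a skip-free generator\<close>

text \<open>The Markov property is available only at deterministic times and the jump rates may be
  unbounded over the states, so neither stopping arguments nor Kolmogorov equations for
  \<open>p\<close> itself can be used directly. Path events are therefore approximated on dyadic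
  grids, where cylinder probabilities are iterated one-step kernels, and every martingale-type
  argument becomes the monotonicity in time of a finite sum over a block \<open>{..<N}\<close>, with
  \<open>N\<close> sent to infinity afterwards. Skip-freeness does two analytic services. Each
  column of \<open>Q\<close> is finite, which keeps \<open>V Q\<close> and the forward equation of a
  mixture finite sums. And row \<open>Suc x\<close> of \<open>Q\<close> starts at column
  \<open>x\<close> with a positive entry, so that an equation or inequality in that row can be
  solved for the value at \<open>x\<close>: back substitution, the maximum principle and the
  downward propagation of zeros all rest on this.\<close>

definition power_scale :: "(nat \<Rightarrow> nat \<Rightarrow> real) \<Rightarrow> real \<Rightarrow> nat \<Rightarrow> nat \<Rightarrow> real" where
  "power_scale V q x y = (\<Sum>n\<le>y. q ^ n * upper_power V (Suc n) x y)"

lemma upper_power_eq_0: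
  assumes "\<And>u y. y \<le> u \<Longrightarrow> V u y = 0" "y < x + n"
  shows "upper_power V n x y = 0"
  using assms(2)
proof (induction n arbitrary: y)
  case 0
  then show ?case by simp
next
  case (Suc n)
  show ?case
    unfolding upper_power.simps
  proof (rule sum.neutral, rule ballI)
    fix u assume "u \<in> {..<y}"
    then have "u < x + n" using Suc.prems by auto
    then show "upper_power V n x u * V u y = 0" using Suc.IH by simp
  qed
qed

text \<open>Splitting the first term off the Neumann series and reindexing the rest gives a Volterra
  equation. Later arguments use this recursion in place of the polynomial.\<close>

lemma power_scale_rec:
  assumes V: "\<And>u y. y \<le> u \<Longrightarrow> V u y = 0"
  shows "power_scale V q x y = V x y + q * (\<Sum>u<y. power_scale V q x u * V u y)"
proof -
  have first: "upper_power V (Suc 0) x y = V x y"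
  proof (cases "x < y")
    case True
    then have "(\<Sum>u<y. (if x = u then 1 else 0) * V u y) = (\<Sum>u<y. if x = u then V u y else 0)"
      by (intro sum.cong) auto
    then show ?thesis using True by simp
  next
    case False
    have "(\<Sum>u<y. (if x = u then 1 else 0) * V u y) = 0"
      using False by (intro sum.neutral) auto
    then show ?thesis using V False by simp
  qed
  have *: "(\<Sum>n<y. q ^ n * upper_power V (Suc n) x u) = power_scale V q x u" if "u < y" for u
    unfolding power_scale_def
  proof (rule sum.mono_neutral_right)
    show "{..u} \<subseteq> {..<y}" using that by auto
    show "\<forall>i\<in>{..<y} - {..u}. q ^ i * upper_power V (Suc i) x u = 0"
      using upper_power_eq_0[where V=V, OF V] that by auto
  qed simp
  have "power_scale V q x y = (\<Sum>n<Suc y. q ^ n * upper_power V (Suc n) x y)"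
    by (simp add: power_scale_def lessThan_Suc_atMost)
  also have "\<dots> = upper_power V (Suc 0) x y + (\<Sum>n<y. q ^ Suc n * upper_power V (Suc (Suc n)) x y)"
    by (subst sum.lessThan_Suc_shift) simp
  also have "(\<Sum>n<y. q ^ Suc n * upper_power V (Suc (Suc n)) x y) =
      q * (\<Sum>n<y. \<Sum>u<y. q ^ n * upper_power V (Suc n) x u * V u y)"
    by (simp del: upper_power.simps(2) add: upper_power.simps(2)[of V "Suc _"] sum_distrib_left mult_ac)
  also have "\<dots> = q * (\<Sum>u<y. (\<Sum>n<y. q ^ n * upper_power V (Suc n) x u) * V u y)"
    by (subst sum.swap) (simp add: sum_distrib_right)
  also have "\<dots> = q * (\<Sum>u<y. power_scale V q x u * V u y)"
    using * by (intro arg_cong[where f="(*) q"] sum.cong) auto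
  finally show ?thesis using first by simp
qed

lemma power_scale_continuous [continuous_intros]:
  "continuous_on A (\<lambda>l. power_scale V (- l) x y)"
  unfolding power_scale_def by (intro continuous_intros)

lemma power_scale_eq_0:
  assumes "\<And>u y. y \<le> u \<Longrightarrow> V u y = 0" "y \<le> x"
  shows "power_scale V q x y = 0"
  unfolding power_scale_def using assms(2)
  by (intro sum.neutral ballI, subst upper_power_eq_0[where V=V, OF assms(1)]) auto

text \<open>From \<open>z\<close> on the partial sums increase, and their limit is 0.\<close>

lemma partial_sum_nonpos:
  fixes f :: "nat \<Rightarrow> real"
  assumes "f sums 0" "\<And>v. z \<le> v \<Longrightarrow> 0 \<le> f v"
  shows "(\<Sum>v<z. f v) \<le> 0"
proof (rule LIMSEQ_le_const)
  show "(\<lambda>n. \<Sum>v<n. f v) \<longlonglongrightarrow> 0" using assms(1) by (simp add: sums_def)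
  have "(\<Sum>v<z. f v) \<le> (\<Sum>v<n. f v)" if "z \<le> n" for n
    using that assms(2) by (intro sum_mono2) auto
  then show "\<exists>N. \<forall>n\<ge>N. (\<Sum>v<z. f v) \<le> (\<Sum>v<n. f v)" by blast
qed

locale skip_free_generator =
  fixes Q :: "nat \<Rightarrow> nat \<Rightarrow> real"
  assumes off_diagonal: "x \<noteq> y \<Longrightarrow> 0 \<le> Q x y"
    and row_sums: "Q x sums 0"
    and no_skip: "y + 2 \<le> x \<Longrightarrow> Q x y = 0"
    and row_0: "Q 0 y = 0"
    and down_pos: "0 < Q (Suc y) y"
begin

lemma row_partial_sum_nonpos: "y < z \<Longrightarrow> (\<Sum>v<z. Q y v) \<le> 0"
  using row_sums by (rule partial_sum_nonpos) (auto intro: off_diagonal)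

lemma row_sum_split:
  assumes "x < z"
  shows "(\<Sum>v<z. Q (Suc x) v * f v) = Q (Suc x) x * f x + (\<Sum>v\<in>{x<..<z}. Q (Suc x) v * f v)"
proof -
  have "(\<Sum>v<z. Q (Suc x) v * f v) = (\<Sum>v\<in>insert x {x<..<z}. Q (Suc x) v * f v)"
    using assms by (intro sum.mono_neutral_right) (auto simp: no_skip)
  then show ?thesis by simp
qed

lemma row_sum_split':
  assumes "Suc x < z"
  shows "(\<Sum>v<z. Q (Suc x) v * f v) =
    Q (Suc x) x * f x + Q (Suc x) (Suc x) * f (Suc x) + (\<Sum>v\<in>{Suc x<..<z}. Q (Suc x) v * f v)"
proof -
  have "{x<..<z} = insert (Suc x) {Suc x<..<z}" using assms by auto
  then show ?thesis using assms by (simp add: row_sum_split)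
qed

text \<open>The upper triangular inverse of the matrix \<open>Q (Suc x) y\<close>, obtained by back substitution.\<close>

function W :: "nat \<Rightarrow> nat \<Rightarrow> real" where
  "W x z = (if z \<le> x then 0 else if z = Suc x then 1 / Q z x
     else - (\<Sum>v\<in>{x<..<z}. Q (Suc x) v * W v z) / Q (Suc x) x)"
  by pat_completeness auto
termination by (relation "Wellfounded.measure (\<lambda>(x, z). z - x)") auto

declare W.simps [simp del]

lemma W_eq_0 [simp]: "z \<le> x \<Longrightarrow> W x z = 0"
  by (simp add: W.simps)

lemma W_Suc: "W x (Suc x) = 1 / Q (Suc x) x"
  by (simp add: W.simps)

text \<open>Column \<open>z\<close> of \<open>W\<close> vanishes from \<open>z\<close> on, so
  cutting the product at \<open>z\<close> loses nothing. Row 0 of \<open>Q\<close> is zero and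
  cannot be inverted.\<close>

lemma Q_W: 
  assumes "0 < y" shows "(\<Sum>v<z. Q y v * W v z) = (if y = z then 1 else 0)"
proof -
  obtain x where y: "y = Suc x" using assms gr0_implies_Suc by blast
  have Q: "Q (Suc x) x \<noteq> 0" using down_pos[of x] by simp
  consider "z \<le> x" | "z = Suc x" | "Suc x < z" by linarith
  then show ?thesis
  proof cases
    case 1
    then show ?thesis unfolding y by (intro trans[OF sum.neutral]) (auto simp: no_skip)
  next
    case 2
    have "{x<..<Suc x} = {}" by auto
    then show ?thesis unfolding y 2 using Q by (subst row_sum_split) (auto simp: W_Suc)
  next
    case 3
    then show ?thesis unfolding y using Q
      by (subst row_sum_split) (auto simp: W.simps[of x z])
  qed
qed

text \<open>A right inverse of a triangular matrix is also a left inverse: the defect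
  \<open>R\<close> of \<open>W Q\<close> from the identity satisfies \<open>R W = 0\<close> by
  associativity of finite sums, and since \<open>W u (Suc u)\<close> is nonzero this forces
  \<open>R u = 0\<close> successively.\<close>

lemma W_Q: "(\<Sum>z\<le>Suc u. W x z * Q z u) = (if x = u then 1 else 0)"
proof -
  define R where "R u = (\<Sum>z\<le>Suc u. W x z * Q z u) - (if x = u then 1 else 0)" for u
  have RW: "(\<Sum>u<z. R u * W u z) = 0" for z
  proof -
    have "(\<Sum>u<z. (\<Sum>w\<le>Suc u. W x w * Q w u) * W u z) = (\<Sum>u<z. (\<Sum>w\<le>z. W x w * Q w u) * W u z)"
    proof (rule sum.cong[OF refl])
      fix u assume "u \<in> {..<z}"
      then have "(\<Sum>w\<le>Suc u. W x w * Q w u) = (\<Sum>w\<le>z. W x w * Q w u)"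
        by (intro sum.mono_neutral_left) (auto simp: no_skip)
      then show "(\<Sum>w\<le>Suc u. W x w * Q w u) * W u z = (\<Sum>w\<le>z. W x w * Q w u) * W u z"
        by (rule arg_cong)
    qed
    also have "\<dots> = (\<Sum>u<z. \<Sum>w\<le>z. W x w * (Q w u * W u z))"
      by (simp add: sum_distrib_right mult.assoc)
    also have "\<dots> = (\<Sum>w\<le>z. W x w * (\<Sum>u<z. Q w u * W u z))"
      by (subst sum.swap) (simp add: sum_distrib_left)
    also have "\<dots> = (\<Sum>w\<le>z. W x w * (if w = z then 1 else 0))"
    proof (intro sum.cong refl)
      fix w assume "w \<in> {..z}"
      show "W x w * (\<Sum>u<z. Q w u * W u z) = W x w * (if w = z then 1 else 0)"
        by (cases "w = 0") (auto simp: Q_W)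
    qed
    also have "\<dots> = W x z" by (simp add: if_distrib[where f="(*) _"] cong: if_cong)
    finally have 1: "(\<Sum>u<z. (\<Sum>w\<le>Suc u. W x w * Q w u) * W u z) = W x z" .
    have 2: "(\<Sum>u<z. (if x = u then 1 else 0) * W u z) = W x z"
    proof -
      have "(\<Sum>u<z. (if x = u then 1 else 0) * W u z) = (\<Sum>u<z. if x = u then W u z else 0)"
        by (intro sum.cong) auto
      then show ?thesis by auto
    qed
    show ?thesis unfolding R_def by (simp add: left_diff_distrib sum_subtractf 1 2 del: sum.atMost_Suc)
  qed
  have "R u = 0" for u
  proof (induction u rule: less_induct)
    case (less u)
    have "(\<Sum>v<Suc u. R v * W v (Suc u)) = R u * W u (Suc u)"
      using less by simp
    then show ?case using RW[of "Suc u"] down_pos[of u] by (simp add: W_Suc)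
  qed
  then show ?thesis unfolding R_def by simp
qed

text \<open>Maximum principle, by induction on \<open>z - x\<close>. Column \<open>z\<close> is
  harmonic at \<open>Suc x\<close>, the larger states carry at most the value there, and the row sum
  cut at \<open>z\<close> is nonpositive; so the value at \<open>x\<close> cannot be smaller than
  the one at \<open>Suc x\<close>.\<close>

lemma W_decreasing_pos:
  assumes "x < z"
  shows "0 < W x z \<and> (\<forall>v\<ge>x. W v z \<le> W x z)"
  using assms
proof (induction "z - x" arbitrary: x rule: less_induct)
  case less
  show ?case
  proof (cases "z = Suc x")
    case True
    have *: "W v (Suc x) \<le> W x (Suc x)" if "x \<le> v" for v
      using that down_pos[of x] by (cases "v = x") (auto simp: W_Suc)
    show ?thesis unfolding True using down_pos[of x] * by (auto simp: W_Suc)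
  next
    case False
    then have z: "Suc x < z" using less.prems by simp
    have IH: "0 < W (Suc x) z" "\<And>v. Suc x \<le> v \<Longrightarrow> W v z \<le> W (Suc x) z"
      using less.hyps[of "Suc x"] z less.prems by auto
    have "0 = Q (Suc x) x * W x z + Q (Suc x) (Suc x) * W (Suc x) z
        + (\<Sum>v\<in>{Suc x<..<z}. Q (Suc x) v * W v z)"
      using Q_W[of "Suc x" z] z by (simp add: row_sum_split'[OF z])
    also have "(\<Sum>v\<in>{Suc x<..<z}. Q (Suc x) v * W v z) \<le> (\<Sum>v\<in>{Suc x<..<z}. Q (Suc x) v * W (Suc x) z)"
      using IH by (intro sum_mono mult_left_mono off_diagonal) auto
    finally have 1: "0 \<le> Q (Suc x) x * W x z + (Q (Suc x) (Suc x) + (\<Sum>v\<in>{Suc x<..<z}. Q (Suc x) v)) * W (Suc x) z"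
      by (simp add: distrib_right sum_distrib_right)
    have "Q (Suc x) x + Q (Suc x) (Suc x) + (\<Sum>v\<in>{Suc x<..<z}. Q (Suc x) v) \<le> 0"
      using row_sum_split'[OF z, of "\<lambda>_. 1"] row_partial_sum_nonpos[OF z] by simp
    then have "(Q (Suc x) (Suc x) + (\<Sum>v\<in>{Suc x<..<z}. Q (Suc x) v)) * W (Suc x) z \<le> (- Q (Suc x) x) * W (Suc x) z"
      using IH(1) by (intro mult_right_mono) auto
    with 1 have "Q (Suc x) x * W (Suc x) z \<le> Q (Suc x) x * W x z" by linarith
    then have le: "W (Suc x) z \<le> W x z" using down_pos[of x] by simp
    have "W v z \<le> W x z" if "x \<le> v" for v
      using that le IH(2)[of v] by (cases "v = x") auto
    then show ?thesis using le IH(1) by (metis less_le_trans)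
  qed
qed

lemma W_pos: "x < z \<Longrightarrow> 0 < W x z" and W_nonneg: "0 \<le> W x z"
  using W_decreasing_pos[of x z] by (cases "x < z"; force)+

lemma W_le_W_0: "W x z \<le> W 0 z"
  using W_decreasing_pos[of 0 z] W_nonneg by (cases "z = 0") auto

section \<open>The family \<open>V l\<close> and its resolvent equations\<close>

abbreviation V :: "real \<Rightarrow> nat \<Rightarrow> nat \<Rightarrow> real" where
  "V l \<equiv> power_scale W (- l)"

lemma V_eq_0 [simp]: "z \<le> x \<Longrightarrow> V l x z = 0"
  by (rule power_scale_eq_0) auto

lemma V_rec: "V l x z = W x z - l * (\<Sum>u<z. V l x u * W u z)"
  using power_scale_rec[of W "- l" x z] by simp

lemma V_Suc: "V l x (Suc x) = W x (Suc x)"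
proof -
  have "(\<Sum>u<Suc x. V l x u * W u (Suc x)) = 0" by (intro sum.neutral) auto
  then show ?thesis using V_rec[of l x "Suc x"] by simp
qed

lemma V_0 [simp]: "power_scale W 0 x z = W x z"
  using V_rec[of 0 x z] by simp

text \<open>Multiply the recursion \<open>V = W - l V W\<close> by \<open>Q\<close> from the left.
  The factor \<open>Q V\<close> that reappears inside only involves columns smaller than
  \<open>z\<close>, hence the induction.\<close>

lemma Q_V:
  assumes "0 < y" shows "(\<Sum>v<z. Q y v * V l v z) = (if y = z then 1 else 0) - l * V l y z"
proof (induction z rule: less_induct)
  case (less z)
  have "(\<Sum>v<z. Q y v * V l v z) = (\<Sum>v<z. Q y v * W v z) - l * (\<Sum>v<z. \<Sum>u<z. Q y v * V l v u * W u z)"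
    by (subst V_rec) (simp add: right_diff_distrib sum_subtractf sum_distrib_left mult_ac)
  also have "(\<Sum>v<z. \<Sum>u<z. Q y v * V l v u * W u z) = (\<Sum>u<z. (\<Sum>v<z. Q y v * V l v u) * W u z)"
    by (subst sum.swap) (simp add: sum_distrib_right)
  also have "\<dots> = (\<Sum>u<z. ((if y = u then 1 else 0) - l * V l y u) * W u z)"
  proof (intro sum.cong refl arg_cong2[where f="(*)"])
    fix u assume u: "u \<in> {..<z}"
    have "(\<Sum>v<z. Q y v * V l v u) = (\<Sum>v<u. Q y v * V l v u)"
      using u by (intro sum.mono_neutral_right) auto
    then show "(\<Sum>v<z. Q y v * V l v u) = (if y = u then 1 else 0) - l * V l y u"
      using less u by simp
  qed
  also have "\<dots> = (\<Sum>u<z. (if y = u then W u z else 0)) - l * (\<Sum>u<z. V l y u * W u z)"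
    unfolding sum_distrib_left sum_subtractf[symmetric]
    by (intro sum.cong) (auto simp: algebra_simps)
  also have "(\<Sum>u<z. (if y = u then W u z else 0)) = W y z" by simp
  finally have "(\<Sum>v<z. Q y v * V l v z) = (\<Sum>v<z. Q y v * W v z) - l * V l y z"
    using V_rec[of l y z] by simp
  then show ?case using Q_W[OF assms] by simp
qed

lemma Q_V':
  assumes "0 < y" "z \<le> n" shows "(\<Sum>v<n. Q y v * V l v z) = (if y = z then 1 else 0) - l * V l y z"
  unfolding Q_V[OF assms(1), symmetric] using assms(2)
  by (intro sum.mono_neutral_right) auto

lemma V_Q: "(\<Sum>z\<le>Suc u. V l x z * Q z u) = (if x = u then 1 else 0) - l * V l x u"
proof -
  have "(\<Sum>z\<le>Suc u. V l x z * Q z u) = (\<Sum>z\<le>Suc u. W x z * Q z u) - l * (\<Sum>z\<le>Suc u. \<Sum>w<z. V l x w * W w z * Q z u)"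
    by (subst V_rec) (simp add: right_diff_distrib left_diff_distrib sum_subtractf sum_distrib_left sum_distrib_right mult_ac del: sum.atMost_Suc)
  also have "(\<Sum>z\<le>Suc u. \<Sum>w<z. V l x w * W w z * Q z u) = (\<Sum>z\<le>Suc u. \<Sum>w\<le>u. V l x w * W w z * Q z u)"
  proof (rule sum.cong[OF refl])
    fix z assume "z \<in> {..Suc u}"
    then show "(\<Sum>w<z. V l x w * W w z * Q z u) = (\<Sum>w\<le>u. V l x w * W w z * Q z u)"
      by (intro sum.mono_neutral_left) auto
  qed
  also have "\<dots> = (\<Sum>w\<le>u. V l x w * (\<Sum>z\<le>Suc u. W w z * Q z u))"
    by (subst sum.swap) (simp add: sum_distrib_left mult_ac del: sum.atMost_Suc)
  also have "\<dots> = (\<Sum>w\<le>u. if w = u then V l x w else 0)"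
    by (intro sum.cong) (auto simp: W_Q simp del: sum.atMost_Suc)
  also have "\<dots> = V l x u" by simp
  finally show ?thesis by (simp add: W_Q del: sum.atMost_Suc)
qed

text \<open>Evaluating \<open>V l Q V k\<close> in the two possible orders gives the resolvent identity.\<close>

lemma resolvent_identity:
  "V l 0 z - V k 0 z = (k - l) * (\<Sum>u<z. V l 0 u * V k u z)"
proof -
  have "(\<Sum>y\<le>z. V l 0 y * (\<Sum>v<z. Q y v * V k v z)) =
      (\<Sum>y\<le>z. (if y = z then V l 0 y else 0) - k * (V l 0 y * V k y z))"
  proof (intro sum.cong refl)
    fix y assume "y \<in> {..z}"
    \<comment> \<open>Row 0, where \<open>Q_V\<close> says nothing, is weighted by
      \<open>V l 0 0 = 0\<close>.\<close>
    show "V l 0 y * (\<Sum>v<z. Q y v * V k v z) = (if y = z then V l 0 y else 0) - k * (V l 0 y * V k y z)"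
      by (cases "y = 0") (auto simp: Q_V algebra_simps)
  qed
  also have "\<dots> = V l 0 z - k * (\<Sum>y\<le>z. V l 0 y * V k y z)"
    by (simp add: sum_subtractf sum_distrib_left)
  also have "(\<Sum>y\<le>z. V l 0 y * V k y z) = (\<Sum>y<z. V l 0 y * V k y z)"
    by (intro sum.mono_neutral_right) auto
  finally have 1: "(\<Sum>y\<le>z. V l 0 y * (\<Sum>v<z. Q y v * V k v z)) = V l 0 z - k * (\<Sum>y<z. V l 0 y * V k y z)" .
  have "(\<Sum>y\<le>z. V l 0 y * (\<Sum>v<z. Q y v * V k v z)) = (\<Sum>v<z. (\<Sum>y\<le>z. V l 0 y * Q y v) * V k v z)"
    unfolding sum_distrib_left sum_distrib_right by (subst sum.swap) (simp add: mult.assoc)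
  also have "\<dots> = (\<Sum>v<z. (if v = 0 then V k v z else 0) - l * (V l 0 v * V k v z))"
  proof (intro sum.cong refl)
    fix v assume "v \<in> {..<z}"
    then have "(\<Sum>y\<le>z. V l 0 y * Q y v) = (\<Sum>y\<le>Suc v. V l 0 y * Q y v)"
      by (intro sum.mono_neutral_right) (auto simp: no_skip)
    also note V_Q
    finally have eq: "(\<Sum>y\<le>z. V l 0 y * Q y v) = (if 0 = v then 1 else 0) - l * V l 0 v" .
    show "(\<Sum>y\<le>z. V l 0 y * Q y v) * V k v z = (if v = 0 then V k v z else 0) - l * (V l 0 v * V k v z)"
      unfolding eq by (simp add: algebra_simps)
  qed
  also have "\<dots> = V k 0 z - l * (\<Sum>v<z. V l 0 v * V k v z)"
    by (simp add: sum_subtractf sum_distrib_left)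
  finally show ?thesis using 1 by (simp add: algebra_simps)
qed

end

section \<open>Survival rate and scale functions\<close>

text \<open>One-sided derivatives at the end points are enough, which is what semigroups on
  \<open>{0..}\<close> provide.\<close>

lemma nondecreasing_of_derivative_within:
  fixes f f' :: "real \<Rightarrow> real"
  assumes "a \<le> b"
    and "\<And>s. s \<in> {a..b} \<Longrightarrow> (f has_real_derivative f' s) (at s within {a..b})"
    and "\<And>s. s \<in> {a..b} \<Longrightarrow> 0 \<le> f' s"
  shows "f a \<le> f b"
proof -
  have "(f' has_integral (f b - f a)) {a..b}"
    using assms(1,2) unfolding has_real_derivative_iff_has_vector_derivative
    by (rule fundamental_theorem_of_calculus)
  then show ?thesis using has_integral_nonneg[of f' "f b - f a" "{a..b}"] assms(3) by simp
qed

text \<open>The tail assumption leaves finitely many indices, so the parameters with a nonpositive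
  value form a finite union of closed subsets of \<open>{0..l1}\<close>; \<open>k\<close> is the
  least element of this compact set. Nonnegativity at \<open>k\<close> follows by continuity from
  the left. It is applied to a column of \<open>V\<close> and to the function \<open>Z\<close> of
  the entrance case.\<close>

lemma first_zero:
  fixes f :: "real \<Rightarrow> nat \<Rightarrow> real"
  assumes cont: "\<And>y L. continuous_on {0..L} (\<lambda>l. f l y)"
    and pos0: "\<And>y. 0 < f 0 y"
    and tail: "\<And>L. \<exists>Y. \<forall>y\<ge>Y. \<forall>l\<in>{0..L}. 0 < f l y"
    and l1: "0 \<le> l1" "f l1 y1 \<le> 0"
  obtains k y where "0 < k" "k \<le> l1" "\<And>l y. 0 \<le> l \<Longrightarrow> l < k \<Longrightarrow> 0 < f l y"
    "\<And>y. 0 \<le> f k y" "f k y = 0"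
proof -
  obtain Y where Y: "\<And>y l. Y \<le> y \<Longrightarrow> 0 \<le> l \<Longrightarrow> l \<le> l1 \<Longrightarrow> 0 < f l y"
    using tail[of l1] by (metis atLeastAtMost_iff)
  define S where "S = (\<Union>y<Y. {l\<in>{0..l1}. f l y \<le> 0})"
  have "closed {l\<in>{0..l1}. f l y \<le> 0}" for y
    by (rule continuous_on_closed_Collect_le[OF cont continuous_on_const]) simp
  then have "closed S" unfolding S_def by (intro closed_UN) auto
  moreover have "S \<subseteq> {0..l1}" unfolding S_def by auto
  ultimately have "compact S" using bounded_subset[OF bounded_closed_interval] compact_eq_bounded_closed by blast
  moreover have "y1 < Y" using Y[of y1 l1] l1 by force
  then have "l1 \<in> S" using l1 unfolding S_def by auto
  ultimately obtain k where k: "k \<in> S" "\<And>l. l \<in> S \<Longrightarrow> k \<le> l"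
    using compact_attains_inf[of S] by auto
  then obtain y where y: "0 \<le> k" "k \<le> l1" "f k y \<le> 0" unfolding S_def by auto
  have "k \<noteq> 0" using y pos0[of y] by auto
  then have k0: "0 < k" using y by simp
  have pos: "0 < f l v" if "0 \<le> l" "l < k" for l v
  proof (cases "v < Y")
    case True
    have "l \<notin> S" using k(2) that by force
    then show ?thesis using True that y unfolding S_def by force
  next
    case False
    then show ?thesis using Y that y by auto
  qed
  have nonneg: "0 \<le> f k v" for v
    by (rule continuous_ge_on_closure[of "{0..<k}" "\<lambda>l. f l v"])
      (use k0 cont[of k v] pos in \<open>auto intro: less_imp_le\<close>)
  show ?thesis by (rule that[OF k0 y(2) pos nonneg, of y]) (use nonneg[of y] y in auto)
qed

text \<open>The row inequality is solved for the value at \<open>x\<close>; states above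
  \<open>Suc x\<close> contribute at least \<open>- d\<close> times their total rate, which is at
  most \<open>- Q (Suc x) (Suc x)\<close>. With \<open>d = 0\<close>, a nonnegative supersolution
  that vanishes at \<open>Suc x\<close> vanishes at \<open>x\<close>; a positive \<open>d\<close>
  absorbs truncation errors.\<close>

lemma (in skip_free_generator) down_step:
  assumes z: "Suc x < z" and d: "\<And>v. v < z \<Longrightarrow> - d \<le> h v" "0 \<le> d"
    and sub: "(\<Sum>v<z. Q (Suc x) v * h v) \<le> - l * h (Suc x)"
  shows "Q (Suc x) x * h x \<le> - (l + Q (Suc x) (Suc x)) * h (Suc x) - d * Q (Suc x) (Suc x)"
proof -
  have "(\<Sum>v\<in>{Suc x<..<z}. Q (Suc x) v) \<le> - Q (Suc x) (Suc x)"
    using row_sum_split'[OF z, of "\<lambda>_. 1"] row_partial_sum_nonpos[OF z] down_pos[of x] by simp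
  then have "d * (\<Sum>v\<in>{Suc x<..<z}. Q (Suc x) v) \<le> d * - Q (Suc x) (Suc x)"
    using d(2) by (rule mult_left_mono)
  moreover have "(\<Sum>v\<in>{Suc x<..<z}. Q (Suc x) v * - d) \<le> (\<Sum>v\<in>{Suc x<..<z}. Q (Suc x) v * h v)"
    using d by (intro sum_mono mult_left_mono off_diagonal) auto
  ultimately show ?thesis
    using sub[unfolded row_sum_split'[OF z, of h]]
    by (simp add: sum_distrib_left[symmetric] sum_distrib_right[symmetric] sum_negf algebra_simps)
qed

text \<open>\<open>pN N\<close> is the transition semigroup of the chain killed on leaving \<open>{..<N}\<close>, and \<open>lam0\<close> is the decay
  parameter, of which only the relation to the survival probabilities is used.\<close>

locale skip_free_transitions = skip_free_generator Q
  for Q :: "nat \<Rightarrow> nat \<Rightarrow> real" +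
  fixes p :: "real \<Rightarrow> nat \<Rightarrow> nat \<Rightarrow> real" and pN :: "nat \<Rightarrow> real \<Rightarrow> nat \<Rightarrow> nat \<Rightarrow> real"
    and lam0 :: ereal
  assumes pN_nonneg: "0 \<le> t \<Longrightarrow> 0 \<le> pN N t x y"
    and pN_0: "\<lbrakk>x < N; y < N\<rbrakk> \<Longrightarrow> pN N 0 x y = (if x = y then 1 else 0)"
    and pN_forward: "\<lbrakk>x < N; y < N; 0 \<le> t\<rbrakk> \<Longrightarrow>
      ((\<lambda>t. pN N t x y) has_real_derivative (\<Sum>u<N. pN N t x u * Q u y)) (at t within {0..})"
    and pN_backward: "\<lbrakk>x < N; y < N; 0 \<le> t\<rbrakk> \<Longrightarrow>
      ((\<lambda>t. pN N t x y) has_real_derivative (\<Sum>u<N. Q x u * pN N t u y)) (at t within {0..})"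
    and pN_tendsto: "0 \<le> t \<Longrightarrow> (\<lambda>N. pN N t x y) \<longlonglongrightarrow> p t x y"
    and pN_le: "0 \<le> t \<Longrightarrow> pN N t x y \<le> p t x y"
    and p_sums: "0 \<le> t \<Longrightarrow> p t x sums 1"
    and p_absorbed: "((\<lambda>t. p t x 0) \<longlongrightarrow> 1) at_top"
    and p_irreducible: "1 \<le> x \<Longrightarrow> \<exists>t\<ge>0. 0 < p t x y"
    and p_survival: "\<lbrakk>0 \<le> s; 0 \<le> t\<rbrakk> \<Longrightarrow> p s x u * (1 - p t u 0) \<le> 1 - p (s + t) x 0"
    and lam0_nonneg: "0 \<le> lam0"
    and lam0_upper: "\<lbrakk>0 \<le> l; ereal l < lam0\<rbrakk> \<Longrightarrow> \<exists>x\<ge>1. \<exists>C. \<forall>t\<ge>0. 1 - p t x 0 \<le> C * exp (- l * t)"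
    and lam0_lower: "\<lbrakk>0 < l; 1 \<le> x; \<And>t. 0 \<le> t \<Longrightarrow> 1 - p t x 0 \<le> C * exp (- l * t)\<rbrakk> \<Longrightarrow> ereal l \<le> lam0"
begin

section \<open>Supersolutions of the killed chain and the sign of \<open>V\<close>\<close>

lemma p_nonneg: "0 \<le> t \<Longrightarrow> 0 \<le> p t x y"
  using pN_le pN_nonneg order_trans by blast

lemma p_le_1: "0 \<le> t \<Longrightarrow> p t x y \<le> 1"
  using sum_le_suminf[of "p t x" "{y}"] p_sums[of t x] p_nonneg[of t x]
  by (auto simp: sums_iff)

lemma sum_pos_le_survival:
  assumes "0 \<le> t" shows "(\<Sum>v\<in>{1..<n}. p t x v) \<le> 1 - p t x 0"
proof -
  have "sum (p t x) (insert 0 {1..<n}) \<le> suminf (p t x)"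
    using p_sums[OF assms] p_nonneg[OF assms] by (intro sum_le_suminf) (auto simp: sums_iff)
  then show ?thesis using p_sums[OF assms, of x] by (simp add: sums_iff)
qed

text \<open>The analytic form of the statement that \<open>exp (l * t) * h (X t)\<close> is a
  supermartingale up to killing: by the forward equation the expectation has a nonpositive
  derivative. \<open>F\<close> carries a minus sign so as to be nondecreasing.\<close>

lemma pN_supersolution:
  assumes sup: "\<And>y. y < N \<Longrightarrow> (\<Sum>v<N. Q y v * h v) \<le> - l * h y" and t: "0 \<le> t" "x < N"
  shows "(\<Sum>v<N. pN N t x v * h v) \<le> exp (- l * t) * h x"
proof -
  define F where "F s = - exp (l * s) * (\<Sum>v<N. pN N s x v * h v)" for s
  define F' where "F' s = - exp (l * s) * (\<Sum>u<N. pN N s x u * (l * h u + (\<Sum>v<N. Q u v * h v)))" for s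
  have "F 0 \<le> F t"
  proof (rule nondecreasing_of_derivative_within[where f=F and f'=F' and a=0 and b=t])
    fix s assume s: "s \<in> {0..t}"
    have e1: "(\<Sum>v<N. (\<Sum>u<N. pN N s x u * Q u v) * h v) = (\<Sum>u<N. pN N s x u * (\<Sum>v<N. Q u v * h v))"
      unfolding sum_distrib_left sum_distrib_right by (subst sum.swap) (simp add: mult.assoc)
    have e2: "(\<Sum>u<N. pN N s x u * (l * h u + (\<Sum>v<N. Q u v * h v))) =
        l * (\<Sum>v<N. pN N s x v * h v) + (\<Sum>u<N. pN N s x u * (\<Sum>v<N. Q u v * h v))"
      by (simp add: distrib_left sum.distrib sum_distrib_left mult_ac)
    have "(F has_real_derivative (- exp (l * s) * (\<Sum>v<N. (\<Sum>u<N. pN N s x u * Q u v) * h v)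
        + - (l * exp (l * s)) * (\<Sum>v<N. pN N s x v * h v))) (at s within {0..t})"
      unfolding F_def using s t(2)
      by (auto intro!: derivative_eq_intros DERIV_subset[OF pN_forward])
    moreover have "- exp (l * s) * (\<Sum>v<N. (\<Sum>u<N. pN N s x u * Q u v) * h v)
        + - (l * exp (l * s)) * (\<Sum>v<N. pN N s x v * h v) = F' s"
      unfolding F'_def e1 e2 by (simp only: distrib_left mult_minus_left mult_ac minus_add_distrib add.commute)
    ultimately show "(F has_real_derivative F' s) (at s within {0..t})"
      by simp
    have "(\<Sum>u<N. pN N s x u * (l * h u + (\<Sum>v<N. Q u v * h v))) \<le> 0"
    proof (intro sum_nonpos mult_nonneg_nonpos pN_nonneg)
      fix u assume "u \<in> {..<N}"
      then show "l * h u + (\<Sum>v<N. Q u v * h v) \<le> 0" using sup[of u] by simp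
    qed (use s in auto)
    then show "0 \<le> F' s" unfolding F'_def by (simp add: mult_nonneg_nonpos)
  qed (use t in auto)
  moreover have "(\<Sum>v<N. pN N 0 x v * h v) = (\<Sum>v<N. if v = x then h v else 0)"
    using t by (intro sum.cong) (auto simp: pN_0)
  then have "F 0 = - h x" unfolding F_def using t by simp
  ultimately have "exp (l * t) * (\<Sum>v<N. pN N t x v * h v) \<le> h x" unfolding F_def by simp
  then show ?thesis by (simp add: exp_minus field_simps)
qed

lemma pN_eigenfunction:
  assumes eig: "\<And>y. y < N \<Longrightarrow> (\<Sum>v<N. Q y v * h v) = - l * h y" and t: "0 \<le> t" "x < N"
  shows "(\<Sum>v<N. pN N t x v * h v) = exp (- l * t) * h x"
  using pN_supersolution[of N h l t x] pN_supersolution[of N "\<lambda>v. - h v" l t x] assms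
  by (force simp: sum_negf)

text \<open>\<open>lam0_upper\<close> gives decay from one state \<open>x\<close> only. Since
  \<open>x\<close> reaches \<open>u\<close> at some time \<open>s\<close> with positive probability,
  long survival from \<open>u\<close> forces long survival from \<open>x\<close>, at the cost of a
  constant.\<close>

lemma survival_upper:
  assumes l: "0 \<le> l" "ereal l < lam0"
  shows "\<exists>C. \<forall>t\<ge>0. 1 - p t u 0 \<le> C * exp (- l * t)"
proof -
  obtain x C where x: "1 \<le> x" "\<And>t. 0 \<le> t \<Longrightarrow> 1 - p t x 0 \<le> C * exp (- l * t)"
    using lam0_upper[OF l] by auto
  obtain s where s: "0 \<le> s" "0 < p s x u" using p_irreducible[OF x(1)] by auto
  have "1 - p t u 0 \<le> (C / p s x u * exp (- l * s)) * exp (- l * t)" if "0 \<le> t" for t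
  proof -
    have "p s x u * (1 - p t u 0) \<le> C * exp (- l * (s + t))"
      using p_survival[of s t x u] x(2)[of "s + t"] s that by simp
    also have "exp (- l * (s + t)) = exp (- l * s) * exp (- l * t)"
      by (simp add: mult_exp_exp algebra_simps)
    finally have "1 - p t u 0 \<le> C * (exp (- l * s) * exp (- l * t)) / p s x u"
      using s by (simp add: pos_le_divide_eq mult.commute)
    then show ?thesis by (simp add: mult_ac)
  qed
  then show ?thesis by blast
qed

lemma exp_rate_le:
  fixes c k l C :: real
  assumes "0 < c" "\<And>t. 0 \<le> t \<Longrightarrow> c * exp (- k * t) \<le> C * exp (- l * t)"
  shows "l \<le> k"
proof (rule ccontr)
  assume "\<not> l \<le> k"
  then have lk: "0 < l - k" by simp
  have "C > 0" using assms(1) assms(2)[of 0] by simp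
  \<comment> \<open>At this time the exponent \<open>(l - k) * t\<close> equals
    \<open>C / c\<close>, and \<open>exp a\<close> is at least \<open>1 + a\<close>.\<close>
  define t where "t = (C / c) / (l - k)"
  have t: "0 \<le> t" unfolding t_def using lk \<open>C > 0\<close> assms(1) by simp
  have "C / c < exp ((l - k) * t)"
    unfolding t_def using lk exp_ge_add_one_self[of "C / c"] by (simp, linarith)
  then have "C * exp (- l * t) < c * exp ((l - k) * t) * exp (- l * t)"
    using assms(1) by (simp add: field_simps)
  also have "\<dots> = c * exp (- k * t)"
    by (simp add: mult_exp_exp algebra_simps)
  finally show False using assms(2)[OF t] by simp
qed

text \<open>At the first parameter where column \<open>z\<close> of \<open>V\<close> touches zero, this column is an eigenfunction of
  the chain killed outside \<open>{1..<z}\<close>, so the parameter is a lower bound for the survival rate.\<close>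

lemma V_pos:
  assumes l: "0 \<le> l" "ereal l < lam0" and y: "y < z"
  shows "0 < V l y z"
proof (rule ccontr)
  assume "\<not> 0 < V l y z"
  \<comment> \<open>Only entries above the diagonal may be tested for a first zero; the padding by 1
    also supplies the tail condition of \<open>first_zero\<close>.\<close>
  define f where "f l v = (if v < z then V l v z else 1)" for l v
  obtain k v where k: "0 < k" "k \<le> l" "\<And>v. 0 \<le> f k v" "f k v = 0"
  proof (rule first_zero[of f l y])
    show "continuous_on {0..L} (\<lambda>l. f l v)" for v L
      unfolding f_def by (cases "v < z") (auto intro: continuous_intros)
    show "0 < f 0 v" for v unfolding f_def by (simp add: W_pos)
    show "\<exists>Y. \<forall>v\<ge>Y. \<forall>l\<in>{0..L}. 0 < f l v" for L
      by (rule exI[of _ z]) (auto simp: f_def)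
    show "f l y \<le> 0" using \<open>\<not> 0 < V l y z\<close> y by (auto simp: f_def)
  qed (use l in auto)
  have nonneg: "0 \<le> V k u z" for u
    using k(3)[of u] by (cases "u < z") (auto simp: f_def)
  have v: "v < z" "V k v z = 0" using k(4) by (auto simp: f_def split: if_splits)
  obtain z' where z': "z = Suc z'" using y by (cases z) auto
  have last: "0 < V k z' z" unfolding z' by (simp add: V_Suc W_pos)
  \<comment> \<open>By \<open>down_step\<close> with \<open>d = 0\<close> the zero propagates from
    \<open>v\<close> down to state 0.\<close>
  have "V k u z = 0" if "u \<le> v" for u
    using that
  proof (induction u rule: inc_induct)
    case base
    then show ?case using v by simp
  next
    case (step u)
    have "Q (Suc u) u * V k u z \<le> - (k + Q (Suc u) (Suc u)) * V k (Suc u) z - 0 * Q (Suc u) (Suc u)"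
    proof (rule down_step[where h="\<lambda>u. V k u z"])
      show "Suc u < z" using step v by simp
      then show "(\<Sum>v<z. Q (Suc u) v * V k v z) \<le> - k * V k (Suc u) z" using Q_V[of "Suc u"] by simp
    qed (use nonneg in auto)
    then have "Q (Suc u) u * V k u z \<le> 0" using step.IH by simp
    then show ?case using nonneg[of u] down_pos[of u] by (simp add: mult_le_0_iff)
  qed
  then have V0: "V k 0 z = 0" by simp
  have z'0: "0 < z'" using last V0 by (cases z') auto
  define M where "M = Max ((\<lambda>u. V k u z) ` {..z})"
  have M: "V k u z \<le> M" if "u \<le> z" for u
    unfolding M_def using that by (intro Max_ge) auto
  have M0: "0 < M" using last M[of z'] z' by simp
  \<comment> \<open>With \<open>V k 0 z = 0\<close> the eigenvalue equation holds in row 0 as well.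
    The other states below \<open>z\<close> carry at most the survival probability, and
    \<open>M\<close> bounds the column.\<close>
  have lower: "V k z' z / M * exp (- k * t) \<le> 1 - p t z' 0" if t: "0 \<le> t" for t
  proof -
    have "exp (- k * t) * V k z' z = (\<Sum>v<z. pN z t z' v * V k v z)"
    proof (rule pN_eigenfunction[symmetric])
      fix y assume "y < z"
      then show "(\<Sum>v<z. Q y v * V k v z) = - k * V k y z"
        using Q_V[of y k z] V0 by (cases "y = 0") (auto simp: row_0)
    qed (use t z' in auto)
    also have "\<dots> = (\<Sum>v\<in>{1..<z}. pN z t z' v * V k v z)"
      using V0 by (intro sum.mono_neutral_right) (auto simp: not_le)
    also have "\<dots> \<le> (\<Sum>v\<in>{1..<z}. p t z' v * M)"
      using nonneg M pN_le[OF t] pN_nonneg[OF t] p_nonneg[OF t] by (intro sum_mono mult_mono) auto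
    also have "\<dots> \<le> (1 - p t z' 0) * M"
      unfolding sum_distrib_right[symmetric] using M0 sum_pos_le_survival[OF t]
      by (intro mult_right_mono) auto
    finally show ?thesis using M0 by (simp add: field_simps)
  qed
  \<comment> \<open>A rate strictly between \<open>l\<close> and \<open>lam0\<close>: decay at rate
    \<open>l'\<close> contradicts the lower bound at rate \<open>k\<close>, as \<open>k\<close> is
    at most \<open>l\<close>.\<close>
  define l' where "l' = (if lam0 = \<infinity> then l + 1 else (l + real_of_ereal lam0) / 2)"
  have l': "l < l'" "ereal l' < lam0"
    using l unfolding l'_def by (cases lam0; auto)+
  obtain C where "\<And>t. 0 \<le> t \<Longrightarrow> 1 - p t z' 0 \<le> C * exp (- l' * t)"
    using survival_upper[of l' z'] l l' by auto
  then have "l' \<le> k"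
    using lower last M0 by (intro exp_rate_le[of "V k z' z / M" k C l']) (auto intro: order_trans)
  then show False using k l' by simp
qed

text \<open>Positivity strictly below \<open>lam0\<close> passes to the end point by continuity in
  \<open>l\<close>.\<close>

lemma V_nonneg:
  assumes l: "0 \<le> l" "ereal l \<le> lam0" shows "0 \<le> V l y z"
proof (cases "y < z \<and> 0 < l")
  case True
  have "V k y z \<ge> 0" if "k \<in> {0..<l}" for k
  proof -
    have "ereal k < lam0" using that by (intro less_le_trans[OF _ l(2)]) simp
    then show ?thesis using V_pos[of k y z] that True by simp
  qed
  moreover have "l \<in> closure {0..<l}" using True by simp
  moreover have "continuous_on (closure {0..<l}) (\<lambda>l. V l y z)" by (rule power_scale_continuous)
  ultimately show ?thesis using continuous_ge_on_closure[of "{0..<l}" "\<lambda>l. V l y z" l 0] by blast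
next
  case False
  then show ?thesis using l W_nonneg[of y z] by (cases "l = 0") (auto simp: not_less)
qed

text \<open>\<open>V l 0 2\<close> is affine in \<open>l\<close> with a positive zero, which
  \<open>V_pos\<close> forbids below \<open>lam0\<close>.\<close>

lemma lam0_finite: "lam0 \<noteq> \<infinity>"
proof
  assume "lam0 = \<infinity>"
  define l where "l = W 0 2 / (W 0 1 * W 1 2)"
  have W: "0 < W 0 1" "0 < W 1 2" "0 < W 0 2" by (auto intro!: W_pos)
  have "V l 0 1 = W 0 1" using V_Suc[of l 0] by simp
  then have "V l 0 2 = W 0 2 - l * (W 0 1 * W 1 2)"
    by (subst V_rec) (simp add: numeral_2_eq_2 del: V_0)
  also have "\<dots> = 0" unfolding l_def using W by simp
  finally show False using V_pos[of l 0 2] \<open>lam0 = \<infinity>\<close> W by (auto simp: l_def)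
qed

text \<open>As a function of \<open>u\<close> the ratio is harmonic for the chain killed on leaving
  \<open>{..<z}\<close> and equals 1 at state 0, hence is at least \<open>pN z t u 0\<close>. As
  \<open>z\<close> grows this tends to \<open>p t u 0\<close>, which is close to 1 for large
  \<open>t\<close> because absorption is certain.\<close>

lemma W_ratio_tendsto: "(\<lambda>z. W u z / W 0 z) \<longlonglongrightarrow> 1"
proof (rule LIMSEQ_I)
  fix r :: real assume "0 < r"
  have "\<forall>\<^sub>F t in at_top. p t u 0 > 1 - r \<and> t \<ge> 0"
    using order_tendstoD(1)[OF p_absorbed, of "1 - r"] \<open>0 < r\<close> eventually_ge_at_top[of 0]
    by (intro eventually_conj) auto
  then obtain t where t: "0 \<le> t" "p t u 0 > 1 - r"
    by (metis (no_types, lifting) eventually_at_top_linorder order_refl)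
  have "\<forall>\<^sub>F z in sequentially. pN z t u 0 > 1 - r"
    using order_tendstoD(1)[OF pN_tendsto[OF t(1)] t(2)] .
  moreover have "\<forall>\<^sub>F z in sequentially. u < z" by (rule eventually_gt_at_top)
  ultimately have "\<forall>\<^sub>F z in sequentially. norm (W u z / W 0 z - 1) < r"
  proof eventually_elim
    case (elim z)
    then have W: "0 < W 0 z" "W u z \<le> W 0 z" by (auto intro!: W_pos W_le_W_0)
    have "pN z t u 0 * (W 0 z / W 0 z) \<le> (\<Sum>v<z. pN z t u v * (W v z / W 0 z))"
      using elim W_nonneg pN_nonneg[OF t(1)] by (intro member_le_sum) auto
    also have "\<dots> = exp (- 0 * t) * (W u z / W 0 z)"
    proof (rule pN_eigenfunction)
      fix y assume "y < z"
      have "(\<Sum>v<z. Q y v * (W v z / W 0 z)) = (\<Sum>v<z. Q y v * W v z) / W 0 z"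
        by (simp add: sum_divide_distrib)
      also have "\<dots> = 0" using Q_W[of y z] \<open>y < z\<close> by (cases "y = 0") (auto simp: row_0)
      finally show "(\<Sum>v<z. Q y v * (W v z / W 0 z)) = - 0 * (W y z / W 0 z)" by simp
    qed (use elim t in auto)
    finally have "1 - r < W u z / W 0 z" using elim W by simp
    moreover have "W u z / W 0 z \<le> 1" using W by simp
    ultimately show ?case by (simp add: abs_if)
  qed
  then show "\<exists>no. \<forall>n\<ge>no. norm (W u n / W 0 n - 1) < r" by (simp add: eventually_at_top_linorder)
qed

text \<open>Divide \<open>V_rec\<close> for \<open>V l 0 z\<close> by \<open>W 0 z\<close>: the
  weighted sum equals \<open>1 - V l 0 z / W 0 z\<close>, so it is at most 1. For fixed
  \<open>n\<close> the weights \<open>W u z / W 0 z\<close> tend to 1.\<close>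

lemma partial_mass_le_1:
  assumes l: "0 \<le> l" "ereal l \<le> lam0" shows "(\<Sum>u<n. l * V l 0 u) \<le> 1"
proof -
  have "(\<lambda>z. \<Sum>u<n. l * V l 0 u * (W u z / W 0 z)) \<longlonglongrightarrow> (\<Sum>u<n. l * V l 0 u * 1)"
    by (intro tendsto_intros W_ratio_tendsto)
  moreover have "(\<Sum>u<n. l * V l 0 u * (W u z / W 0 z)) \<le> 1" if "z \<ge> Suc n" for z
  proof -
    have W: "0 < W 0 z" using that by (auto intro!: W_pos)
    have "(\<Sum>u<n. l * V l 0 u * (W u z / W 0 z)) \<le> (\<Sum>u<z. l * V l 0 u * (W u z / W 0 z))"
      using that l V_nonneg[OF l] W_nonneg by (intro sum_mono2) auto
    also have "\<dots> = (l * (\<Sum>u<z. V l 0 u * W u z)) / W 0 z"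
      by (simp add: sum_distrib_left sum_divide_distrib mult.assoc)
    also have "\<dots> = (W 0 z - V l 0 z) / W 0 z" using V_rec[of l 0 z] by simp
    also have "\<dots> \<le> 1" using W V_nonneg[OF l, of 0 z] by simp
    finally show ?thesis .
  qed
  ultimately show ?thesis by (metis (no_types, lifting) LIMSEQ_le_const2 mult.right_neutral sum.cong)
qed

lemma mass_summable: 
  assumes l: "0 \<le> l" "ereal l \<le> lam0" 
  shows "summable (\<lambda>x. l * V l 0 x)" "(\<Sum>x. l * V l 0 x) \<le> 1"
proof -
  show s: "summable (\<lambda>x. l * V l 0 x)"
    using partial_mass_le_1[OF l] V_nonneg[OF l] l by (intro summableI_nonneg_bounded[of _ 1]) auto
  show "(\<Sum>x. l * V l 0 x) \<le> 1"
    using s partial_mass_le_1[OF l] by (rule suminf_le_const)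
qed

text \<open>If the mass \<open>m\<close> were below 1, \<open>V_rec\<close> and the bound of
  \<open>W u z\<close> by \<open>W 0 z\<close> would give \<open>(1 - m) * W 0 z\<close> at most
  \<open>V l 0 z\<close>, and the latter is summable.\<close>

lemma mass_eq_1_of_not_summable:
  assumes l: "0 < l" "ereal l \<le> lam0" and W: "\<not> summable (W 0)"
  shows "(\<lambda>x. l * V l 0 x) sums 1"
proof -
  have l0: "0 \<le> l" using l by simp
  define m where "m = (\<Sum>x. l * V l 0 x)"
  have "\<not> m < 1"
  proof
    assume m: "m < 1"
    have "norm (W 0 z) \<le> V l 0 z / (1 - m)" for z
    proof -
      have "l * (\<Sum>u<z. V l 0 u * W u z) \<le> (\<Sum>u<z. l * V l 0 u) * W 0 z"
        unfolding sum_distrib_left sum_distrib_right mult.assoc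
        using l V_nonneg[OF l0 l(2)] W_le_W_0 by (intro sum_mono mult_left_mono) auto
      also have "\<dots> \<le> m * W 0 z"
        unfolding m_def using mass_summable[OF l0 l(2)] l V_nonneg[OF l0 l(2)] W_nonneg
        by (intro mult_right_mono sum_le_suminf) auto
      finally have "W 0 z * (1 - m) \<le> V l 0 z" using V_rec[of l 0 z] by (simp add: algebra_simps)
      then show ?thesis using m W_nonneg[of 0 z] by (simp add: field_simps)
    qed
    moreover have "summable (\<lambda>z. V l 0 z / (1 - m))"
      using mass_summable(1)[OF l0 l(2)] l by (intro summable_divide) (simp add: summable_cmult_iff)
    ultimately show False using W by (metis summable_comparison_test')
  qed
  then show ?thesis using mass_summable[OF l0 l(2)] unfolding m_def by (simp add: sums_iff)
qed

end

section \<open>Quasi-stationary distributions of the transition semigroup\<close>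

context skip_free_transitions
begin

definition mix :: "(nat \<Rightarrow> real) \<Rightarrow> real \<Rightarrow> nat \<Rightarrow> real" where
  "mix v t y = (\<Sum>x. v x * p t x y)"

definition survival :: "(nat \<Rightarrow> real) \<Rightarrow> real \<Rightarrow> real" where
  "survival v t = (\<Sum>x. v x * (1 - p t x 0))"

text \<open>Multiplied out to avoid the quotient. The value at 0 is forced to be 0 because being
  alive at time \<open>t\<close> excludes state 0.\<close>

definition qsd :: "(nat \<Rightarrow> real) \<Rightarrow> bool" where
  "qsd v \<longleftrightarrow> (\<forall>x. 0 \<le> v x) \<and> v sums 1 \<and>
     (\<forall>t\<ge>0. 0 < survival v t \<and> (\<forall>y. v y * survival v t = (if y = 0 then 0 else mix v t y)))"

lemma mix_summable:
  assumes "\<And>x. 0 \<le> v x" "v sums 1" "0 \<le> t" shows "summable (\<lambda>x. v x * p t x y)"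
proof (rule summable_comparison_test'[of v 0])
  show "summable v" using assms(2) by (rule sums_summable)
  show "norm (v x * p t x y) \<le> v x" for x
    using assms(1)[of x] p_nonneg[OF assms(3), of x y] p_le_1[OF assms(3), of x y]
    by (simp add: abs_mult mult_left_le)
qed

lemma survival_eq:
  assumes "\<And>x. 0 \<le> v x" "v sums 1" "0 \<le> t" shows "survival v t = 1 - mix v t 0"
  using suminf_diff[OF _ mix_summable[OF assms, of 0], of v] assms(2)
  by (simp add: survival_def mix_def sums_iff right_diff_distrib)

lemma mix_lower:
  assumes "\<And>x. 0 \<le> v x" "v sums 1" "0 \<le> t" shows "v x * p t x y \<le> mix v t y"
  unfolding mix_def using sum_le_suminf[OF mix_summable[OF assms], of "{x}"] assms p_nonneg by auto

text \<open>Because column \<open>y\<close> of \<open>Q\<close> ends at row \<open>Suc y\<close>,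
  the right-hand side is a finite sum. So the integrated forward equation of the killed chain passes
  to the limit in \<open>N\<close> by dominated convergence; all masses are bounded by 1.\<close>

lemma mix_forward:
  assumes v: "\<And>x. 0 \<le> v x" "v sums 1" and t: "0 \<le> t"
  shows "((\<lambda>s. \<Sum>u\<le>Suc y. mix v s u * Q u y) has_integral (mix v t y - v y)) {0..t}"
proof -
  \<comment> \<open>The initial distribution is cut at the same level as the state space, so that
    \<open>pN_forward\<close> applies to each term.\<close>
  define a where "a N s u = (\<Sum>x<N. v x * pN N s x u)" for N s u
  have a_nonneg: "0 \<le> a N s u" if "0 \<le> s" for N s u
    unfolding a_def using v pN_nonneg[OF that] by (intro sum_nonneg) auto
  have pN_le_1: "pN N s x u \<le> 1" if "0 \<le> s" for N s x u
    using pN_le[OF that] p_le_1[OF that] order_trans by blast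
  have a_le: "a N s u \<le> 1" if "0 \<le> s" for N s u
  proof -
    have "a N s u \<le> (\<Sum>x<N. v x)"
      unfolding a_def using v(1) pN_le_1[OF that] by (intro sum_mono mult_left_le) auto
    also have "\<dots> \<le> 1" using v sum_le_suminf[of v "{..<N}"] by (auto simp: sums_iff)
    finally show ?thesis .
  qed
  \<comment> \<open>Tannery's theorem with dominating sequence \<open>v\<close> handles the cut and
    the limit of \<open>pN\<close> together.\<close>
  have a_lim: "(\<lambda>N. a N s u) \<longlonglongrightarrow> mix v s u" if s: "0 \<le> s" for s u
  proof -
    have "((\<lambda>N. \<Sum>x. if x < N then v x * pN N s x u else 0) \<longlongrightarrow> (\<Sum>x. v x * p s x u)) sequentially"
    proof (rule conjunct2[OF conjunct2[OF tannerys_theorem[where M=v]]])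
      fix x
      have "(\<lambda>N. v x * pN N s x u) \<longlonglongrightarrow> v x * p s x u"
        by (intro tendsto_intros pN_tendsto s)
      moreover have "\<forall>\<^sub>F N in sequentially. v x * pN N s x u = (if x < N then v x * pN N s x u else 0)"
        using eventually_gt_at_top[of x] by eventually_elim simp
      ultimately show "(\<lambda>N. if x < N then v x * pN N s x u else 0) \<longlonglongrightarrow> v x * p s x u"
        by (rule Lim_transform_eventually)
    next
      show "\<forall>\<^sub>F (x, N) in sequentially \<times>\<^sub>F sequentially. norm (if x < N then v x * pN N s x u else 0) \<le> v x"
      proof (rule always_eventually, clarify)
        fix x N
        show "norm (if x < N then v x * pN N s x u else 0) \<le> v x"
          using v(1)[of x] pN_nonneg[OF s, of N x u] pN_le_1[OF s, of N x u]
          by (auto simp: abs_mult mult_left_le)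
      qed
    qed (use v in \<open>auto simp: sums_iff\<close>)
    moreover have "(\<Sum>x. if x < N then v x * pN N s x u else 0) = a N s u" for N
      unfolding a_def by (subst suminf_finite[of "{..<N}"]) auto
    ultimately show ?thesis unfolding mix_def by simp
  qed
  \<comment> \<open>The shift by \<open>y + 2\<close> puts all of column \<open>y\<close> inside the
    block for every \<open>k\<close>.\<close>
  define f where "f k s = (\<Sum>u\<le>Suc y. a (k + (y + 2)) s u * Q u y)" for k s
  have f_int: "(f k has_integral (a (k + (y + 2)) t y - v y)) {0..t}" for k
  proof -
    define N where "N = k + (y + 2)"
    have N: "Suc y < N" "y < N" unfolding N_def by auto
    have "((\<lambda>s. \<Sum>u\<le>Suc y. a N s u * Q u y) has_integral (a N t y - a N 0 y)) {0..t}"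
    proof (rule fundamental_theorem_of_calculus[OF t])
      fix s assume s: "s \<in> {0..t}"
      have "((\<lambda>s. a N s y) has_real_derivative (\<Sum>x<N. v x * (\<Sum>u<N. pN N s x u * Q u y))) (at s within {0..t})"
        unfolding a_def using s N
        by (intro DERIV_sum DERIV_cmult DERIV_subset[OF pN_forward]) auto
      also have "(\<Sum>x<N. v x * (\<Sum>u<N. pN N s x u * Q u y)) = (\<Sum>u<N. a N s u * Q u y)"
        unfolding a_def sum_distrib_left sum_distrib_right by (subst sum.swap) (simp add: mult.assoc)
      also have "\<dots> = (\<Sum>u\<le>Suc y. a N s u * Q u y)"
        using N by (intro sum.mono_neutral_right) (auto simp: no_skip)
      finally show "((\<lambda>s. a N s y) has_vector_derivative (\<Sum>u\<le>Suc y. a N s u * Q u y)) (at s within {0..t})"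
        by (simp add: has_real_derivative_iff_has_vector_derivative)
    qed
    moreover have "a N 0 y = (\<Sum>x<N. if x = y then v x else 0)"
      unfolding a_def using N by (intro sum.cong) (auto simp: pN_0)
    ultimately show ?thesis unfolding f_def N_def[symmetric] using N(2) by (simp del: sum.atMost_Suc)
  qed
  have dom: "(\<lambda>s. \<Sum>u\<le>Suc y. mix v s u * Q u y) integrable_on {0..t}"
    "(\<lambda>k. integral {0..t} (f k)) \<longlonglongrightarrow> integral {0..t} (\<lambda>s. \<Sum>u\<le>Suc y. mix v s u * Q u y)"
  proof (rule_tac [!] dominated_convergence[where h="\<lambda>_. \<Sum>u\<le>Suc y. \<bar>Q u y\<bar>"])
    show "f k integrable_on {0..t}" for k using f_int by blast
    then show "f k integrable_on {0..t}" for k .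
    fix k s assume "s \<in> {0..t}"
    then have s: "0 \<le> s" by simp
    have "norm (f k s) \<le> (\<Sum>u\<le>Suc y. \<bar>a (k + (y + 2)) s u * Q u y\<bar>)"
      unfolding f_def real_norm_def by (rule sum_abs)
    also have "\<dots> \<le> (\<Sum>u\<le>Suc y. \<bar>Q u y\<bar>)"
      using a_nonneg[OF s] a_le[OF s] by (intro sum_mono) (simp add: abs_mult mult_left_le_one_le)
    finally show "norm (f k s) \<le> (\<Sum>u\<le>Suc y. \<bar>Q u y\<bar>)" .
    then show "norm (f k s) \<le> (\<Sum>u\<le>Suc y. \<bar>Q u y\<bar>)" .
  next
    fix s assume "s \<in> {0..t}"
    then show "(\<lambda>k. f k s) \<longlonglongrightarrow> (\<Sum>u\<le>Suc y. mix v s u * Q u y)"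
      unfolding f_def by (intro tendsto_sum tendsto_mult tendsto_const LIMSEQ_ignore_initial_segment a_lim) simp
    then show "(\<lambda>k. f k s) \<longlonglongrightarrow> (\<Sum>u\<le>Suc y. mix v s u * Q u y)" .
  qed (auto intro: integrable_const_ivl)
  have "integral {0..t} (f k) = a (k + (y + 2)) t y - v y" for k
    using f_int by (rule integral_unique)
  moreover have "(\<lambda>k. a (k + (y + 2)) t y - v y) \<longlonglongrightarrow> mix v t y - v y"
    by (intro tendsto_diff tendsto_const LIMSEQ_ignore_initial_segment a_lim t)
  ultimately have "integral {0..t} (\<lambda>s. \<Sum>u\<le>Suc y. mix v s u * Q u y) = mix v t y - v y"
    using dom(2) LIMSEQ_unique by (simp add: LIMSEQ_unique)
  then show ?thesis using dom(1) by (metis integrable_integral)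
qed

text \<open>Column \<open>u\<close> of the equation contains \<open>a (Suc u)\<close> with the
  positive coefficient \<open>Q (Suc u) u\<close> and otherwise only smaller entries. By
  \<open>V_Q\<close>, \<open>l * V l 0\<close> obeys the same recursion.\<close>

lemma left_eigenvector_unique:
  assumes "\<And>u. (\<Sum>z\<le>Suc u. a z * Q z u) = (if u = 0 then l else - l * a u)" "a 0 = 0"
  shows "a x = l * V l 0 x"
proof (induction x rule: less_induct)
  case (less x)
  show ?case
  proof (cases x)
    case 0
    then show ?thesis using assms(2) by simp
  next
    case (Suc u)
    have "(\<Sum>z\<le>Suc u. l * V l 0 z * Q z u) = l * (\<Sum>z\<le>Suc u. V l 0 z * Q z u)"
      by (simp add: sum_distrib_left mult.assoc del: sum.atMost_Suc)
    also have "\<dots> = (if u = 0 then l else - l * (l * V l 0 u))"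
      unfolding V_Q by auto
    also have "\<dots> = (\<Sum>z\<le>Suc u. a z * Q z u)"
      using assms less.IH[of u] Suc by simp
    finally have "(\<Sum>z\<le>u. l * V l 0 z * Q z u) + l * V l 0 (Suc u) * Q (Suc u) u =
        (\<Sum>z\<le>u. a z * Q z u) + a (Suc u) * Q (Suc u) u" by simp
    moreover have "(\<Sum>z\<le>u. l * V l 0 z * Q z u) = (\<Sum>z\<le>u. a z * Q z u)"
      using less.IH Suc by (intro sum.cong) auto
    ultimately show ?thesis using down_pos[of u] Suc by simp
  qed
qed

text \<open>Quasi-stationarity turns the integrand of \<open>mix_forward\<close> into
  \<open>survival v s\<close> times the constant \<open>c y\<close>. Column 0 then gives a linear
  integral equation for the survival probability, with exponential solution of rate
  \<open>l = c 0\<close>, and the other columns say that \<open>v\<close> is a left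
  eigenvector.\<close>

lemma qsd_imp:
  assumes "qsd v"
  shows "\<exists>l>0. ereal l \<le> lam0 \<and> v = (\<lambda>x. l * V l 0 x)"
proof -
  have v: "\<And>x. 0 \<le> v x" "v sums 1" and surv_pos: "\<And>t. 0 \<le> t \<Longrightarrow> 0 < survival v t"
    and inv: "\<And>t y. 0 \<le> t \<Longrightarrow> v y * survival v t = (if y = 0 then 0 else mix v t y)"
    using assms unfolding qsd_def by auto
  have v0: "v 0 = 0" using inv[of 0 0] surv_pos[of 0] by simp
  obtain x where x: "0 < v x"
    using v by (metis less_eq_real_def sums_0 sums_unique2 zero_neq_one)
  then have x1: "1 \<le> x" using v0 by (cases x) auto
  define c where "c y = (\<Sum>u\<le>Suc y. v u * Q u y)" for y
  have int: "((\<lambda>s. survival v s * c y) has_integral (mix v t y - v y)) {0..t}" if t: "0 \<le> t" for t y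
  proof (rule has_integral_eq[OF _ mix_forward[OF v t]])
    fix s assume s: "s \<in> {0..t}"
    show "(\<Sum>u\<le>Suc y. mix v s u * Q u y) = survival v s * c y"
      unfolding c_def sum_distrib_left
    proof (rule sum.cong[OF refl])
      fix u
      show "mix v s u * Q u y = survival v s * (v u * Q u y)"
        using inv[of s u] s by (cases "u = 0") (auto simp: row_0 algebra_simps)
    qed
  qed
  define l where "l = c 0"
  have surv: "survival v t = 1 - mix v t 0" if "0 \<le> t" for t
    using survival_eq[OF v that] .
  have l_nonneg: "0 \<le> l" unfolding l_def c_def using v off_diagonal by (auto simp: row_0)
  \<comment> \<open>With \<open>l = 0\<close> no mass would ever arrive at 0, although the state
    \<open>x\<close> charged by \<open>v\<close> is absorbed with positive probability.\<close>
  have "l \<noteq> 0"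
  proof
    assume "l = 0"
    have "mix v t 0 = 0" if "0 \<le> t" for t
      using has_integral_unique[OF int[OF that, of 0], of 0] \<open>l = 0\<close> v0 unfolding l_def by simp
    moreover have "\<forall>\<^sub>F t in at_top. p t x 0 > 0 \<and> t \<ge> 0"
      using order_tendstoD(1)[OF p_absorbed, of 0] eventually_ge_at_top[of 0]
      by (intro eventually_conj) auto
    then obtain t where "0 \<le> t" "p t x 0 > 0"
      by (metis (no_types, lifting) eventually_at_top_linorder order_refl)
    ultimately show False using mix_lower[OF v, of t x 0] x by (simp add: mult_le_0_iff)
  qed
  then have l: "0 < l" using l_nonneg by simp
  have surv_int: "survival v integrable_on {0..T}" if "0 \<le> T" for T
  proof -
    have "(\<lambda>s. survival v s * c 0) integrable_on {0..T}" using int[OF that, of 0] by blast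
    then have "(\<lambda>s. survival v s * c 0 * (1 / c 0)) integrable_on {0..T}" by (rule integrable_on_mult_left)
    then show ?thesis using l unfolding l_def by simp
  qed
  define J where "J t = integral {0..t} (survival v)" for t
  have mix_J: "mix v t y - v y = c y * J t" if "0 \<le> t" for t y
    using integral_unique[OF int[OF that, of y]] unfolding J_def by (simp add: mult.commute)
  have surv_J: "survival v t = 1 - l * J t" if "0 \<le> t" for t
    using surv[OF that] mix_J[OF that, of 0] v0 unfolding l_def by simp
  \<comment> \<open>\<open>survival v\<close> is so far only known to be integrable. Being affine in
    its own integral \<open>J\<close>, it is continuous, so \<open>J\<close> is differentiable and
    the integrating factor works.\<close>
  have surv_exp: "survival v t = exp (- l * t)" if t: "0 \<le> t" for t
  proof -
    have contJ: "continuous_on {0..t} J"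
      unfolding J_def by (rule indefinite_integral_continuous_1[OF surv_int[OF t]])
    have cont: "continuous_on {0..t} (survival v)"
    proof (subst continuous_on_cong[OF refl])
      show "survival v s = 1 - l * J s" if "s \<in> {0..t}" for s using surv_J that by simp
    qed (intro continuous_intros contJ)
    have "\<exists>c. \<forall>s\<in>{0..t}. exp (l * s) * (1 - l * J s) = c"
    proof (rule has_field_derivative_zero_constant)
      fix s assume s: "s \<in> {0..t}"
      have "(J has_real_derivative survival v s) (at s within {0..t})"
        unfolding J_def by (rule integral_has_real_derivative[OF cont s])
      moreover have "survival v s = 1 - l * J s" using surv_J s by simp
      ultimately show "((\<lambda>s. exp (l * s) * (1 - l * J s)) has_real_derivative 0) (at s within {0..t})"
        by (auto intro!: derivative_eq_intros simp: algebra_simps)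
    qed simp
    then have "exp (l * t) * (1 - l * J t) = exp (l * 0) * (1 - l * J 0)"
      using t by (metis atLeastAtMost_iff order_refl)
    then have "exp (l * t) * survival v t = 1" using surv_J[OF t] unfolding J_def by simp
    then show ?thesis by (simp add: exp_minus field_simps)
  qed
  have "(\<Sum>z\<le>Suc u. v z * Q z u) = (if u = 0 then l else - l * v u)" for u
  proof (cases "u = 0")
    case False
    \<comment> \<open>Time 1 serves as a time with \<open>J\<close> nonzero, so that
      \<open>J\<close> can be cancelled.\<close>
    have "v u * survival v 1 - v u = c u * J 1" using mix_J[of 1 u] inv[of 1 u] False by simp
    then have "c u * J 1 = (- l * v u) * J 1" using surv_J[of 1] by (simp add: algebra_simps)
    moreover have "survival v 1 < 1" using surv_exp[of 1] l by simp
    then have "J 1 \<noteq> 0" using surv_J[of 1] by auto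
    ultimately have "c u = - l * v u" by (metis mult_right_cancel)
    then show ?thesis using False unfolding c_def by simp
  qed (simp add: l_def c_def)
  then have "v = (\<lambda>x. l * V l 0 x)" by (intro ext left_eigenvector_unique v0)
  moreover have "ereal l \<le> lam0"
  proof (rule lam0_lower[OF l x1])
    fix t :: real assume t: "0 \<le> t"
    have "v x * p t x 0 + v x * (1 - p t x 0) = v x" by (simp add: algebra_simps)
    have "v x * (1 - p t x 0) \<le> survival v t"
      unfolding survival_def
    proof (rule order_trans[OF _ sum_le_suminf[of _ "{x}"]])
      show "summable (\<lambda>x. v x * (1 - p t x 0))"
        unfolding right_diff_distrib using mix_summable[OF v t, of 0] v(2)
        by (intro summable_diff) (auto simp: sums_iff)
    qed (use v p_le_1[OF t] in auto)
    then show "1 - p t x 0 \<le> (1 / v x) * exp (- l * t)"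
      using surv_exp[OF t] x by (simp add: field_simps)
  qed
  ultimately show ?thesis using l by auto
qed

text \<open>The bound \<open>mu\<close> is the flow that \<open>v\<close> should generate, and it
  solves the full forward equation. \<open>F s\<close>, which runs \<open>mu\<close> up to
  \<open>s\<close> and the killed chain for the remaining time, joins the killed mixture at
  \<open>s = 0\<close> to \<open>mu t\<close> at \<open>s = t\<close>. It is nondecreasing because
  the block omits only inflow from outside.\<close>

lemma mix_le:
  assumes l: "0 < l" and v: "v = (\<lambda>x. l * V l 0 x)" "\<And>x. 0 \<le> v x" "v sums 1" and t: "0 \<le> t"
  shows "mix v t y \<le> (if y = 0 then 1 - exp (- l * t) else exp (- l * t) * v y)"
proof -
  define mu where "mu s y = (if y = 0 then 1 - exp (- l * s) else exp (- l * s) * v y)" for s y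
  have mu_nonneg: "0 \<le> mu s y" if "0 \<le> s" for s y
    unfolding mu_def using v(2) l that by simp
  have v0: "v 0 = 0" using v(1) by simp
  have vQ: "(\<Sum>z\<le>Suc w. v z * Q z w) = (if w = 0 then l else - l * v w)" for w
  proof -
    have "(\<Sum>z\<le>Suc w. v z * Q z w) = l * (\<Sum>z\<le>Suc w. V l 0 z * Q z w)"
      by (simp add: v(1) sum_distrib_left mult.assoc del: sum.atMost_Suc)
    then show ?thesis unfolding V_Q by (auto simp: v(1))
  qed
  have muQ: "(\<Sum>z\<le>Suc w. mu s z * Q z w) = exp (- l * s) * (if w = 0 then l else - l * v w)" for s w
  proof -
    have "(\<Sum>z\<le>Suc w. mu s z * Q z w) = (\<Sum>z\<le>Suc w. exp (- l * s) * (v z * Q z w))"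
      by (intro sum.cong) (auto simp: mu_def row_0 v0)
    then show ?thesis by (simp only: sum_distrib_left[symmetric] vQ)
  qed
  have mu_deriv: "((\<lambda>s. mu s w) has_real_derivative (\<Sum>z\<le>Suc w. mu s z * Q z w)) (at s within A)" for s w A
    unfolding muQ unfolding mu_def by (cases "w = 0") (auto intro!: derivative_eq_intros)
  have fin: "(\<Sum>u<N. v u * pN N t u y) \<le> mu t y" if N: "y < N" for N
  proof -
    define F where "F s = (\<Sum>u<N. mu s u * pN N (t - s) u y)" for s
    define F' where "F' s = (\<Sum>w<N. ((\<Sum>z\<le>Suc w. mu s z * Q z w) - (\<Sum>z<N. mu s z * Q z w)) * pN N (t - s) w y)" for s
    have "F 0 \<le> F t"
    proof (rule nondecreasing_of_derivative_within[OF t, where f'=F'])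
      fix s assume s: "s \<in> {0..t}"
      have pN': "((\<lambda>s. pN N (t - s) u y) has_real_derivative - (\<Sum>w<N. Q u w * pN N (t - s) w y)) (at s within {0..t})"
        if u: "u < N" for u
      proof -
        have "((\<lambda>r. pN N r u y) has_real_derivative (\<Sum>w<N. Q u w * pN N (t - s) w y)) (at (t - s) within (\<lambda>s. t - s) ` {0..t})"
          using pN_backward[OF u N, of "t - s"] s by (intro DERIV_subset[OF pN_backward[OF u N]]) auto
        moreover have "((\<lambda>s. t - s) has_real_derivative - 1) (at s within {0..t})"
          by (auto intro!: derivative_eq_intros)
        ultimately show ?thesis using DERIV_image_chain[of "\<lambda>r. pN N r u y"] by (fastforce simp: o_def)
      qed
      have "(F has_real_derivative (\<Sum>u<N. (\<Sum>z\<le>Suc u. mu s z * Q z u) * pN N (t - s) u y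
          + - (\<Sum>w<N. Q u w * pN N (t - s) w y) * mu s u)) (at s within {0..t})"
        unfolding F_def by (intro DERIV_sum DERIV_mult mu_deriv pN') simp
      also have "(\<Sum>u<N. (\<Sum>z\<le>Suc u. mu s z * Q z u) * pN N (t - s) u y
          + - (\<Sum>w<N. Q u w * pN N (t - s) w y) * mu s u) = 
          (\<Sum>u<N. (\<Sum>z\<le>Suc u. mu s z * Q z u) * pN N (t - s) u y)
          - (\<Sum>u<N. \<Sum>w<N. mu s u * Q u w * pN N (t - s) w y)"
        by (simp add: sum.distrib sum_subtractf sum_negf sum_distrib_left sum_distrib_right mult_ac del: sum.atMost_Suc)
      also have "(\<Sum>u<N. \<Sum>w<N. mu s u * Q u w * pN N (t - s) w y) =
          (\<Sum>w<N. (\<Sum>u<N. mu s u * Q u w) * pN N (t - s) w y)"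
        by (subst sum.swap) (simp add: sum_distrib_right)
      finally show "(F has_real_derivative F' s) (at s within {0..t})"
        unfolding F'_def by (simp only: left_diff_distrib sum_subtractf)
      \<comment> \<open>Rows outside the block meet column \<open>w\<close> off the diagonal, so
        dropping them can only decrease the sum.\<close>
      have "(\<Sum>z<N. mu s z * Q z w) \<le> (\<Sum>z\<le>Suc w. mu s z * Q z w)" if w: "w < N" for w
      proof -
        have "Q z w = 0" if "z \<in> {..<N} - {..<N} \<inter> {..Suc w}" for z
          using that by (intro no_skip) auto
        then have "(\<Sum>z<N. mu s z * Q z w) = (\<Sum>z\<in>{..<N} \<inter> {..Suc w}. mu s z * Q z w)"
          by (intro sum.mono_neutral_right) auto
        also have "\<dots> \<le> (\<Sum>z\<le>Suc w. mu s z * Q z w)"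
          using s w mu_nonneg by (intro sum_mono2) (auto intro!: mult_nonneg_nonneg off_diagonal)
        finally show ?thesis .
      qed
      then show "0 \<le> F' s" unfolding F'_def using s
        by (intro sum_nonneg mult_nonneg_nonneg pN_nonneg) auto
    qed
    moreover have "F t = (\<Sum>u<N. if u = y then mu t u else 0)"
      unfolding F_def using N by (intro sum.cong) (auto simp: pN_0)
    moreover have "F 0 = (\<Sum>u<N. v u * pN N t u y)"
      unfolding F_def mu_def using v0 by (intro sum.cong) auto
    ultimately show ?thesis using N by simp
  qed
  have "(\<Sum>u<n. v u * p t u y) \<le> mu t y" for n
  proof (rule LIMSEQ_le_const2)
    show "(\<lambda>N. \<Sum>u<n. v u * pN N t u y) \<longlonglongrightarrow> (\<Sum>u<n. v u * p t u y)"
      by (intro tendsto_intros pN_tendsto t)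
    have "(\<Sum>u<n. v u * pN N t u y) \<le> mu t y" if "N \<ge> n + Suc y" for N
    proof -
      have "(\<Sum>u<n. v u * pN N t u y) \<le> (\<Sum>u<N. v u * pN N t u y)"
        using that v(2) pN_nonneg[OF t] by (intro sum_mono2) auto
      also have "\<dots> \<le> mu t y" using that by (intro fin) simp
      finally show ?thesis .
    qed
    then show "\<exists>N. \<forall>k\<ge>N. (\<Sum>u<n. v u * pN k t u y) \<le> mu t y" by blast
  qed
  then have "(\<Sum>u. v u * p t u y) \<le> mu t y"
    by (intro suminf_le_const mix_summable v(2,3) t)
  then show ?thesis unfolding mix_def mu_def .
qed

text \<open>Both sides of \<open>mix_le\<close> have total mass one, hence they agree.\<close>

lemma qsd_of_mass_1:
  assumes l: "0 < l" and v: "v = (\<lambda>x. l * V l 0 x)" "\<And>x. 0 \<le> v x" "v sums 1"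
  shows "qsd v"
proof -
  have v0: "v 0 = 0" using v(1) by simp
  have eq: "mix v t y = (if y = 0 then 1 - exp (- l * t) else exp (- l * t) * v y)" if t: "0 \<le> t" for t y
  proof -
    define mu where "mu y = (if y = 0 then 1 - exp (- l * t) else exp (- l * t) * v y)" for y
    have le: "mix v t y \<le> mu y" for y
      using mix_le[OF l v t] unfolding mu_def by simp
    have "(\<lambda>y. exp (- l * t) * v y) sums (exp (- l * t) * 1)" by (intro sums_mult v(3))
    moreover have "(\<lambda>y. if y = 0 then 1 - exp (- l * t) else 0) sums (1 - exp (- l * t))"
      using sums_single[of 0 "\<lambda>_. 1 - exp (- l * t)"] by simp
    ultimately have "(\<lambda>y. exp (- l * t) * v y + (if y = 0 then 1 - exp (- l * t) else 0)) sums (exp (- l * t) * 1 + (1 - exp (- l * t)))"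
      by (rule sums_add)
    moreover have "(\<lambda>y. exp (- l * t) * v y + (if y = 0 then 1 - exp (- l * t) else 0)) = mu"
      unfolding mu_def using v0 by auto
    ultimately have mu: "mu sums 1" by simp
    have mix_nonneg: "0 \<le> mix v t y" for y
      unfolding mix_def using mix_summable[OF v(2,3) t] v(2) p_nonneg[OF t] by (intro suminf_nonneg) auto
    have mix_s: "summable (mix v t)"
      using mu le mix_nonneg by (rule_tac summable_comparison_test'[of mu 0]) (auto simp: sums_iff)
    \<comment> \<open>No mass of the mixture is lost, because every row of \<open>p t\<close> has
      sum 1; summing over finitely many initial states avoids an interchange of two series.\<close>
    have "(\<Sum>x<n. v x) \<le> suminf (mix v t)" for n
    proof -
      have "(\<lambda>y. \<Sum>x<n. v x * p t x y) sums (\<Sum>x<n. v x * 1)"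
        by (intro sums_sum sums_mult p_sums t)
      moreover have "(\<Sum>x<n. v x * p t x y) \<le> mix v t y" for y
        unfolding mix_def using mix_summable[OF v(2,3) t] v(2) p_nonneg[OF t] by (intro sum_le_suminf) auto
      ultimately show ?thesis using sums_le[OF _ _ summable_sums[OF mix_s]] by fastforce
    qed
    then have "1 \<le> suminf (mix v t)"
      using v(3) suminf_le_const[of v "suminf (mix v t)"] by (auto simp: sums_iff)
    then have "(\<Sum>y. mu y - mix v t y) \<le> 0"
      using mu mix_s by (subst suminf_diff[symmetric]) (auto simp: sums_iff)
    moreover have s: "summable (\<lambda>y. mu y - mix v t y)"
      using mu mix_s by (intro summable_diff) (auto simp: sums_iff)
    ultimately have "mu y - mix v t y \<le> 0"
      using sum_le_suminf[OF s, of "{y}"] le by simp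
    then show ?thesis using le[of y] unfolding mu_def by linarith
  qed
  have surv: "survival v t = exp (- l * t)" if "0 \<le> t" for t
    using survival_eq[OF v(2,3) that] eq[OF that, of 0] by simp
  show ?thesis unfolding qsd_def using v surv eq v0 by (auto simp: mult.commute)
qed

theorem qsd_non_entrance:
  assumes "\<not> summable (W 0)"
  shows "Collect qsd = (\<lambda>l x. l * V l 0 x) ` {l. 0 < l \<and> ereal l \<le> lam0}"
proof (intro equalityI subsetI)
  fix v assume "v \<in> Collect qsd"
  then show "v \<in> (\<lambda>l x. l * V l 0 x) ` {l. 0 < l \<and> ereal l \<le> lam0}"
    using qsd_imp[of v] by auto
next
  fix v assume "v \<in> (\<lambda>l x. l * V l 0 x) ` {l. 0 < l \<and> ereal l \<le> lam0}"
  then obtain l where l: "0 < l" "ereal l \<le> lam0" "v = (\<lambda>x. l * V l 0 x)" by auto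
  have "qsd v"
    using mass_eq_1_of_not_summable[OF l(1,2) assms] V_nonneg[of l] l
    by (intro qsd_of_mass_1[of l]) auto
  then show "v \<in> Collect qsd" by simp
qed

end

section \<open>The entrance case\<close>

locale entrance_transitions = skip_free_transitions +
  assumes entrance: "summable (W 0)"
begin

definition tail :: "nat \<Rightarrow> real" where
  "tail z = suminf (W 0) - (\<Sum>u<z. W 0 u)"

definition Zn :: "nat \<Rightarrow> real \<Rightarrow> nat \<Rightarrow> real" where
  "Zn z l y = 1 - l * (\<Sum>u<z. V l y u)"

text \<open>Since \<open>Q V = I - l V\<close> and the rows of \<open>Q\<close> sum to 0, this is
  formally a solution of \<open>Q h = - l h\<close> on the rows above 0. The truncation
  \<open>Zn\<close> keeps the sums finite.\<close>

definition Z :: "real \<Rightarrow> nat \<Rightarrow> real" where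
  "Z l y = 1 - l * (\<Sum>u. V l y u)"

text \<open>A bound for the tail of the series in \<open>Z\<close>, uniform in the state and in
  parameters up to \<open>L\<close>; the exponential is the Gronwall constant of
  \<open>abs_V_le\<close>.\<close>

definition err :: "real \<Rightarrow> nat \<Rightarrow> real" where
  "err L z = L * exp (L * suminf (W 0)) * tail z"

lemma tail_nonneg: "0 \<le> tail z"
  unfolding tail_def using sum_le_suminf[OF entrance, of "{..<z}"] W_nonneg by auto

lemma tail_tendsto: "tail \<longlonglongrightarrow> 0"
proof -
  have "(\<lambda>z. suminf (W 0) - (\<Sum>u<z. W 0 u)) \<longlonglongrightarrow> suminf (W 0) - suminf (W 0)"
    by (intro tendsto_intros summable_LIMSEQ entrance)
  then show ?thesis unfolding tail_def by simp
qed

lemma err_tendsto: "err L \<longlonglongrightarrow> 0"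
proof -
  have "(\<lambda>z. L * exp (L * suminf (W 0)) * tail z) \<longlonglongrightarrow> L * exp (L * suminf (W 0)) * 0"
    by (intro tendsto_intros tail_tendsto)
  then show ?thesis unfolding err_def by simp
qed

lemma err_nonneg: "0 \<le> L \<Longrightarrow> 0 \<le> err L z"
  unfolding err_def using tail_nonneg by simp

section \<open>Uniform bounds on \<open>V\<close> and continuity of \<open>Z\<close>\<close>

lemma abs_V_le_partial:
  assumes l: "0 \<le> l" shows "\<bar>V l y z\<bar> \<le> W 0 z * (1 + l * (\<Sum>u<z. \<bar>V l y u\<bar>))"
proof -
  have "\<bar>V l y z\<bar> \<le> \<bar>W y z\<bar> + \<bar>l * (\<Sum>u<z. V l y u * W u z)\<bar>"
    using V_rec[of l y z] by linarith
  also have "\<bar>l * (\<Sum>u<z. V l y u * W u z)\<bar> \<le> l * (\<Sum>u<z. \<bar>V l y u\<bar> * W 0 z)"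
    unfolding abs_mult using l W_nonneg W_le_W_0
    by (intro mult_mono order_trans[OF sum_abs] sum_mono) (auto simp: abs_mult intro!: mult_left_mono)
  also have "\<bar>W y z\<bar> \<le> W 0 z" using W_nonneg W_le_W_0 by simp
  finally show ?thesis by (simp add: distrib_left sum_distrib_left mult_ac)
qed

text \<open>Discrete Gronwall: passing from \<open>z\<close> to \<open>Suc z\<close> multiplies the
  left side by at most \<open>1 + l * W 0 z\<close>. The bound does not depend on \<open>y\<close>
  because \<open>W y z\<close> is at most \<open>W 0 z\<close>.\<close>

lemma sum_abs_V_le:
  assumes l: "0 \<le> l" shows "1 + l * (\<Sum>u<z. \<bar>V l y u\<bar>) \<le> exp (l * (\<Sum>u<z. W 0 u))"
proof (induction z)
  case 0
  then show ?case by simp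
next
  case (Suc z)
  define S where "S = 1 + l * (\<Sum>u<z. \<bar>V l y u\<bar>)"
  have S: "0 \<le> S" unfolding S_def using l by (auto intro!: add_nonneg_nonneg mult_nonneg_nonneg sum_nonneg)
  have "1 + l * (\<Sum>u<Suc z. \<bar>V l y u\<bar>) = S + l * \<bar>V l y z\<bar>"
    unfolding S_def by (simp add: algebra_simps)
  also have "\<dots> \<le> S + l * (W 0 z * S)"
    using abs_V_le_partial[OF l, of y z] l unfolding S_def by (intro add_left_mono mult_left_mono) auto
  also have "\<dots> = S * (1 + l * W 0 z)" by (simp add: algebra_simps)
  also have "\<dots> \<le> exp (l * (\<Sum>u<z. W 0 u)) * exp (l * W 0 z)"
    using Suc S exp_ge_add_one_self[of "l * W 0 z"] l W_nonneg unfolding S_def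
    by (intro mult_mono) auto
  finally show ?case by (simp add: mult_exp_exp algebra_simps)
qed

lemma abs_V_le:
  assumes l: "0 \<le> l" "l \<le> L" shows "\<bar>V l y z\<bar> \<le> exp (L * suminf (W 0)) * W 0 z"
proof -
  have "l * (\<Sum>u<z. W 0 u) \<le> L * suminf (W 0)"
    using l sum_le_suminf[OF entrance, of "{..<z}"] W_nonneg
    by (intro mult_mono sum_nonneg) auto
  then have "1 + l * (\<Sum>u<z. \<bar>V l y u\<bar>) \<le> exp (L * suminf (W 0))"
    using sum_abs_V_le[OF l(1), where z=z and y=y] by (meson exp_le_cancel_iff order_trans)
  then have "W 0 z * (1 + l * (\<Sum>u<z. \<bar>V l y u\<bar>)) \<le> W 0 z * exp (L * suminf (W 0))"
    using W_nonneg by (rule mult_left_mono)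
  then show ?thesis using abs_V_le_partial[OF l(1), of y z] by (simp add: mult.commute)
qed

lemma V_summable: "0 \<le> l \<Longrightarrow> summable (V l y)"
  by (rule summable_comparison_test'[of "\<lambda>z. exp (l * suminf (W 0)) * W 0 z"])
    (auto intro!: summable_mult entrance simp: abs_V_le)

lemma Z_diff_le:
  assumes l: "0 \<le> l" "l \<le> L" shows "\<bar>Z l y - Zn z l y\<bar> \<le> err L z"
proof -
  have s: "summable (\<lambda>u. V l y (u + z))" using V_summable[OF l(1), of y] by (rule summable_ignore_initial_segment)
  have sW: "summable (\<lambda>u. exp (L * suminf (W 0)) * W 0 (u + z))"
    using summable_ignore_initial_segment[OF entrance, of z] by (rule summable_mult)
  have "(\<Sum>u. V l y u) = (\<Sum>u. V l y (u + z)) + (\<Sum>u<z. V l y u)"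
    using V_summable[OF l(1)] by (rule suminf_split_initial_segment)
  then have "\<bar>Z l y - Zn z l y\<bar> = l * \<bar>\<Sum>u. V l y (u + z)\<bar>"
    unfolding Z_def Zn_def using l by (simp add: right_diff_distrib[symmetric] abs_mult algebra_simps)
  also have "\<bar>\<Sum>u. V l y (u + z)\<bar> \<le> (\<Sum>u. exp (L * suminf (W 0)) * W 0 (u + z))"
    using norm_suminf_le[of "\<lambda>u. V l y (u + z)" "\<lambda>u. exp (L * suminf (W 0)) * W 0 (u + z)"]
      abs_V_le[OF l] sW by simp
  also have "(\<Sum>u. exp (L * suminf (W 0)) * W 0 (u + z)) = exp (L * suminf (W 0)) * tail z"
    using suminf_minus_initial_segment[OF entrance, of z]
    by (subst suminf_mult[OF summable_ignore_initial_segment[OF entrance]]) (simp add: tail_def)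
  also have "l * (exp (L * suminf (W 0)) * tail z) \<le> L * (exp (L * suminf (W 0)) * tail z)"
    using l tail_nonneg by (intro mult_right_mono) auto
  finally show ?thesis unfolding err_def using l by (simp add: mult_left_mono mult.assoc)
qed

lemma Zn_self: "z \<le> Suc y \<Longrightarrow> Zn z l y = 1"
  unfolding Zn_def by (simp add: sum.neutral)

text \<open>\<open>Z\<close> tends to 1 at infinity uniformly for \<open>l\<close> in a bounded
  interval, so its sign is in question at finitely many states only.\<close>

lemma Z_near_1: "0 \<le> l \<Longrightarrow> l \<le> L \<Longrightarrow> \<bar>Z l y - 1\<bar> \<le> err L y"
  using Z_diff_le[of l L y y] by (simp add: Zn_self)

lemma Zn_tendsto: "0 \<le> l \<Longrightarrow> (\<lambda>z. Zn z l y) \<longlonglongrightarrow> Z l y"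
  unfolding Zn_def Z_def by (intro tendsto_intros summable_LIMSEQ V_summable)

text \<open>A uniform limit of polynomials in \<open>l\<close>.\<close>

lemma Z_continuous: "continuous_on {0..L} (\<lambda>l. Z l y)"
proof (rule uniform_limit_theorem[where f="\<lambda>z l. Zn z l y" and F=sequentially])
  show "\<forall>\<^sub>F z in sequentially. continuous_on {0..L} (\<lambda>l. Zn z l y)"
    unfolding Zn_def by (intro always_eventually allI continuous_intros)
  show "uniform_limit {0..L} (\<lambda>z l. Zn z l y) (\<lambda>l. Z l y) sequentially"
  proof (rule uniform_limitI)
    fix e :: real assume "0 < e"
    have "\<forall>\<^sub>F z in sequentially. err L z < e" using order_tendstoD(2)[OF err_tendsto \<open>0 < e\<close>] .
    then show "\<forall>\<^sub>F z in sequentially. \<forall>l\<in>{0..L}. dist (Zn z l y) (Z l y) < e"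
    proof eventually_elim
      case (elim z)
      then show ?case using Z_diff_le[of _ L y z] by (force simp: dist_real_def abs_minus_commute)
    qed
  qed
qed simp

text \<open>The equation for \<open>Z\<close> holds exactly except for the row sum of
  \<open>Q\<close> cut at \<open>z\<close>, which is nonpositive.\<close>

lemma Q_Zn:
  assumes y: "0 < y" "y < z" shows "(\<Sum>v<z. Q y v * Zn z l v) \<le> - l * Zn z l y"
proof -
  have "(\<Sum>v<z. Q y v * Zn z l v) = (\<Sum>v<z. Q y v) - l * (\<Sum>v<z. \<Sum>u<z. Q y v * V l v u)"
    unfolding Zn_def by (simp add: right_diff_distrib sum_subtractf sum_distrib_left mult_ac)
  also have "(\<Sum>v<z. \<Sum>u<z. Q y v * V l v u) = (\<Sum>u<z. (if y = u then 1 else 0) - l * V l y u)"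
    using y by (subst sum.swap) (intro sum.cong refl Q_V'; simp)
  also have "\<dots> = Zn z l y"
    unfolding Zn_def using y by (simp add: sum_subtractf sum_distrib_left)
  finally show ?thesis using row_partial_sum_nonpos[OF y(2)] by simp
qed

text \<open>Positivity together with the limit 1 at infinity bounds \<open>Z l\<close> away from 0.
  So the truncations are eventually bounded below by a positive constant, and a supersolution
  bounded below on the states above 0 forces the survival probability to decay at rate
  \<open>l\<close>.\<close>

lemma le_lam0_of_Z_pos:
  assumes l: "0 < l" and pos: "\<And>y. 0 < Z l y"
  shows "ereal l \<le> lam0"
proof -
  have l0: "0 \<le> l" using l by simp
  have "\<forall>\<^sub>F y in sequentially. err l y < 1 / 2" by (rule order_tendstoD(2)[OF err_tendsto]) simp
  then obtain Y where Y: "\<And>y. Y \<le> y \<Longrightarrow> err l y < 1 / 2" by (auto simp: eventually_at_top_linorder)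
  \<comment> \<open>The minimum of the finitely many values below \<open>Y\<close> and of
    \<open>1 / 2\<close>, which takes care of the rest.\<close>
  define e where "e = Min (insert (1 / 2) (Z l ` {..<Y}))"
  have e0: "0 < e" unfolding e_def using pos by (subst Min_gr_iff) auto
  have e: "e \<le> Z l y" for y
  proof (cases "y < Y")
    case True
    then show ?thesis unfolding e_def by (intro Min_le) auto
  next
    case False
    then have "1 / 2 \<le> Z l y" using Z_near_1[OF l0 order_refl, of y] Y[of y] by linarith
    moreover have "e \<le> 1 / 2" unfolding e_def by (intro Min_le) auto
    ultimately show ?thesis by linarith
  qed
  have "\<forall>\<^sub>F z in sequentially. err l z < e / 2" using e0 by (intro order_tendstoD(2)[OF err_tendsto]) simp
  then obtain z0 where z0: "\<And>z. z0 \<le> z \<Longrightarrow> err l z < e / 2" by (auto simp: eventually_at_top_linorder)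
  have Zn: "e / 2 \<le> Zn z l y" if "z0 \<le> z" for z y
    using Z_diff_le[OF l0 order_refl, of y z] z0[OF that] e[of y] by linarith
  define M where "M = Z l 1 + e / 2"
  have key: "(\<Sum>v\<in>{1..<n}. pN z t 1 v) \<le> 2 / e * (exp (- l * t) * M)"
    if t: "0 \<le> t" and z: "z0 \<le> z" "n \<le> z" "1 < z" for n z t
  proof -
    \<comment> \<open>Setting the value at 0 to 0 makes row 0 an equality and only lowers the sums
      in the other rows, since \<open>Q y 0\<close> is nonnegative there.\<close>
    define h where "h v = (if v = 0 then 0 else Zn z l v)" for v
    have "(\<Sum>v<z. pN z t 1 v * h v) \<le> exp (- l * t) * h 1"
    proof (rule pN_supersolution[OF _ t z(3)])
      fix y assume y: "y < z"
      show "(\<Sum>v<z. Q y v * h v) \<le> - l * h y"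
      proof (cases "y = 0")
        case False
        have "(\<Sum>v<z. Q y v * h v) \<le> (\<Sum>v<z. Q y v * Zn z l v)"
        proof (rule sum_mono)
          fix v
          show "Q y v * h v \<le> Q y v * Zn z l v"
            using Zn[OF z(1), of 0] e0 off_diagonal[of y 0] False unfolding h_def by auto
        qed
        also have "\<dots> \<le> - l * Zn z l y" using False y by (intro Q_Zn) auto
        finally show ?thesis using False unfolding h_def by simp
      qed (simp add: h_def row_0)
    qed
    also have "h 1 \<le> M" unfolding h_def M_def
      using Z_diff_le[OF l0 order_refl, of 1 z] z0[OF z(1)] by simp
    finally have 1: "(\<Sum>v<z. pN z t 1 v * h v) \<le> exp (- l * t) * M" by simp
    have "e / 2 * (\<Sum>v\<in>{1..<n}. pN z t 1 v) \<le> (\<Sum>v\<in>{1..<n}. pN z t 1 v * h v)"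
      unfolding sum_distrib_left h_def
    proof (rule sum_mono)
      fix v assume "v \<in> {1..<n}"
      then show "e / 2 * pN z t 1 v \<le> pN z t 1 v * (if v = 0 then 0 else Zn z l v)"
        using mult_right_mono[OF Zn[OF z(1), of v] pN_nonneg[OF t, of z 1 v]]
        by (simp add: mult.commute)
    qed
    also have "\<dots> \<le> (\<Sum>v<z. pN z t 1 v * h v)"
      using z pN_nonneg[OF t] Zn[OF z(1)] e0 unfolding h_def
      by (intro sum_mono2) (auto intro!: mult_nonneg_nonneg intro: order_trans[of 0 "e / 2"])
    finally show ?thesis using 1 e0 by (simp add: field_simps)
  qed
  show ?thesis
  proof (rule lam0_lower[OF l order_refl])
    fix t :: real assume t: "0 \<le> t"
    have fin: "(\<Sum>v\<in>{1..<n}. p t 1 v) \<le> 2 / e * (exp (- l * t) * M)" for n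
    proof (rule LIMSEQ_le_const2)
      show "(\<lambda>N. \<Sum>v\<in>{1..<n}. pN N t 1 v) \<longlonglongrightarrow> (\<Sum>v\<in>{1..<n}. p t 1 v)"
        by (intro tendsto_intros pN_tendsto t)
      show "\<exists>N. \<forall>k\<ge>N. (\<Sum>v\<in>{1..<n}. pN k t 1 v) \<le> 2 / e * (exp (- l * t) * M)"
        using key[OF t] by (intro exI[of _ "max z0 (max n 2)"]) auto
    qed
    have "(\<lambda>n. p t 1 (Suc n)) sums (1 - p t 1 0)"
      using p_sums[OF t, of 1] sums_Suc_iff[of "p t 1"] by simp
    moreover have "(\<Sum>v<n. p t 1 (Suc v)) \<le> 2 / e * (exp (- l * t) * M)" for n
    proof -
      have "(\<Sum>v\<in>{1..<Suc n}. p t 1 v) = (\<Sum>v<n. p t 1 (Suc v))"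
        unfolding One_nat_def sum.shift_bounds_Suc_ivl by (simp add: atLeast0LessThan)
      then show ?thesis using fin[of "Suc n"] by linarith
    qed
    ultimately show "1 - p t 1 0 \<le> (2 / e * M) * exp (- l * t)"
      using suminf_le_const[of "\<lambda>n. p t 1 (Suc n)" "2 / e * (exp (- l * t) * M)"]
      by (simp add: sums_iff mult_ac)
  qed
qed

text \<open>\<open>down_step\<close> applied to the truncations, whose values are at least
  \<open>- err k z\<close>; then \<open>z\<close> tends to infinity and the error
  disappears.\<close>

lemma Z_zero_down:
  assumes k: "0 \<le> k" and nonneg: "\<And>y. 0 \<le> Z k y" and zero: "Z k (Suc x) = 0"
  shows "Z k x = 0"
proof -
  have "Q (Suc x) x * Z k x \<le> - (k + Q (Suc x) (Suc x)) * Z k (Suc x) - 0 * Q (Suc x) (Suc x)"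
  proof (rule LIMSEQ_le)
    show "(\<lambda>z. Q (Suc x) x * Zn z k x) \<longlonglongrightarrow> Q (Suc x) x * Z k x"
      by (intro tendsto_intros Zn_tendsto k)
    show "(\<lambda>z. - (k + Q (Suc x) (Suc x)) * Zn z k (Suc x) - err k z * Q (Suc x) (Suc x)) \<longlonglongrightarrow>
        - (k + Q (Suc x) (Suc x)) * Z k (Suc x) - 0 * Q (Suc x) (Suc x)"
      by (intro tendsto_intros Zn_tendsto err_tendsto k)
    have "Q (Suc x) x * Zn z k x \<le> - (k + Q (Suc x) (Suc x)) * Zn z k (Suc x) - err k z * Q (Suc x) (Suc x)"
      if "Suc (Suc x) \<le> z" for z
    proof (rule down_step[where z=z])
      show "- err k z \<le> Zn z k v" for v
        using Z_diff_le[OF k order_refl, of v z] nonneg[of v] by linarith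
    qed (use that err_nonneg k Q_Zn[of "Suc x" z] in auto)
    then show "\<exists>N. \<forall>z\<ge>N. Q (Suc x) x * Zn z k x \<le> - (k + Q (Suc x) (Suc x)) * Zn z k (Suc x) - err k z * Q (Suc x) (Suc x)"
      by blast
  qed
  then have "Q (Suc x) x * Z k x \<le> 0" using zero by simp
  then show ?thesis using nonneg[of x] down_pos[of x] by (simp add: mult_le_0_iff)
qed

text \<open>Beyond the finite \<open>lam0\<close> the function \<open>Z\<close> cannot be positive
  everywhere, by \<open>le_lam0_of_Z_pos\<close>, so a first zero exists. \<open>Z_zero_down\<close>
  carries it to state 0.\<close>

lemma Z_first_zero:
  obtains k where "0 < k" "\<And>l y. 0 \<le> l \<Longrightarrow> l < k \<Longrightarrow> 0 < Z l y" "\<And>y. 0 \<le> Z k y" "Z k 0 = 0"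
proof -
  obtain L where L: "lam0 = ereal L" "0 \<le> L"
    using lam0_nonneg lam0_finite by (cases lam0) auto
  have "\<not> (\<forall>y. 0 < Z (L + 1) y)"
    using le_lam0_of_Z_pos[of "L + 1"] L by auto
  then obtain y1 where y1: "Z (L + 1) y1 \<le> 0" by (auto simp: not_less)
  obtain k y where k: "0 < k" "k \<le> L + 1" "\<And>l y. 0 \<le> l \<Longrightarrow> l < k \<Longrightarrow> 0 < Z l y"
    "\<And>y. 0 \<le> Z k y" "Z k y = 0"
  proof (rule first_zero[of Z "L + 1" y1])
    show "\<exists>Y. \<forall>y\<ge>Y. \<forall>l\<in>{0..K}. 0 < Z l y" for K
    proof -
      have "\<forall>\<^sub>F y in sequentially. err K y < 1" by (rule order_tendstoD(2)[OF err_tendsto]) simp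
      then obtain Y where Y: "\<And>y. Y \<le> y \<Longrightarrow> err K y < 1" by (auto simp: eventually_at_top_linorder)
      have "0 < Z l y" if "Y \<le> y" "l \<in> {0..K}" for l y
        using Z_near_1[of l K y] Y[OF that(1)] that by auto
      then show ?thesis by blast
    qed
    show "continuous_on {0..K} (\<lambda>l. Z l y)" for y K by (rule Z_continuous)
    show "0 < Z 0 y" for y by (simp add: Z_def)
    show "0 \<le> L + 1" using L by simp
    show "Z (L + 1) y1 \<le> 0" by fact
  qed (rule that)
  have "Z k u = 0" if "u \<le> y" for u
    using that
  proof (induction u rule: inc_induct)
    case (step u)
    then show ?case using Z_zero_down[of k u] k(1,4) by simp
  qed (use k(5) in simp)
  then have "Z k 0 = 0" by simp
  then show ?thesis using that[of k] k(1,3,4) by blast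
qed

text \<open>For \<open>l\<close> strictly between \<open>k\<close> and \<open>lam0\<close>, the
  masses of \<open>l * V l 0\<close> and \<open>k * V k 0\<close> differ by \<open>(l - k)\<close>
  times the sum of \<open>V l 0 u * Z k u\<close>. The first mass is at most 1, the second equals 1
  because \<open>Z k 0 = 0\<close>, and the sum has a positive term.\<close>

lemma lam0_le_Z_zero:
  assumes k: "0 < k" "\<And>y. 0 \<le> Z k y" "Z k 0 = 0"
  shows "lam0 \<le> ereal k"
proof (rule ccontr)
  assume "\<not> lam0 \<le> ereal k"
  then obtain l where kl: "k < l" "ereal l < lam0"
    using ereal_dense2[of "ereal k" lam0] by (auto simp: not_le)
  have l: "0 \<le> l" "ereal l \<le> lam0" using k kl by auto
  have "\<forall>\<^sub>F y in sequentially. err k y < 1" by (rule order_tendstoD(2)[OF err_tendsto]) simp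
  moreover have "\<forall>\<^sub>F y in sequentially. 0 < y" by (rule eventually_gt_at_top)
  ultimately have "\<forall>\<^sub>F y in sequentially. err k y < 1 \<and> 0 < y" by eventually_elim simp
  then obtain y where y: "err k y < 1" "0 < y" by (auto simp: eventually_at_top_linorder)
  have Zy: "0 < Z k y" using Z_near_1[of k k y] k(1) y by auto
  have Vy: "0 < V l 0 y" using V_pos[of l 0 y] l kl y by simp
  define a where "a n = (\<Sum>u<n. V l 0 u)" for n
  define b where "b n = (\<Sum>u<n. V k 0 u)" for n
  define r where "r n = (\<Sum>u<n. V l 0 u * Zn n k u)" for n
  have V0: "0 \<le> V l 0 u" for u using V_nonneg[OF l] .
  have la: "l * a n \<le> 1" for n
    using partial_mass_le_1[OF l, of n] unfolding a_def by (simp add: sum_distrib_left)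
  have a_nonneg: "0 \<le> a n" for n unfolding a_def using V0 by (intro sum_nonneg) auto
  have kb: "(\<lambda>n. k * b n) \<longlonglongrightarrow> 1"
  proof -
    have "(\<lambda>n. 1 - Zn n k 0) \<longlonglongrightarrow> 1 - Z k 0" using k by (intro tendsto_intros Zn_tendsto) simp
    then show ?thesis unfolding Zn_def b_def using k by simp
  qed
  \<comment> \<open>The resolvent identity summed over \<open>z < n\<close>; the inner sum over
    columns is, up to a factor, \<open>1 - Zn n k u\<close>.\<close>
  have id: "l * a n - k * b n = (l - k) * r n" for n
  proof -
    have "a n - b n = (\<Sum>z<n. (k - l) * (\<Sum>u<z. V l 0 u * V k u z))"
      unfolding a_def b_def by (simp add: sum_subtractf[symmetric] resolvent_identity)
    also have "\<dots> = (k - l) * (\<Sum>z<n. \<Sum>u<n. V l 0 u * V k u z)"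
      unfolding sum_distrib_left[symmetric]
      by (intro arg_cong[where f="(*) (k - l)"] sum.cong refl sum.mono_neutral_left) auto
    also have "(\<Sum>z<n. \<Sum>u<n. V l 0 u * V k u z) = (\<Sum>u<n. V l 0 u * (\<Sum>z<n. V k u z))"
      by (subst sum.swap) (simp add: sum_distrib_left)
    finally have "k * (a n - b n) = (k - l) * (\<Sum>u<n. V l 0 u * (k * (\<Sum>z<n. V k u z)))"
      by (simp add: sum_distrib_left mult_ac)
    also have "(\<Sum>u<n. V l 0 u * (k * (\<Sum>z<n. V k u z))) = a n - r n"
      unfolding a_def r_def Zn_def by (simp add: right_diff_distrib sum_subtractf)
    finally show ?thesis by (simp add: algebra_simps)
  qed
  \<comment> \<open>The right-hand side is the termwise limit of the defect
    \<open>1 - k * b n\<close> plus the truncation error.\<close>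
  have "(l - k) * (V l 0 y * Z k y) \<le> 1 - 1 + (l - k) * (0 / l)"
  proof (rule LIMSEQ_le_const)
    show "(\<lambda>n. 1 - k * b n + (l - k) * (err k n / l)) \<longlonglongrightarrow> 1 - 1 + (l - k) * (0 / l)"
      using kl k by (intro tendsto_intros kb err_tendsto) auto
    have "(l - k) * (V l 0 y * Z k y) \<le> 1 - k * b n + (l - k) * (err k n / l)" if n: "Suc y \<le> n" for n
    proof -
      have Zle: "Z k u \<le> Zn n k u + err k n" for u
        using Z_diff_le[of k k u n] k(1) by linarith
      have "V l 0 y * Z k y \<le> (\<Sum>u<n. V l 0 u * Z k u)"
        using n V0 k by (intro member_le_sum) auto
      also have "\<dots> \<le> (\<Sum>u<n. V l 0 u * (Zn n k u + err k n))"
        using Zle V0 by (intro sum_mono mult_left_mono) auto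
      also have "\<dots> = r n + a n * err k n"
        unfolding r_def a_def by (simp add: distrib_left sum.distrib sum_distrib_right)
      also have "a n * err k n \<le> (1 / l) * err k n"
        using la[of n] kl k err_nonneg[of k n] by (intro mult_right_mono) (auto simp: field_simps)
      finally have "(l - k) * (V l 0 y * Z k y) \<le> (l - k) * (r n + err k n / l)"
        using kl by (intro mult_left_mono) auto
      also have "\<dots> \<le> 1 - k * b n + (l - k) * (err k n / l)"
        using id[of n] la[of n] by (simp add: distrib_left)
      finally show ?thesis .
    qed
    then show "\<exists>N. \<forall>n\<ge>N. (l - k) * (V l 0 y * Z k y) \<le> 1 - k * b n + (l - k) * (err k n / l)" by blast
  qed
  moreover have "0 < (l - k) * (V l 0 y * Z k y)" using kl Vy Zy by simp
  ultimately show False by simp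
qed

text \<open>Mass one for \<open>l * V l 0\<close> means \<open>Z l 0 = 0\<close>, and on
  \<open>(0, k]\<close> this happens only at \<open>k\<close>, which equals
  \<open>lam0\<close>.\<close>

theorem qsd_entrance: "\<exists>l0. lam0 = ereal l0 \<and> 0 < l0 \<and> Collect qsd = {\<lambda>x. l0 * V l0 0 x}"
proof -
  obtain k where k: "0 < k" "\<And>l y. 0 \<le> l \<Longrightarrow> l < k \<Longrightarrow> 0 < Z l y" "\<And>y. 0 \<le> Z k y" "Z k 0 = 0"
    using Z_first_zero by metis
  obtain L where L: "lam0 = ereal L" "0 \<le> L"
    using lam0_nonneg lam0_finite by (cases lam0) auto
  have "L \<le> k" using lam0_le_Z_zero[OF k(1,3,4)] L by simp
  moreover have "k \<le> L"
  proof (rule dense_le_bounded[OF k(1)])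
    fix l assume "0 < l" "l < k"
    then show "l \<le> L" using le_lam0_of_Z_pos[of l] k(2)[of l] L by simp
  qed
  ultimately have lam: "lam0 = ereal k" using L by simp
  have mass: "Z l 0 = 0 \<longleftrightarrow> (\<lambda>x. l * V l 0 x) sums 1" if "0 \<le> l" for l
    unfolding Z_def sums_iff using V_summable[OF that, of 0]
    by (auto simp: suminf_mult intro: summable_mult)
  have "v = (\<lambda>x. k * V k 0 x)" if v: "qsd v" for v
  proof -
    obtain l where l: "0 < l" "ereal l \<le> lam0" "v = (\<lambda>x. l * V l 0 x)" using qsd_imp[OF v] by auto
    have "Z l 0 = 0" using mass[of l] l v unfolding qsd_def by simp
    then have "\<not> l < k" using k(2)[of l 0] l by auto
    then show ?thesis using l lam by simp
  qed
  moreover have "qsd (\<lambda>x. k * V k 0 x)"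
  proof (rule qsd_of_mass_1[OF k(1) refl])
    show "0 \<le> k * V k 0 x" for x using V_nonneg[of k 0 x] lam k(1) by simp
    show "(\<lambda>x. k * V k 0 x) sums 1" using mass[of k] k(1,4) by simp
  qed
  ultimately have "Collect qsd = {\<lambda>x. k * V k 0 x}" by blast
  then show ?thesis using lam k(1) by blast
qed

end

section \<open>Path properties\<close>

lemma grid_point:
  fixes h r :: real
  assumes "0 < h" "0 \<le> r"
  obtains i :: nat where "r \<le> i * h" "i * h < r + h" "\<And>j. j < i \<Longrightarrow> j * h < r"
proof -
  have ex: "\<exists>i::nat. r \<le> i * h"
    using reals_Archimedean2[of "r / h"] assms by (auto simp: field_simps intro: less_imp_le)
  define i where "i = (LEAST i::nat. r \<le> i * h)"
  have i: "r \<le> i * h" unfolding i_def using ex by (rule LeastI_ex)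
  have less: "j * h < r" if "j < i" for j :: nat
    using not_less_Least[of j "\<lambda>i. r \<le> real i * h"] that unfolding i_def by auto
  have "i * h < r + h"
  proof (cases i)
    case 0
    then show ?thesis using assms by simp
  next
    case (Suc j)
    then show ?thesis using less[of j] by (simp add: algebra_simps)
  qed
  then show ?thesis using that i less by blast
qed

context killed_markov_chain
begin

definition \<Omega> :: "'w set" where "\<Omega> = space (P 0)"

lemma space_P [simp]: "space (P x) = \<Omega>"
  unfolding \<Omega>_def using sets_P sets_eq_imp_space_eq by blast

sublocale P: prob_space "P x" for x by (rule prob_space_P)

lemma sets_X: "0 \<le> t \<Longrightarrow> {\<omega> \<in> \<Omega>. X t \<omega> \<in> B} \<in> sets (P x)"
  using measurable_sets[OF measurable_X[of t x], of B] space_P[of x]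
  by (simp add: vimage_def Int_def conj_commute)

lemma sets_X_eq: "0 \<le> t \<Longrightarrow> {\<omega> \<in> \<Omega>. X t \<omega> = y} \<in> sets (P x)"
  using sets_X[of t "{y}"] by simp

lemma alive_iff: "\<lbrakk>\<omega> \<in> \<Omega>; 0 \<le> t\<rbrakk> \<Longrightarrow> X t \<omega> \<noteq> None \<longleftrightarrow> ereal t < explosion_time X \<omega>"
  using killed[of \<omega> 0 t] by (auto simp: not_le)

lemma alive_before: "\<lbrakk>\<omega> \<in> \<Omega>; 0 \<le> s; s \<le> t; X t \<omega> \<noteq> None\<rbrakk> \<Longrightarrow> X s \<omega> \<noteq> None"
  using alive_iff[of \<omega> s] alive_iff[of \<omega> t] le_less_trans[of "ereal s" "ereal t" "explosion_time X \<omega>"]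
  by simp

lemma right_constant:
  assumes "\<omega> \<in> \<Omega>" "0 \<le> t" "X t \<omega> = Some y"
  obtains e where "0 < e" "\<And>s. t \<le> s \<Longrightarrow> s < t + e \<Longrightarrow> X s \<omega> = Some y"
proof -
  have "eventually (\<lambda>s. X s \<omega> = X t \<omega>) (at_right t)"
    using assms alive_iff[of \<omega> t] by (intro right_continuous[of \<omega> 0]) auto
  then obtain b where b: "t < b" "\<And>s. t < s \<Longrightarrow> s < b \<Longrightarrow> X s \<omega> = X t \<omega>"
    unfolding eventually_at_right_field by auto
  show ?thesis
  proof (rule that[of "b - t"])
    show "X s \<omega> = Some y" if "t \<le> s" "s < t + (b - t)" for s
      using b(2)[of s] assms(3) that by (cases "s = t") auto
  qed (use b in simp)
qed

lemma hitting_time_le: "\<lbrakk>0 < s; X s \<omega> \<in> Some ` A\<rbrakk> \<Longrightarrow> hitting_time X A \<omega> \<le> ereal s"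
  unfolding hitting_time_def by (intro Inf_lower) auto

lemma hitting_time_nonneg: "0 \<le> hitting_time X A \<omega>"
  unfolding hitting_time_def by (intro Inf_greatest) auto

lemma bounded_before:
  assumes "\<omega> \<in> \<Omega>" "0 \<le> t" "X t \<omega> \<noteq> None"
  obtains N where "\<And>s. 0 \<le> s \<Longrightarrow> s \<le> t \<Longrightarrow> X s \<omega> \<in> Some ` {..<N}"
proof -
  have "incseq (\<lambda>z. hitting_time X {z..} \<omega>)"
    unfolding hitting_time_def by (intro monoI Inf_superset_mono) auto
  then have "explosion_time X \<omega> = (SUP z. hitting_time X {z..} \<omega>)"
    unfolding explosion_time_def using LIMSEQ_SUP limI by blast
  then obtain z where z: "ereal t < hitting_time X {z..} \<omega>"
    using alive_iff[OF assms(1,2)] assms(3) by (auto simp: less_SUP_iff)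
  have pos: "\<exists>w<z. X s \<omega> = Some w" if s: "0 < s" "s \<le> t" for s
  proof -
    obtain w where w: "X s \<omega> = Some w" using alive_before[OF assms(1), of s t] s assms(3) by auto
    have "\<not> z \<le> w"
    proof
      assume "z \<le> w"
      then have "hitting_time X {z..} \<omega> \<le> ereal s" using w s by (intro hitting_time_le) auto
      then show False using z s by (metis ereal_less_eq(3) not_less order_trans)
    qed
    then show ?thesis using w by auto
  qed
  \<comment> \<open>Hitting times ignore time 0, so the initial state has to be added to the bound
    separately.\<close>
  obtain w0 where w0: "X 0 \<omega> = Some w0" using alive_before[OF assms(1), of 0 t] assms by auto
  show ?thesis
  proof (rule that[of "max z (Suc w0)"])
    fix s assume "0 \<le> s" "s \<le> t"
    then show "X s \<omega> \<in> Some ` {..<max z (Suc w0)}"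
      using pos[of s] w0 by (cases "s = 0") (auto simp: image_iff less_max_iff_disj)
  qed
qed

text \<open>By right continuity a visit lasts for a positive time and contains a rational time. This
  reduces hitting and return times to countably many events.\<close>

lemma dense_time:
  assumes \<omega>: "\<omega> \<in> \<Omega>" and t: "0 \<le> t" "X t \<omega> \<in> Some ` A" and y: "ereal t < y"
  obtains r where "r \<in> \<rat>" "t < r" "ereal r < y" "X r \<omega> = X t \<omega>"
proof -
  obtain w where w: "X t \<omega> = Some w" using t by auto
  obtain e where e: "0 < e" "\<And>s. t \<le> s \<Longrightarrow> s < t + e \<Longrightarrow> X s \<omega> = Some w"
    using right_constant[OF \<omega> t(1) w] by blast
  have "ereal t < min y (ereal (t + e))" using y e by simp
  then obtain b where b: "ereal t < ereal b" "ereal b < min y (ereal (t + e))"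
    using ereal_dense2 by blast
  obtain r where "r \<in> \<rat>" "t < r" "r < b" using Rats_dense_in_real[of t b] b by auto
  moreover have "ereal r < y" using b \<open>r < b\<close> by (metis ereal_less(2) less_ereal.simps(1) min_less_iff_conj less_trans)
  ultimately show ?thesis using that[of r] b w e(2)[of r] by auto
qed

lemma hitting_time_less_iff:
  assumes "\<omega> \<in> \<Omega>"
  shows "hitting_time X A \<omega> < y \<longleftrightarrow> (\<exists>r\<in>\<rat>. 0 < r \<and> ereal r < y \<and> X r \<omega> \<in> Some ` A)"
proof
  assume "hitting_time X A \<omega> < y"
  then obtain t where t: "0 < t" "X t \<omega> \<in> Some ` A" "ereal t < y"
    unfolding hitting_time_def Inf_less_iff by auto
  then show "\<exists>r\<in>\<rat>. 0 < r \<and> ereal r < y \<and> X r \<omega> \<in> Some ` A"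
    using dense_time[OF assms, of t A y] by (metis less_eq_real_def less_trans)
next
  assume "\<exists>r\<in>\<rat>. 0 < r \<and> ereal r < y \<and> X r \<omega> \<in> Some ` A"
  then show "hitting_time X A \<omega> < y" using hitting_time_le le_less_trans by blast
qed

lemma hitting_time_measurable [measurable]: "hitting_time X A \<in> borel_measurable (P x)"
proof (rule borel_measurableI_less)
  fix y
  have "{\<omega> \<in> space (P x). hitting_time X A \<omega> < y} =
      (\<Union>r\<in>{r\<in>\<rat>. 0 < r \<and> ereal r < y}. {\<omega> \<in> \<Omega>. X r \<omega> \<in> Some ` A})"
    by (simp add: hitting_time_less_iff set_eq_iff cong: conj_cong) blast
  also have "\<dots> \<in> sets (P x)"
  proof (rule sets.countable_UN')
    show "countable {r \<in> \<rat>. 0 < r \<and> ereal r < y}" by (rule countable_subset[OF _ countable_rat]) auto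
  qed (auto intro!: sets_X)
  finally show "{\<omega> \<in> space (P x). hitting_time X A \<omega> < y} \<in> sets (P x)" .
qed

lemma sets_hitting_time_less: "{\<omega> \<in> \<Omega>. hitting_time X A \<omega> < y} \<in> sets (P x)"
proof -
  have "{\<omega> \<in> space (P x). hitting_time X A \<omega> < y} \<in> sets (P x)" by measurable
  then show ?thesis by simp
qed

lemma return_time_measurable [measurable]: "return_time X z \<in> borel_measurable (P x)"
proof (rule borel_measurableI_less)
  fix y
  have "return_time X z \<omega> < y \<longleftrightarrow>
      (\<exists>r\<in>\<rat>. 0 < r \<and> ereal r < y \<and> hitting_time X (- {z}) \<omega> < ereal r \<and> X r \<omega> = Some z)" if \<omega>: "\<omega> \<in> \<Omega>" for \<omega>
  proof
    assume "return_time X z \<omega> < y"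
    then obtain t where t: "hitting_time X (- {z}) \<omega> < ereal t" "X t \<omega> = Some z" "ereal t < y"
      unfolding return_time_def Inf_less_iff by auto
    have t0: "0 < t" using le_less_trans[OF hitting_time_nonneg t(1)] by simp
    obtain r where r: "r \<in> \<rat>" "t < r" "ereal r < y" "X r \<omega> = X t \<omega>"
      using dense_time[OF \<omega>, of t "{z}" y] t0 t by auto
    then have "hitting_time X (- {z}) \<omega> < ereal r"
      using less_trans[OF t(1), of "ereal r"] by simp
    then show "\<exists>r\<in>\<rat>. 0 < r \<and> ereal r < y \<and> hitting_time X (- {z}) \<omega> < ereal r \<and> X r \<omega> = Some z"
      using r t t0 by (intro bexI[of _ r]) auto
  next
    assume "\<exists>r\<in>\<rat>. 0 < r \<and> ereal r < y \<and> hitting_time X (- {z}) \<omega> < ereal r \<and> X r \<omega> = Some z"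
    then show "return_time X z \<omega> < y" unfolding return_time_def Inf_less_iff by blast
  qed
  then have "{\<omega> \<in> space (P x). return_time X z \<omega> < y} =
      (\<Union>r\<in>{r\<in>\<rat>. 0 < r \<and> ereal r < y}. {\<omega> \<in> space (P x). hitting_time X (- {z}) \<omega> < ereal r} \<inter> {\<omega> \<in> \<Omega>. X r \<omega> = Some z})"
    by auto
  also have "\<dots> \<in> sets (P x)"
  proof (rule sets.countable_UN')
    show "countable {r \<in> \<rat>. 0 < r \<and> ereal r < y}" by (rule countable_subset[OF _ countable_rat]) auto
  qed (auto intro!: sets.Int sets_X_eq sets_hitting_time_less)
  finally show "{\<omega> \<in> space (P x). return_time X z \<omega> < y} \<in> sets (P x)" .
qed

text \<open>The infimum of the visits to \<open>A\<close> is attained: at a state outside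
  \<open>A\<close> the path would stay there for a while, pushing the infimum further to the
  right.\<close>

lemma first_hit:
  assumes \<omega>: "\<omega> \<in> \<Omega>" and a: "0 \<le> a" "a \<le> T" "X T \<omega> \<in> Some ` A"
  obtains r where "a \<le> r" "r \<le> T" "X r \<omega> \<in> Some ` A" "\<And>s. a \<le> s \<Longrightarrow> s < r \<Longrightarrow> X s \<omega> \<notin> Some ` A"
proof -
  define S where "S = {t. a \<le> t \<and> X t \<omega> \<in> Some ` A}"
  have T: "T \<in> S" using a by (simp add: S_def)
  have bdd: "bdd_below S" unfolding S_def by (intro bdd_belowI[of _ a]) auto
  define r where "r = Inf S"
  have ar: "a \<le> r" unfolding r_def using T by (intro cInf_greatest) (auto simp: S_def)
  have rT: "r \<le> T" unfolding r_def using T bdd by (rule cInf_lower)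
  have before: "X s \<omega> \<notin> Some ` A" if "a \<le> s" "s < r" for s
    using cInf_lower[OF _ bdd, of s] that unfolding r_def S_def by force
  have "X T \<omega> \<noteq> None" using a by auto
  then obtain w where w: "X r \<omega> = Some w" using alive_before[OF \<omega>, of r T] ar rT a by auto
  obtain e where e: "0 < e" "\<And>s. r \<le> s \<Longrightarrow> s < r + e \<Longrightarrow> X s \<omega> = Some w"
    using right_constant[OF \<omega> _ w] ar a by auto
  have "w \<in> A"
  proof (rule ccontr)
    assume "w \<notin> A"
    have "r + e \<le> Inf S"
    proof (rule cInf_greatest)
      fix s assume s: "s \<in> S"
      then have "r \<le> s" unfolding r_def using bdd by (rule cInf_lower)
      then show "r + e \<le> s" using e(2)[of s] s \<open>w \<notin> A\<close> unfolding S_def by force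
    qed (use T in auto)
    then show False using e(1) unfolding r_def by simp
  qed
  then show ?thesis using that ar rT w before by blast
qed

section \<open>Transition probabilities and the Markov property along a grid\<close>

definition p :: "real \<Rightarrow> nat \<Rightarrow> nat \<Rightarrow> real" where
  "p t x y = measure (P x) {\<omega> \<in> \<Omega>. X t \<omega> = Some y}"

lemma p_nonneg: "0 \<le> p t x y" unfolding p_def by simp

lemma p_le_1: "p t x y \<le> 1" unfolding p_def by (rule P.prob_le_1)

lemma AE_start: "AE \<omega> in P x. X 0 \<omega> = Some x"
  using start[of x] sets_X_eq[of 0 "Some x" x] space_P[of x]
  by (subst (asm) P.prob_Collect_eq_1) auto

lemma measure_start: 
  assumes "0 \<le> t" "{\<omega> \<in> \<Omega>. R \<omega>} \<in> sets (P x)"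
  shows "measure (P x) {\<omega> \<in> \<Omega>. X 0 \<omega> = Some x \<and> R \<omega>} = measure (P x) {\<omega> \<in> \<Omega>. R \<omega>}"
proof (rule P.finite_measure_eq_AE)
  show "AE \<omega> in P x. (\<omega> \<in> {\<omega> \<in> \<Omega>. X 0 \<omega> = Some x \<and> R \<omega>}) = (\<omega> \<in> {\<omega> \<in> \<Omega>. R \<omega>})"
    using AE_start[of x] by eventually_elim auto
  have "{\<omega> \<in> \<Omega>. X 0 \<omega> = Some x \<and> R \<omega>} = {\<omega> \<in> \<Omega>. X 0 \<omega> = Some x} \<inter> {\<omega> \<in> \<Omega>. R \<omega>}" by auto
  then show "{\<omega> \<in> \<Omega>. X 0 \<omega> = Some x \<and> R \<omega>} \<in> sets (P x)"
    using assms(2) sets_X_eq[of 0] by auto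
qed (use assms in auto)

lemma p_0: "p 0 x y = (if x = y then 1 else 0)"
proof -
  have "p 0 x y = measure (P x) {\<omega> \<in> \<Omega>. x = y}"
    unfolding p_def
  proof (rule P.finite_measure_eq_AE)
    show "AE \<omega> in P x. (\<omega> \<in> {\<omega> \<in> \<Omega>. X 0 \<omega> = Some y}) = (\<omega> \<in> {\<omega> \<in> \<Omega>. x = y})"
      using AE_start[of x] by eventually_elim auto
  qed (use space_P[of x] sets.top[of "P x"] in \<open>auto intro: sets_X_eq\<close>)
  then show ?thesis using P.prob_space[of x] space_P[of x] by auto
qed

lemma p_derivative:
  "((\<lambda>h. (p h x y - (if x = y then 1 else 0)) / h) \<longlongrightarrow> Q x y) (at_right 0)"
proof -
  have "p = (\<lambda>t x y. \<P>(\<omega> in P x. X t \<omega> = Some y))"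
    unfolding p_def by simp
  then have "((\<lambda>t. p t x y) has_real_derivative Q x y) (at_right 0)"
    using Q_matrix[of x y] by simp
  then show ?thesis unfolding has_field_derivative_iff by (simp add: p_0)
qed

lemma filterlim_halving: "0 < (t::real) \<Longrightarrow> filterlim (\<lambda>m::nat. t / 2 ^ m) (at_right 0) sequentially"
  by real_asymp

lemma past_sigma_algebra: "sigma_algebra \<Omega> (past_events \<Omega> X s)"
  unfolding past_events_def by (rule sigma_algebra_sigma_sets) auto

lemma past_event_X: "\<lbrakk>0 \<le> u; u \<le> s\<rbrakk> \<Longrightarrow> {\<omega> \<in> \<Omega>. X u \<omega> \<in> B} \<in> past_events \<Omega> X s"
  unfolding past_events_def by (rule sigma_sets.Basic) (auto intro!: exI[of _ u] exI[of _ B])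

lemma past_events_mono: "s \<le> t \<Longrightarrow> past_events \<Omega> X s \<subseteq> past_events \<Omega> X t"
  unfolding past_events_def by (rule sigma_sets_mono') (auto, metis order_trans)

lemma past_events_sets: "past_events \<Omega> X s \<subseteq> sets (P x)"
proof -
  have "sigma_sets (space (P x)) {X u -` B \<inter> \<Omega> | u B. 0 \<le> u \<and> u \<le> s} \<subseteq> sets (P x)"
  proof (rule sets.sigma_sets_subset)
    show "{X u -` B \<inter> \<Omega> |u B. 0 \<le> u \<and> u \<le> s} \<subseteq> sets (P x)"
      using measurable_sets[OF measurable_X[of _ x]] space_P[of x] by auto
  qed
  then show ?thesis unfolding past_events_def using space_P[of x] by simp
qed

lemma past_Int: "\<lbrakk>A \<in> past_events \<Omega> X s; B \<in> past_events \<Omega> X s\<rbrakk> \<Longrightarrow> A \<inter> B \<in> past_events \<Omega> X s"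
  using past_sigma_algebra[of s] by (meson sigma_algebra_def algebra.axioms(1) ring_of_sets.axioms(1) semiring_of_sets.Int)

lemma past_space: "\<Omega> \<in> past_events \<Omega> X s"
  unfolding past_events_def by (rule sigma_sets_top)

lemma markov_p:
  assumes "0 \<le> s" "0 \<le> t" "A \<in> past_events \<Omega> X s"
  shows "measure (P x) {\<omega> \<in> \<Omega>. \<omega> \<in> A \<and> X s \<omega> = Some y \<and> X (s + t) \<omega> = Some z} =
    measure (P x) {\<omega> \<in> \<Omega>. \<omega> \<in> A \<and> X s \<omega> = Some y} * p t y z"
  using markov[of s t A x y z] assms space_P[of x] space_P[of y] unfolding p_def by simp

lemma markov_p_0:
  assumes "0 \<le> s" "0 \<le> t"
  shows "measure (P x) {\<omega> \<in> \<Omega>. X s \<omega> = Some y \<and> X (s + t) \<omega> = Some z} = p s x y * p t y z"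
  using markov_p[OF assms past_space, of x y z] unfolding p_def by simp

lemma sum_p_le_1:
  assumes "0 \<le> t" "finite S" shows "(\<Sum>v\<in>S. p t x v) \<le> 1"
proof -
  have "(\<Sum>v\<in>S. p t x v) = measure (P x) (\<Union>v\<in>S. {\<omega> \<in> \<Omega>. X t \<omega> = Some v})"
    unfolding p_def using assms
    by (subst P.finite_measure_finite_Union) (auto simp: disjoint_family_on_def intro: sets_X_eq)
  then show ?thesis by simp
qed

primrec run :: "real \<Rightarrow> nat set list \<Rightarrow> real \<Rightarrow> 'w \<Rightarrow> bool" where
  "run h [] s \<omega> = True"
| "run h (S # L) s \<omega> = (X (s + h) \<omega> \<in> Some ` S \<and> run h L (s + h) \<omega>)"

primrec cyl :: "real \<Rightarrow> nat set list \<Rightarrow> nat \<Rightarrow> real" where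
  "cyl h [] u = 1"
| "cyl h (S # L) u = (\<Sum>v\<in>S. p h u v * cyl h L v)"

lemma run_iff: "run h L s \<omega> \<longleftrightarrow> (\<forall>i<length L. X (s + (real i + 1) * h) \<omega> \<in> Some ` (L ! i))"
proof (induction L arbitrary: s)
  case (Cons S L)
  have *: "s + h + (real i + 1) * h = s + (real (Suc i) + 1) * h" for i by (simp add: algebra_simps)
  show ?case
    unfolding run.simps Cons.IH * by (auto simp: less_Suc_eq_0_disj)
qed simp

lemma sets_run: "\<lbrakk>0 \<le> s; 0 \<le> h\<rbrakk> \<Longrightarrow> {\<omega> \<in> \<Omega>. run h L s \<omega>} \<in> sets (P x)"
proof (induction L arbitrary: s)
  case Nil
  then show ?case using sets.top[of "P x"] space_P[of x] by simp
next
  case (Cons S L)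
  have "{\<omega> \<in> \<Omega>. run h (S # L) s \<omega>} = {\<omega> \<in> \<Omega>. X (s + h) \<omega> \<in> Some ` S} \<inter> {\<omega> \<in> \<Omega>. run h L (s + h) \<omega>}"
    by auto
  also have "\<dots> \<in> sets (P x)" using Cons by (intro sets.Int sets_X Cons.IH) auto
  finally show ?case .
qed

text \<open>One grid step at a time, the current state is moved into the past event and the Markov
  property is applied at the next grid time. A general past event is kept so that the result can be
  used from any time \<open>s\<close>.\<close>

lemma cylinder:
  assumes "0 \<le> s" "0 \<le> h" "A \<in> past_events \<Omega> X s" "\<And>S. S \<in> set L \<Longrightarrow> finite S"
  shows "measure (P x) {\<omega> \<in> \<Omega>. \<omega> \<in> A \<and> X s \<omega> = Some u \<and> run h L s \<omega>} =
    measure (P x) {\<omega> \<in> \<Omega>. \<omega> \<in> A \<and> X s \<omega> = Some u} * cyl h L u"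
  using assms
proof (induction L arbitrary: s A u)
  case (Cons S L)
  define A' where "A' = A \<inter> {\<omega> \<in> \<Omega>. X s \<omega> = Some u}"
  have A': "A' \<in> past_events \<Omega> X (s + h)"
    unfolding A'_def
    using past_events_mono[of s "s + h"] Cons.prems past_event_X[of s "s + h" "{Some u}"]
    by (intro past_Int) auto
  have S: "finite S" using Cons.prems by simp
  have "measure (P x) {\<omega> \<in> \<Omega>. \<omega> \<in> A \<and> X s \<omega> = Some u \<and> run h (S # L) s \<omega>} =
      measure (P x) (\<Union>v\<in>S. {\<omega> \<in> \<Omega>. \<omega> \<in> A' \<and> X (s + h) \<omega> = Some v \<and> run h L (s + h) \<omega>})"
    unfolding A'_def by (rule arg_cong[where f="measure (P x)"]) auto
  also have "\<dots> = (\<Sum>v\<in>S. measure (P x) {\<omega> \<in> \<Omega>. \<omega> \<in> A' \<and> X (s + h) \<omega> = Some v \<and> run h L (s + h) \<omega>})"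
  proof (rule P.finite_measure_finite_Union[OF S])
    have "{\<omega> \<in> \<Omega>. \<omega> \<in> A' \<and> X (s + h) \<omega> = Some v \<and> run h L (s + h) \<omega>} =
        A' \<inter> {\<omega> \<in> \<Omega>. X (s + h) \<omega> = Some v} \<inter> {\<omega> \<in> \<Omega>. run h L (s + h) \<omega>}" for v by auto
    also have "\<dots> v \<in> sets (P x)" for v
      using A' past_events_sets[of "s + h" x] Cons.prems by (intro sets.Int sets_X_eq sets_run) auto
    finally show "(\<lambda>v. {\<omega> \<in> \<Omega>. \<omega> \<in> A' \<and> X (s + h) \<omega> = Some v \<and> run h L (s + h) \<omega>}) ` S \<subseteq> sets (P x)"
      by auto
  qed (auto simp: disjoint_family_on_def)
  also have "\<dots> = (\<Sum>v\<in>S. measure (P x) {\<omega> \<in> \<Omega>. \<omega> \<in> A \<and> X s \<omega> = Some u} * p h u v * cyl h L v)"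
  proof (rule sum.cong[OF refl])
    fix v
    have "measure (P x) {\<omega> \<in> \<Omega>. \<omega> \<in> A' \<and> X (s + h) \<omega> = Some v \<and> run h L (s + h) \<omega>} =
        measure (P x) {\<omega> \<in> \<Omega>. \<omega> \<in> A' \<and> X (s + h) \<omega> = Some v} * cyl h L v"
      using Cons.prems by (intro Cons.IH A') auto
    also have "{\<omega> \<in> \<Omega>. \<omega> \<in> A' \<and> X (s + h) \<omega> = Some v} =
        {\<omega> \<in> \<Omega>. \<omega> \<in> A \<and> X s \<omega> = Some u \<and> X (s + h) \<omega> = Some v}" unfolding A'_def by auto
    finally show "measure (P x) {\<omega> \<in> \<Omega>. \<omega> \<in> A' \<and> X (s + h) \<omega> = Some v \<and> run h L (s + h) \<omega>} =
        measure (P x) {\<omega> \<in> \<Omega>. \<omega> \<in> A \<and> X s \<omega> = Some u} * p h u v * cyl h L v"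
      using markov_p[of s h A x u v] Cons.prems by simp
  qed
  finally show ?case by (simp add: sum_distrib_left mult.assoc)
qed simp

lemma cylinder_0:
  assumes "0 \<le> h" "\<And>S. S \<in> set L \<Longrightarrow> finite S"
  shows "measure (P x) {\<omega> \<in> \<Omega>. X 0 \<omega> = Some x \<and> run h L 0 \<omega>} = cyl h L x"
proof -
  have "measure (P x) {\<omega> \<in> \<Omega>. X 0 \<omega> = Some x} = 1" using p_0[of x x] unfolding p_def by simp
  then show ?thesis using cylinder[of 0 h \<Omega> L x x] assms past_space by simp
qed

end

section \<open>The chain killed on leaving a finite set\<close>

text \<open>The expansion is given only to the right of each point. For \<open>s\<close> to the left
  of \<open>t\<close> it is taken at \<open>s\<close>, and the Lipschitz bound on \<open>f'\<close>
  replaces \<open>f' s\<close> by \<open>f' t\<close>.\<close>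

lemma derivative_of_quadratic_error:
  fixes f f' :: "real \<Rightarrow> real"
  assumes f: "\<And>a h. 0 \<le> a \<Longrightarrow> 0 \<le> h \<Longrightarrow> h \<le> 1 \<Longrightarrow> \<bar>f (a + h) - f a - h * f' a\<bar> \<le> K * h\<^sup>2"
    and f': "\<And>a h. 0 \<le> a \<Longrightarrow> 0 \<le> h \<Longrightarrow> h \<le> 1 \<Longrightarrow> \<bar>f' (a + h) - f' a\<bar> \<le> L * h"
    and t: "0 \<le> t"
  shows "(f has_real_derivative f' t) (at t within {0..})"
proof -
  have K: "0 \<le> K" and L: "0 \<le> L" using f[of 0 1] f'[of 0 1] by auto
  have bound: "\<bar>f s - f t - (s - t) * f' t\<bar> \<le> (K + L) * (s - t)\<^sup>2" if s: "0 \<le> s" "\<bar>s - t\<bar> \<le> 1" for s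
  proof (cases "t \<le> s")
    case True
    then have "\<bar>f s - f t - (s - t) * f' t\<bar> \<le> K * (s - t)\<^sup>2" using f[of t "s - t"] t s by simp
    also have "\<dots> \<le> (K + L) * (s - t)\<^sup>2" using L by (intro mult_right_mono) auto
    finally show ?thesis .
  next
    case False
    have 1: "\<bar>f t - f s - (t - s) * f' s\<bar> \<le> K * (t - s)\<^sup>2" using f[of s "t - s"] s False by simp
    have "\<bar>(t - s) * (f' t - f' s)\<bar> \<le> (t - s) * (L * (t - s))"
      using f'[of s "t - s"] s False unfolding abs_mult by (intro mult_mono) auto
    moreover have "f s - f t - (s - t) * f' t = - (f t - f s - (t - s) * f' s) + (t - s) * (f' t - f' s)"
      by (simp add: algebra_simps)
    ultimately have "\<bar>f s - f t - (s - t) * f' t\<bar> \<le> K * (t - s)\<^sup>2 + (t - s) * (L * (t - s))"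
      using 1 by linarith
    also have "\<dots> = (K + L) * (s - t)\<^sup>2" by (simp add: power2_eq_square algebra_simps)
    finally show ?thesis .
  qed
  have "((\<lambda>s. (f s - f t) / (s - t) - f' t) \<longlongrightarrow> 0) (at t within {0..})"
  proof (rule Lim_null_comparison)
    have "\<forall>\<^sub>F s in at t within {0..}. s \<in> {0..} \<and> s \<noteq> t \<and> dist s t < 1"
      unfolding eventually_at by (rule exI[of _ 1]) auto
    then show "\<forall>\<^sub>F s in at t within {0..}. norm ((f s - f t) / (s - t) - f' t) \<le> (K + L) * \<bar>s - t\<bar>"
    proof eventually_elim
      case (elim s)
      then have "(f s - f t) / (s - t) - f' t = (f s - f t - (s - t) * f' t) / (s - t)"
        by (simp add: field_simps)
      also have "\<bar>\<dots>\<bar> \<le> ((K + L) * (s - t)\<^sup>2) / \<bar>s - t\<bar>"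
        unfolding abs_divide using bound[of s] elim by (intro divide_right_mono) (auto simp: dist_real_def)
      also have "\<dots> = (K + L) * \<bar>s - t\<bar>"
        by (subst nonzero_divide_eq_eq) (use elim in \<open>auto simp: power2_eq_square mult.assoc\<close>)
      finally show ?case by simp
    qed
    have "((\<lambda>s. (K + L) * \<bar>s - t\<bar>) \<longlongrightarrow> (K + L) * \<bar>t - t\<bar>) (at t within {0..})"
      by (intro tendsto_intros)
    then show "((\<lambda>s. (K + L) * \<bar>s - t\<bar>) \<longlongrightarrow> 0) (at t within {0..})" by simp
  qed
  then show ?thesis unfolding has_field_derivative_iff using LIM_zero_iff by fastforce
qed

context killed_markov_chain
begin

definition stays :: "nat \<Rightarrow> real \<Rightarrow> real \<Rightarrow> 'w \<Rightarrow> bool" where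
  "stays N s t \<omega> \<longleftrightarrow> (\<forall>r\<in>{s..t}. X r \<omega> \<in> Some ` {..<N})"

definition pN :: "nat \<Rightarrow> real \<Rightarrow> nat \<Rightarrow> nat \<Rightarrow> real" where
  "pN N t x y = measure (P x) {\<omega> \<in> \<Omega>. stays N 0 t \<omega> \<and> X t \<omega> = Some y}"

text \<open>A state occupied at time \<open>r\<close> is still occupied at the next point of a
  sufficiently fine dyadic grid, so the dyadic times see every state; the right end point is itself
  a grid point.\<close>

lemma stays_iff_grid:
  assumes \<omega>: "\<omega> \<in> \<Omega>" and s: "0 \<le> s" "0 < t"
  shows "stays N s (s + t) \<omega> \<longleftrightarrow> (\<forall>m. \<forall>i\<le>2 ^ m. X (s + real i * (t / 2 ^ m)) \<omega> \<in> Some ` {..<N})"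
proof
  assume st: "stays N s (s + t) \<omega>"
  show "\<forall>m. \<forall>i\<le>2 ^ m. X (s + real i * (t / 2 ^ m)) \<omega> \<in> Some ` {..<N}"
  proof (intro allI impI)
    fix m i :: nat assume "i \<le> 2 ^ m"
    then have "real i \<le> 2 ^ m" by (metis of_nat_le_iff of_nat_numeral of_nat_power)
    then have "real i * (t / 2 ^ m) \<le> t" using s by (simp add: field_simps)
    then show "X (s + real i * (t / 2 ^ m)) \<omega> \<in> Some ` {..<N}"
      using st s unfolding stays_def by simp
  qed
next
  assume grid: "\<forall>m. \<forall>i\<le>2 ^ m. X (s + real i * (t / 2 ^ m)) \<omega> \<in> Some ` {..<N}"
  have last: "X (s + t) \<omega> \<in> Some ` {..<N}" using grid[rule_format, of 1 0] by simp
  show "stays N s (s + t) \<omega>" unfolding stays_def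
  proof
    fix r assume r: "r \<in> {s..s + t}"
    show "X r \<omega> \<in> Some ` {..<N}"
    proof (cases "r = s + t")
      case False
      obtain w where w: "X r \<omega> = Some w" using alive_before[OF \<omega>, of r "s + t"] r s last by auto
      obtain e where e: "0 < e" "\<And>q. r \<le> q \<Longrightarrow> q < r + e \<Longrightarrow> X q \<omega> = Some w"
        using right_constant[OF \<omega> _ w] r s by auto
      have "\<forall>\<^sub>F m in sequentially. t / 2 ^ m < e"
        using filterlim_halving[OF s(2)] e(1)
        by (intro order_tendstoD(2)[of _ 0]) (auto simp: filterlim_at)
      then obtain m where m: "t / 2 ^ m < e" by (auto simp: eventually_at_top_linorder)
      define h where "h = t / 2 ^ m"
      have h: "0 < h" unfolding h_def using s by simp
      obtain i :: nat where i: "r - s \<le> i * h" "i * h < r - s + h" "\<And>j. j < i \<Longrightarrow> j * h < r - s"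
        using grid_point[OF h, of "r - s"] r by auto
      have "i \<le> 2 ^ m"
      proof (rule ccontr)
        assume "\<not> i \<le> 2 ^ m"
        then have "real (2 ^ m) * h < r - s" by (intro i(3)) simp
        then show False using r unfolding h_def by simp
      qed
      then have "X (s + i * h) \<omega> \<in> Some ` {..<N}" using grid unfolding h_def by blast
      moreover have "X (s + i * h) \<omega> = Some w" using i m h_def by (intro e(2)) auto
      ultimately show ?thesis using w by simp
    qed (use last in simp)
  qed
qed

definition grid_sets :: "nat \<Rightarrow> nat \<Rightarrow> nat \<Rightarrow> nat set list" where
  "grid_sets N n y = replicate (n - 1) {..<N} @ [{y}]"

lemma run_grid_sets:
  assumes n: "0 < n" and uy: "u < N" "y < N" "X s \<omega> = Some u"
  shows "run h (grid_sets N n y) s \<omega> \<longleftrightarrow>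
    (\<forall>i\<le>n. X (s + real i * h) \<omega> \<in> Some ` {..<N}) \<and> X (s + real n * h) \<omega> = Some y"
proof -
  obtain k where k: "n = Suc k" using n by (cases n) auto
  have "run h (grid_sets N n y) s \<omega> \<longleftrightarrow>
      (\<forall>i<k. X (s + (real i + 1) * h) \<omega> \<in> Some ` {..<N}) \<and> X (s + (real k + 1) * h) \<omega> = Some y"
    unfolding run_iff grid_sets_def k by (auto simp: less_Suc_eq nth_append)
  also have "(\<forall>i<k. X (s + (real i + 1) * h) \<omega> \<in> Some ` {..<N}) \<longleftrightarrow>
      (\<forall>i\<le>k. X (s + real i * h) \<omega> \<in> Some ` {..<N})"
  proof (intro iffI allI impI)
    fix i assume "\<forall>i<k. X (s + (real i + 1) * h) \<omega> \<in> Some ` {..<N}" "i \<le> k"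
    then show "X (s + real i * h) \<omega> \<in> Some ` {..<N}"
      using uy by (cases i) (auto simp: add.commute)
  next
    fix i assume "\<forall>i\<le>k. X (s + real i * h) \<omega> \<in> Some ` {..<N}" "i < k"
    then show "X (s + (real i + 1) * h) \<omega> \<in> Some ` {..<N}"
      by (metis Suc_leI add.commute of_nat_Suc)
  qed
  finally show ?thesis using uy unfolding k by (auto simp: le_Suc_eq add.commute)
qed

lemma sets_stays: "0 \<le> s \<Longrightarrow> s \<le> t \<Longrightarrow> {\<omega> \<in> \<Omega>. stays N s t \<omega>} \<in> past_events \<Omega> X t"
proof (cases "s = t")
  case True
  assume "0 \<le> s"
  then show ?thesis using True past_event_X[of t t "Some ` {..<N}"] by (simp add: stays_def)
next
  case False
  assume s: "0 \<le> s" "s \<le> t"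
  interpret S: sigma_algebra \<Omega> "past_events \<Omega> X t" by (rule past_sigma_algebra)
  define h where "h m = (t - s) / 2 ^ m" for m :: nat
  have "{\<omega> \<in> \<Omega>. stays N s t \<omega>} = (\<Inter>m. \<Inter>i\<in>{..2 ^ m}. {\<omega> \<in> \<Omega>. X (s + real i * h m) \<omega> \<in> Some ` {..<N}})"
    using stays_iff_grid[of _ s "t - s" N] s False unfolding h_def by force
  also have "\<dots> \<in> past_events \<Omega> X t"
  proof (intro S.countable_INT S.finite_INT image_subsetI)
    fix m i :: nat assume "i \<in> {..2 ^ m}"
    then have "real i \<le> 2 ^ m" by (metis atMost_iff of_nat_le_iff of_nat_numeral of_nat_power)
    then have "real i / 2 ^ m * (t - s) \<le> 1 * (t - s)" using s by (intro mult_right_mono) auto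
    then have "real i * h m \<le> t - s" unfolding h_def by simp
    moreover have "0 \<le> real i * h m" unfolding h_def using s by simp
    ultimately show "{\<omega> \<in> \<Omega>. X (s + real i * h m) \<omega> \<in> Some ` {..<N}} \<in> past_events \<Omega> X t"
      using s by (intro past_event_X) auto
  qed auto
  finally show ?thesis .
qed

lemma sets_stays': "0 \<le> s \<Longrightarrow> s \<le> t \<Longrightarrow> {\<omega> \<in> \<Omega>. stays N s t \<omega>} \<in> sets (P x)"
  using sets_stays past_events_sets by blast

text \<open>Dyadic grids are nested, so the events that the path is in the block at all grid times
  decrease to the event that it stays there throughout, and each of them has the product form given
  by \<open>cylinder\<close>.\<close>

lemma killed_limit:
  assumes s: "0 \<le> s" "0 < t" and A: "A \<in> past_events \<Omega> X s" and uy: "u < N" "y < N"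
  shows "(\<lambda>m. measure (P x) {\<omega> \<in> \<Omega>. \<omega> \<in> A \<and> X s \<omega> = Some u} * cyl (t / 2 ^ m) (grid_sets N (2 ^ m) y) u)
    \<longlonglongrightarrow> measure (P x) {\<omega> \<in> \<Omega>. \<omega> \<in> A \<and> X s \<omega> = Some u \<and> stays N s (s + t) \<omega> \<and> X (s + t) \<omega> = Some y}"
proof -
  define B where "B m = {\<omega> \<in> \<Omega>. \<omega> \<in> A \<and> X s \<omega> = Some u \<and> run (t / 2 ^ m) (grid_sets N (2 ^ m) y) s \<omega>}" for m :: nat
  have B_iff: "\<omega> \<in> B m \<longleftrightarrow> \<omega> \<in> \<Omega> \<and> \<omega> \<in> A \<and> X s \<omega> = Some u \<and>
      (\<forall>i\<le>2 ^ m. X (s + real i * (t / 2 ^ m)) \<omega> \<in> Some ` {..<N}) \<and> X (s + t) \<omega> = Some y" for \<omega> m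
    unfolding B_def using run_grid_sets[of "2 ^ m" u N y s \<omega> "t / 2 ^ m"] uy by auto
  have B_sets: "B m \<in> sets (P x)" for m
  proof -
    have "B m = A \<inter> {\<omega> \<in> \<Omega>. X s \<omega> = Some u} \<inter> {\<omega> \<in> \<Omega>. run (t / 2 ^ m) (grid_sets N (2 ^ m) y) s \<omega>}"
      unfolding B_def by auto
    also have "\<dots> \<in> sets (P x)"
      using A past_events_sets[of s x] s by (intro sets.Int sets_X_eq sets_run) auto
    finally show ?thesis .
  qed
  have "decseq B"
  proof (rule decseq_SucI, rule subsetI)
    fix m \<omega> assume "\<omega> \<in> B (Suc m)"
    then have *: "\<And>i. i \<le> 2 ^ Suc m \<Longrightarrow> X (s + real i * (t / 2 ^ Suc m)) \<omega> \<in> Some ` {..<N}" and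
      **: "\<omega> \<in> \<Omega> \<and> \<omega> \<in> A \<and> X s \<omega> = Some u \<and> X (s + t) \<omega> = Some y" unfolding B_iff by auto
    have "X (s + real i * (t / 2 ^ m)) \<omega> \<in> Some ` {..<N}" if "i \<le> 2 ^ m" for i
      using *[of "2 * i"] that by simp
    then show "\<omega> \<in> B m" unfolding B_iff using ** by blast
  qed
  then have "(\<lambda>m. measure (P x) (B m)) \<longlonglongrightarrow> measure (P x) (\<Inter>m. B m)"
    using B_sets by (intro P.finite_Lim_measure_decseq) auto
  moreover have "(\<Inter>m. B m) = {\<omega> \<in> \<Omega>. \<omega> \<in> A \<and> X s \<omega> = Some u \<and> stays N s (s + t) \<omega> \<and> X (s + t) \<omega> = Some y}"
  proof (rule set_eqI)
    fix \<omega>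
    have "\<omega> \<in> (\<Inter>m. B m) \<longleftrightarrow> \<omega> \<in> \<Omega> \<and> \<omega> \<in> A \<and> X s \<omega> = Some u \<and>
        (\<forall>m. \<forall>i\<le>2 ^ m. X (s + real i * (t / 2 ^ m)) \<omega> \<in> Some ` {..<N}) \<and> X (s + t) \<omega> = Some y"
      unfolding INT_iff B_iff by blast
    then show "\<omega> \<in> (\<Inter>m. B m) \<longleftrightarrow>
        \<omega> \<in> {\<omega> \<in> \<Omega>. \<omega> \<in> A \<and> X s \<omega> = Some u \<and> stays N s (s + t) \<omega> \<and> X (s + t) \<omega> = Some y}"
      using stays_iff_grid[OF _ s, of \<omega> N] by blast
  qed
  moreover have "measure (P x) (B m) = measure (P x) {\<omega> \<in> \<Omega>. \<omega> \<in> A \<and> X s \<omega> = Some u} *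
      cyl (t / 2 ^ m) (grid_sets N (2 ^ m) y) u" for m
    unfolding B_def using s A by (intro cylinder) (auto simp: grid_sets_def)
  ultimately show ?thesis by simp
qed

lemma cyl_tendsto_pN:
  assumes "0 < t" "u < N" "y < N"
  shows "(\<lambda>m. cyl (t / 2 ^ m) (grid_sets N (2 ^ m) y) u) \<longlonglongrightarrow> pN N t u y"
proof -
  have "measure (P u) {\<omega> \<in> \<Omega>. \<omega> \<in> \<Omega> \<and> X 0 \<omega> = Some u} = 1" using p_0[of u u] unfolding p_def by simp
  moreover have "measure (P u) {\<omega> \<in> \<Omega>. \<omega> \<in> \<Omega> \<and> X 0 \<omega> = Some u \<and> stays N 0 (0 + t) \<omega> \<and> X (0 + t) \<omega> = Some y} = pN N t u y"
  proof -
    have "{\<omega> \<in> \<Omega>. stays N 0 t \<omega> \<and> X t \<omega> = Some y} = {\<omega> \<in> \<Omega>. stays N 0 t \<omega>} \<inter> {\<omega> \<in> \<Omega>. X t \<omega> = Some y}" by auto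
    also have "\<dots> \<in> sets (P u)" using assms by (intro sets.Int sets_stays' sets_X_eq) auto
    finally show ?thesis using measure_start[of t "\<lambda>\<omega>. stays N 0 t \<omega> \<and> X t \<omega> = Some y" u] assms
      unfolding pN_def by (simp cong: conj_cong)
  qed
  ultimately show ?thesis using killed_limit[OF order_refl assms(1) past_space assms(2,3), of u] by simp
qed

lemma pN_0: "x < N \<Longrightarrow> y < N \<Longrightarrow> pN N 0 x y = (if x = y then 1 else 0)"
proof -
  assume "x < N" "y < N"
  then have "{\<omega> \<in> \<Omega>. stays N 0 0 \<omega> \<and> X 0 \<omega> = Some y} = {\<omega> \<in> \<Omega>. X 0 \<omega> = Some y}"
    unfolding stays_def by auto
  then show ?thesis using p_0[of x y] unfolding pN_def p_def by simp
qed

text \<open>The grid probabilities converge both to the left side and, by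
  \<open>cyl_tendsto_pN\<close>, to the product on the right.\<close>

lemma markov_pN:
  assumes s: "0 \<le> s" "0 \<le> t" and A: "A \<in> past_events \<Omega> X s" and uy: "u < N" "y < N"
  shows "measure (P x) {\<omega> \<in> \<Omega>. \<omega> \<in> A \<and> X s \<omega> = Some u \<and> stays N s (s + t) \<omega> \<and> X (s + t) \<omega> = Some y} =
    measure (P x) {\<omega> \<in> \<Omega>. \<omega> \<in> A \<and> X s \<omega> = Some u} * pN N t u y"
proof (cases "t = 0")
  case True
  have "{\<omega> \<in> \<Omega>. \<omega> \<in> A \<and> X s \<omega> = Some u \<and> stays N s (s + t) \<omega> \<and> X (s + t) \<omega> = Some y} =
      (if u = y then {\<omega> \<in> \<Omega>. \<omega> \<in> A \<and> X s \<omega> = Some u} else {})"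
    using True uy unfolding stays_def by auto
  then show ?thesis using True pN_0 uy by simp
next
  case False
  then have t: "0 < t" using s by simp
  show ?thesis
    using LIMSEQ_unique[OF killed_limit[OF s(1) t A uy, of x] tendsto_mult_left[OF cyl_tendsto_pN[OF t uy]]] .
qed

lemma pN_nonneg: "0 \<le> pN N t x y" unfolding pN_def by simp

lemma pN_le: 
  assumes "0 \<le> t" shows "pN N t x y \<le> p t x y"
  unfolding pN_def p_def using assms by (intro P.finite_measure_mono sets_X_eq) auto

lemma pN_semigroup:
  assumes s: "0 \<le> s" "0 \<le> t" and xy: "x < N" "y < N"
  shows "pN N (s + t) x y = (\<Sum>u<N. pN N s x u * pN N t u y)"
proof -
  define A where "A = {\<omega> \<in> \<Omega>. stays N 0 s \<omega>}"
  have A: "A \<in> past_events \<Omega> X s" unfolding A_def using s by (intro sets_stays) auto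
  have stays_split: "stays N 0 (s + t) \<omega> \<longleftrightarrow> stays N 0 s \<omega> \<and> stays N s (s + t) \<omega>" for \<omega>
  proof -
    have "{0..s + t} = {0..s} \<union> {s..s + t}" using s by auto
    then show ?thesis unfolding stays_def by (simp add: ball_Un)
  qed
  have "pN N (s + t) x y = measure (P x) (\<Union>u<N. {\<omega> \<in> \<Omega>. \<omega> \<in> A \<and> X s \<omega> = Some u \<and> stays N s (s + t) \<omega> \<and> X (s + t) \<omega> = Some y})"
    unfolding pN_def stays_split A_def
    by (rule arg_cong[where f="measure (P x)"]) (use s in \<open>force simp: stays_def\<close>)
  also have "\<dots> = (\<Sum>u<N. measure (P x) {\<omega> \<in> \<Omega>. \<omega> \<in> A \<and> X s \<omega> = Some u \<and> stays N s (s + t) \<omega> \<and> X (s + t) \<omega> = Some y})"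
  proof (rule P.finite_measure_finite_Union)
    have "{\<omega> \<in> \<Omega>. \<omega> \<in> A \<and> X s \<omega> = Some u \<and> stays N s (s + t) \<omega> \<and> X (s + t) \<omega> = Some y} =
        A \<inter> {\<omega> \<in> \<Omega>. X s \<omega> = Some u} \<inter> {\<omega> \<in> \<Omega>. stays N s (s + t) \<omega>} \<inter> {\<omega> \<in> \<Omega>. X (s + t) \<omega> = Some y}" for u
      by auto
    also have "\<dots> u \<in> sets (P x)" for u
      using A past_events_sets[of s x] s by (intro sets.Int sets_X_eq sets_stays') auto
    finally show "(\<lambda>u. {\<omega> \<in> \<Omega>. \<omega> \<in> A \<and> X s \<omega> = Some u \<and> stays N s (s + t) \<omega> \<and> X (s + t) \<omega> = Some y}) ` {..<N} \<subseteq> sets (P x)"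
      by auto
  qed (auto simp: disjoint_family_on_def)
  also have "\<dots> = (\<Sum>u<N. pN N s x u * pN N t u y)"
  proof (rule sum.cong[OF refl])
    fix u assume u: "u \<in> {..<N}"
    have "{\<omega> \<in> \<Omega>. \<omega> \<in> A \<and> X s \<omega> = Some u} = {\<omega> \<in> \<Omega>. stays N 0 s \<omega> \<and> X s \<omega> = Some u}"
      unfolding A_def by auto
    then show "measure (P x) {\<omega> \<in> \<Omega>. \<omega> \<in> A \<and> X s \<omega> = Some u \<and> stays N s (s + t) \<omega> \<and> X (s + t) \<omega> = Some y} =
        pN N s x u * pN N t u y"
      using markov_pN[OF s A _ xy(2), of u x] u unfolding pN_def by simp
  qed
  finally show ?thesis .
qed

text \<open>A path alive at time \<open>t\<close> has visited only finitely many states before,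
  hence stays in some block.\<close>

lemma pN_tendsto:
  assumes t: "0 \<le> t" shows "(\<lambda>N. pN N t x y) \<longlonglongrightarrow> p t x y"
proof -
  define B where "B N = {\<omega> \<in> \<Omega>. stays N 0 t \<omega> \<and> X t \<omega> = Some y}" for N
  have "B N = {\<omega> \<in> \<Omega>. stays N 0 t \<omega>} \<inter> {\<omega> \<in> \<Omega>. X t \<omega> = Some y}" for N unfolding B_def by auto
  then have "B N \<in> sets (P x)" for N
    using t by (auto intro!: sets.Int sets_stays' sets_X_eq)
  moreover have "incseq B"
    unfolding B_def stays_def by (rule monoI) (fastforce simp: image_iff)
  ultimately have "(\<lambda>N. measure (P x) (B N)) \<longlonglongrightarrow> measure (P x) (\<Union>N. B N)"
    by (intro P.finite_Lim_measure_incseq) auto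
  moreover have "(\<Union>N. B N) = {\<omega> \<in> \<Omega>. X t \<omega> = Some y}"
  proof (intro equalityI subsetI)
    fix \<omega> assume "\<omega> \<in> {\<omega> \<in> \<Omega>. X t \<omega> = Some y}"
    then have \<omega>: "\<omega> \<in> \<Omega>" "X t \<omega> = Some y" by auto
    obtain N where "\<And>s. 0 \<le> s \<Longrightarrow> s \<le> t \<Longrightarrow> X s \<omega> \<in> Some ` {..<N}"
      using bounded_before[OF \<omega>(1) t] \<omega>(2) by blast
    then have "\<omega> \<in> B N" unfolding B_def stays_def using \<omega> by simp
    then show "\<omega> \<in> (\<Union>N. B N)" by blast
  qed (auto simp: B_def)
  ultimately show ?thesis unfolding pN_def p_def B_def by simp
qed

section \<open>Differentiability of the killed semigroup\<close>

primrec grid_power :: "nat \<Rightarrow> real \<Rightarrow> nat \<Rightarrow> nat \<Rightarrow> nat \<Rightarrow> real" where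
  "grid_power N h 0 x y = (if x = y then 1 else 0)"
| "grid_power N h (Suc n) x y = (\<Sum>v<N. p h x v * grid_power N h n v y)"

lemma cyl_eq_grid_power:
  assumes "0 < n" "y < N" shows "cyl h (grid_sets N n y) x = grid_power N h n x y"
proof -
  have "cyl h (replicate k {..<N} @ [{y}]) x = grid_power N h (Suc k) x y" for k
  proof (induction k arbitrary: x)
    case 0
    have "(\<Sum>v<N. p h x v * (if v = y then 1 else 0)) = (\<Sum>v<N. if v = y then p h x v else 0)"
      by (intro sum.cong) auto
    then show ?case using assms by simp
  next
    case (Suc k)
    then show ?case by (simp del: grid_power.simps(2) add: grid_power.simps(2)[of N h "Suc k"])
  qed
  then show ?thesis unfolding grid_sets_def using assms by (cases n) auto
qed

text \<open>Let \<open>d n\<close> be the increment from power \<open>n\<close> to power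
  \<open>n + 1\<close> of the block of \<open>p h\<close>. The block is substochastic, so all second
  differences are bounded like the first one, by \<open>N * c\<^sup>2\<close>; two summations
  produce the factor \<open>n\<^sup>2\<close>.\<close>

lemma grid_power_first_order:
  assumes h: "0 \<le> h" and c: "0 \<le> c" "\<And>x y. x < N \<Longrightarrow> y < N \<Longrightarrow> \<bar>p h x y - (if x = y then 1 else 0)\<bar> \<le> c"
    and xy: "x < N" "y < N"
  shows "\<bar>grid_power N h n x y - (if x = y then 1 else 0) - real n * (p h x y - (if x = y then 1 else 0))\<bar> \<le> N * c\<^sup>2 * (real n)\<^sup>2"
proof -
  define d where "d n x = grid_power N h (Suc n) x y - grid_power N h n x y" for n x
  have d0: "d 0 x = p h x y - (if x = y then 1 else 0)" for x
  proof -
    have "(\<Sum>v<N. p h x v * (if v = y then 1 else 0)) = (\<Sum>v<N. if v = y then p h x v else 0)"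
      by (intro sum.cong) auto
    then show ?thesis unfolding d_def using xy by simp
  qed
  have d_Suc: "d (Suc n) x = (\<Sum>v<N. p h x v * d n v)" for n x
    unfolding d_def by (simp add: right_diff_distrib sum_subtractf)
  have dd: "\<bar>d (Suc n) x - d n x\<bar> \<le> N * c\<^sup>2" if "x < N" for n x
    using that
  proof (induction n arbitrary: x)
    case 0
    have "d (Suc 0) x - d 0 x = (\<Sum>v<N. p h x v * d 0 v) - (\<Sum>v<N. if v = x then d 0 v else 0)"
      unfolding d_Suc using 0 by simp
    also have "\<dots> = (\<Sum>v<N. (p h x v - (if x = v then 1 else 0)) * d 0 v)"
      unfolding sum_subtractf[symmetric] by (intro sum.cong) (auto simp: algebra_simps)
    also have "\<bar>\<dots>\<bar> \<le> (\<Sum>v<N. c * c)"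
    proof (rule order_trans[OF sum_abs], rule sum_mono)
      fix v assume "v \<in> {..<N}"
      then have "\<bar>p h x v - (if x = v then 1 else 0)\<bar> \<le> c" "\<bar>d 0 v\<bar> \<le> c"
        using c(2) 0 xy unfolding d0 by auto
      then show "\<bar>(p h x v - (if x = v then 1 else 0)) * d 0 v\<bar> \<le> c * c"
        unfolding abs_mult by (intro mult_mono) (use c in auto)
    qed
    finally show ?case by (simp add: power2_eq_square)
  next
    case (Suc n)
    have "d (Suc (Suc n)) x - d (Suc n) x = (\<Sum>v<N. p h x v * (d (Suc n) v - d n v))"
      by (subst (1 2) d_Suc) (simp add: right_diff_distrib sum_subtractf)
    also have "\<bar>\<dots>\<bar> \<le> (\<Sum>v<N. p h x v * (N * c\<^sup>2))"
      using Suc.IH p_nonneg by (intro order_trans[OF sum_abs] sum_mono) (auto simp: abs_mult intro!: mult_left_mono)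
    also have "\<dots> \<le> 1 * (N * c\<^sup>2)"
      unfolding sum_distrib_right[symmetric] using sum_p_le_1[OF h, of "{..<N}" x] by (intro mult_right_mono) auto
    finally show ?case by simp
  qed
  have dn: "\<bar>d n x - d 0 x\<bar> \<le> real n * (N * c\<^sup>2)" for n
  proof (induction n)
    case (Suc n)
    then show ?case using dd[OF xy(1), of n] by (simp add: distrib_right)
  qed simp
  have "\<bar>grid_power N h n x y - (if x = y then 1 else 0) - real n * d 0 x\<bar> \<le> (real n)\<^sup>2 * (N * c\<^sup>2)"
  proof (induction n)
    case (Suc n)
    have "grid_power N h (Suc n) x y - (if x = y then 1 else 0) - real (Suc n) * d 0 x =
        (grid_power N h n x y - (if x = y then 1 else 0) - real n * d 0 x) + (d n x - d 0 x)"
      unfolding d_def by (simp add: algebra_simps)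
    then have "\<bar>grid_power N h (Suc n) x y - (if x = y then 1 else 0) - real (Suc n) * d 0 x\<bar> \<le>
        (real n)\<^sup>2 * (N * c\<^sup>2) + real n * (N * c\<^sup>2)"
      using Suc dn[of n] by linarith
    also have "\<dots> = ((real n)\<^sup>2 + real n) * (N * c\<^sup>2)" by (simp add: distrib_right)
    also have "\<dots> \<le> (real (Suc n))\<^sup>2 * (N * c\<^sup>2)"
    proof (rule mult_right_mono)
      show "(real n)\<^sup>2 + real n \<le> (real (Suc n))\<^sup>2" by (simp add: power2_eq_square algebra_simps)
    qed simp
    finally show ?case .
  qed simp
  then show ?thesis unfolding d0 by (simp add: mult.commute)
qed

text \<open>With \<open>2 ^ m\<close> steps of size \<open>h = t / 2 ^ m\<close> and one-step
  deviations at most \<open>c * h\<close>, the bound of \<open>grid_power_first_order\<close> is the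
  same for every mesh, while the linear term converges to \<open>t * Q x y\<close>.\<close>

lemma pN_first_order:
  obtains C where "0 \<le> C" "\<And>t x y. 0 \<le> t \<Longrightarrow> x < N \<Longrightarrow> y < N \<Longrightarrow>
    \<bar>pN N t x y - (if x = y then 1 else 0) - t * Q x y\<bar> \<le> C * t\<^sup>2"
proof -
  \<comment> \<open>The added 1 makes \<open>c\<close> strictly larger than every rate in the block,
    so the difference quotients eventually stay below it.\<close>
  define c where "c = (\<Sum>x<N. \<Sum>y<N. \<bar>Q x y\<bar>) + 1"
  have Q_less: "\<bar>Q x y\<bar> < c" if "x < N" "y < N" for x y
  proof -
    have "\<bar>Q x y\<bar> \<le> (\<Sum>y<N. \<bar>Q x y\<bar>)" using that by (intro member_le_sum) auto
    also have "\<dots> \<le> (\<Sum>x<N. \<Sum>y<N. \<bar>Q x y\<bar>)" using that by (intro member_le_sum[of x "{..<N}" "\<lambda>x. \<Sum>y<N. \<bar>Q x y\<bar>"]) (auto intro: sum_nonneg)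
    finally show ?thesis unfolding c_def by simp
  qed
  have c: "0 \<le> c" unfolding c_def by (auto intro!: add_nonneg_nonneg sum_nonneg)
  have small: "\<forall>\<^sub>F h in at_right 0. \<forall>x\<in>{..<N}. \<forall>y\<in>{..<N}. \<bar>p h x y - (if x = y then 1 else 0)\<bar> \<le> c * h"
  proof (intro eventually_ball_finite finite_lessThan ballI)
    fix x y assume "x \<in> {..<N}" "y \<in> {..<N}"
    then have xy: "x < N" "y < N" by auto
    have "\<forall>\<^sub>F h in at_right 0. \<bar>(p h x y - (if x = y then 1 else 0)) / h\<bar> < c"
      using tendsto_rabs[OF p_derivative[of x y]] Q_less[OF xy] by (rule order_tendstoD(2))
    moreover have "\<forall>\<^sub>F h in at_right (0::real). 0 < h" by (rule eventually_at_right_less)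
    ultimately show "\<forall>\<^sub>F h in at_right 0. \<bar>p h x y - (if x = y then 1 else 0)\<bar> \<le> c * h"
      by eventually_elim (simp add: abs_divide divide_less_eq)
  qed
  show ?thesis
  proof (rule that[of "N * c\<^sup>2"])
    fix t :: real and x y assume t: "0 \<le> t" and xy: "x < N" "y < N"
    show "\<bar>pN N t x y - (if x = y then 1 else 0) - t * Q x y\<bar> \<le> N * c\<^sup>2 * t\<^sup>2"
    proof (cases "t = 0")
      case False
      then have t0: "0 < t" using t by simp
      define e where "e m = (p (t / 2 ^ m) x y - (if x = y then 1 else 0)) / (t / 2 ^ m)" for m :: nat
      have "(\<lambda>m. \<bar>cyl (t / 2 ^ m) (grid_sets N (2 ^ m) y) x - (if x = y then 1 else 0) - t * e m\<bar>) \<longlonglongrightarrow>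
          \<bar>pN N t x y - (if x = y then 1 else 0) - t * Q x y\<bar>"
        unfolding e_def
        by (intro tendsto_intros cyl_tendsto_pN t0 xy filterlim_compose[OF p_derivative filterlim_halving])
      moreover have "\<forall>\<^sub>F m in sequentially. \<bar>cyl (t / 2 ^ m) (grid_sets N (2 ^ m) y) x - (if x = y then 1 else 0) - t * e m\<bar> \<le> N * c\<^sup>2 * t\<^sup>2"
        using eventually_compose_filterlim[OF small filterlim_halving[OF t0]]
      proof eventually_elim
        case (elim m)
        define h where "h = t / 2 ^ m"
        have h: "0 < h" "2 ^ m * h = t" unfolding h_def using t0 by auto
        have "\<bar>grid_power N h (2 ^ m) x y - (if x = y then 1 else 0) - real (2 ^ m) * (p h x y - (if x = y then 1 else 0))\<bar>
            \<le> N * (c * h)\<^sup>2 * (real (2 ^ m))\<^sup>2"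
          using h c elim xy unfolding h_def[symmetric] by (intro grid_power_first_order) auto
        also have "real (2 ^ m) * (p h x y - (if x = y then 1 else 0)) = t * e m"
          unfolding e_def h_def[symmetric] using h t0 by (simp add: field_simps)
        also have "N * (c * h)\<^sup>2 * (real (2 ^ m))\<^sup>2 = N * c\<^sup>2 * t\<^sup>2"
          unfolding h(2)[symmetric] by (simp add: power_mult_distrib)
        also have "grid_power N h (2 ^ m) x y = cyl h (grid_sets N (2 ^ m) y) x"
          using xy by (intro cyl_eq_grid_power[symmetric]) auto
        finally show ?case unfolding h_def .
      qed
      ultimately show ?thesis by (intro tendsto_upperbound) auto
    qed (use xy in \<open>simp add: pN_0\<close>)
  qed simp
qed

text \<open>The semigroup property carries the quadratic estimate at time 0 to every time, with the
  short step taken last for the forward equation and first for the backward one.\<close>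

lemma pN_derivatives:
  assumes xy: "x < N" "y < N" and t: "0 \<le> t"
  shows pN_forward: "((\<lambda>t. pN N t x y) has_real_derivative (\<Sum>u<N. pN N t x u * Q u y)) (at t within {0..})"
    and pN_backward: "((\<lambda>t. pN N t x y) has_real_derivative (\<Sum>u<N. Q x u * pN N t u y)) (at t within {0..})"
proof -
  obtain C where C: "0 \<le> C" "\<And>t x y. 0 \<le> t \<Longrightarrow> x < N \<Longrightarrow> y < N \<Longrightarrow>
      \<bar>pN N t x y - (if x = y then 1 else 0) - t * Q x y\<bar> \<le> C * t\<^sup>2"
    using pN_first_order[of N] by blast
  have pN_le_1: "pN N s x y \<le> 1" for s x y unfolding pN_def by simp
  have delta: "(\<Sum>u<N. pN N a x u * (if u = y then 1 else 0)) = pN N a x y"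
    "(\<Sum>u<N. (if x = u then 1 else 0) * pN N a u y) = pN N a x y" if "x < N" "y < N" for a x y
  proof -
    have 1: "(\<Sum>u<N. pN N a x u * (if u = y then 1 else 0)) = (\<Sum>u<N. if u = y then pN N a x u else 0)"
      and 2: "(\<Sum>u<N. (if x = u then 1 else 0) * pN N a u y) = (\<Sum>u<N. if x = u then pN N a u y else 0)"
      by (rule sum.cong, simp, simp)+
    show "(\<Sum>u<N. pN N a x u * (if u = y then 1 else 0)) = pN N a x y"
      unfolding 1 using that by simp
    show "(\<Sum>u<N. (if x = u then 1 else 0) * pN N a u y) = pN N a x y"
      unfolding 2 using that by simp
  qed
  have fwd: "\<bar>pN N (a + h) x y - pN N a x y - h * (\<Sum>u<N. pN N a x u * Q u y)\<bar> \<le> N * C * h\<^sup>2"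
    if "0 \<le> a" "0 \<le> h" "x < N" "y < N" for a h x y
  proof -
    have "pN N (a + h) x y - pN N a x y - h * (\<Sum>u<N. pN N a x u * Q u y) =
        (\<Sum>u<N. pN N a x u * pN N h u y) - (\<Sum>u<N. pN N a x u * (if u = y then 1 else 0))
          - (\<Sum>u<N. pN N a x u * (h * Q u y))"
      unfolding pN_semigroup[OF that] delta(1)[OF that(3,4)] by (simp add: sum_distrib_left mult_ac)
    also have "\<dots> = (\<Sum>u<N. pN N a x u * (pN N h u y - (if u = y then 1 else 0) - h * Q u y))"
      by (simp only: right_diff_distrib sum_subtractf)
    also have "\<bar>\<dots>\<bar> \<le> (\<Sum>u<N. 1 * (C * h\<^sup>2))"
    proof (rule order_trans[OF sum_abs], rule sum_mono)
      fix u assume "u \<in> {..<N}"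
      then have "\<bar>pN N h u y - (if u = y then 1 else 0) - h * Q u y\<bar> \<le> C * h\<^sup>2"
        using C(2) that by simp
      then show "\<bar>pN N a x u * (pN N h u y - (if u = y then 1 else 0) - h * Q u y)\<bar> \<le> 1 * (C * h\<^sup>2)"
        unfolding abs_mult using pN_nonneg[of N a x u] pN_le_1[of a x u] by (intro mult_mono) auto
    qed
    finally show ?thesis by simp
  qed
  have bwd: "\<bar>pN N (a + h) x y - pN N a x y - h * (\<Sum>u<N. Q x u * pN N a u y)\<bar> \<le> N * C * h\<^sup>2"
    if "0 \<le> a" "0 \<le> h" "x < N" "y < N" for a h x y
  proof -
    have "pN N (a + h) x y - pN N a x y - h * (\<Sum>u<N. Q x u * pN N a u y) =
        (\<Sum>u<N. pN N h x u * pN N a u y) - (\<Sum>u<N. (if x = u then 1 else 0) * pN N a u y)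
          - (\<Sum>u<N. h * Q x u * pN N a u y)"
      using pN_semigroup[OF that(2,1,3,4)] unfolding delta(2)[OF that(3,4)]
      by (simp add: sum_distrib_left mult_ac add.commute)
    also have "\<dots> = (\<Sum>u<N. (pN N h x u - (if x = u then 1 else 0) - h * Q x u) * pN N a u y)"
      by (simp only: left_diff_distrib sum_subtractf)
    also have "\<bar>\<dots>\<bar> \<le> (\<Sum>u<N. (C * h\<^sup>2) * 1)"
    proof (rule order_trans[OF sum_abs], rule sum_mono)
      fix u assume "u \<in> {..<N}"
      then have "\<bar>pN N h x u - (if x = u then 1 else 0) - h * Q x u\<bar> \<le> C * h\<^sup>2"
        using C(2) that by simp
      then show "\<bar>(pN N h x u - (if x = u then 1 else 0) - h * Q x u) * pN N a u y\<bar> \<le> (C * h\<^sup>2) * 1"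
        unfolding abs_mult using pN_nonneg[of N a u y] pN_le_1[of a u y] C(1) by (intro mult_mono) auto
    qed
    finally show ?thesis by simp
  qed
  define M where "M = (\<Sum>x<N. \<Sum>y<N. \<bar>Q x y\<bar>)"
  have lip: "\<bar>pN N (a + h) x y - pN N a x y\<bar> \<le> (N * C + M) * h"
    if a: "0 \<le> a" "0 \<le> h" "h \<le> 1" "x < N" "y < N" for a h x y
  proof -
    have "\<bar>\<Sum>u<N. pN N a x u * Q u y\<bar> \<le> (\<Sum>u<N. \<bar>Q u y\<bar>)"
      using pN_nonneg pN_le_1 by (intro order_trans[OF sum_abs] sum_mono) (simp add: abs_mult mult_left_le_one_le)
    also have "\<dots> \<le> M"
      unfolding M_def using a by (intro sum_mono member_le_sum) auto
    finally have "\<bar>h * (\<Sum>u<N. pN N a x u * Q u y)\<bar> \<le> h * M"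
      using a by (simp add: abs_mult mult_left_mono)
    moreover have "h\<^sup>2 \<le> h" using a by (simp add: power2_eq_square mult_left_le)
    then have "N * C * h\<^sup>2 \<le> N * C * h" using C by (intro mult_left_mono) auto
    ultimately have "\<bar>pN N (a + h) x y - pN N a x y\<bar> \<le> N * C * h + h * M"
      using fwd[OF a(1,2,4,5)] by linarith
    then show ?thesis by (simp add: algebra_simps)
  qed
  show "((\<lambda>t. pN N t x y) has_real_derivative (\<Sum>u<N. pN N t x u * Q u y)) (at t within {0..})"
  proof (rule derivative_of_quadratic_error[OF _ _ t, where K="N * C"])
    fix a h :: real assume a: "0 \<le> a" "0 \<le> h" "h \<le> 1"
    show "\<bar>pN N (a + h) x y - pN N a x y - h * (\<Sum>u<N. pN N a x u * Q u y)\<bar> \<le> N * C * h\<^sup>2"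
      using fwd[OF a(1,2) xy] .
    have "\<bar>(\<Sum>u<N. pN N (a + h) x u * Q u y) - (\<Sum>u<N. pN N a x u * Q u y)\<bar> \<le>
        (\<Sum>u<N. (N * C + M) * h * \<bar>Q u y\<bar>)"
      unfolding sum_subtractf[symmetric] left_diff_distrib[symmetric]
      using lip[OF a xy(1)] by (intro order_trans[OF sum_abs] sum_mono) (auto simp: abs_mult intro!: mult_right_mono)
    then show "\<bar>(\<Sum>u<N. pN N (a + h) x u * Q u y) - (\<Sum>u<N. pN N a x u * Q u y)\<bar> \<le>
        ((N * C + M) * (\<Sum>u<N. \<bar>Q u y\<bar>)) * h"
      by (simp add: sum_distrib_left mult_ac)
  qed
  show "((\<lambda>t. pN N t x y) has_real_derivative (\<Sum>u<N. Q x u * pN N t u y)) (at t within {0..})"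
  proof (rule derivative_of_quadratic_error[OF _ _ t, where K="N * C"])
    fix a h :: real assume a: "0 \<le> a" "0 \<le> h" "h \<le> 1"
    show "\<bar>pN N (a + h) x y - pN N a x y - h * (\<Sum>u<N. Q x u * pN N a u y)\<bar> \<le> N * C * h\<^sup>2"
      using bwd[OF a(1,2) xy] .
    have "\<bar>(\<Sum>u<N. Q x u * pN N (a + h) u y) - (\<Sum>u<N. Q x u * pN N a u y)\<bar> \<le>
        (\<Sum>u<N. \<bar>Q x u\<bar> * ((N * C + M) * h))"
      unfolding sum_subtractf[symmetric] right_diff_distrib[symmetric]
      using lip[OF a _ xy(2)] by (intro order_trans[OF sum_abs] sum_mono) (auto simp: abs_mult intro!: mult_left_mono)
    then show "\<bar>(\<Sum>u<N. Q x u * pN N (a + h) u y) - (\<Sum>u<N. Q x u * pN N a u y)\<bar> \<le>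
        ((N * C + M) * (\<Sum>u<N. \<bar>Q x u\<bar>)) * h"
      by (simp add: sum_distrib_left mult_ac)
  qed
qed

end

section \<open>Absorption at zero\<close>

locale absorbed_chain = skip_free_chain P X Q
  for P :: "nat \<Rightarrow> 'w measure" and X :: "real \<Rightarrow> 'w \<Rightarrow> nat option" and Q :: "nat \<Rightarrow> nat \<Rightarrow> real" +
  assumes hits: "\<P>(\<omega> in P x. hitting_time X {0} \<omega> < \<infinity>) = 1"
begin

lemma Omega_sets [simp]: "\<Omega> \<in> sets (P x)"
  using sets.top[of "P x"] by simp

lemma emeasure_Omega [simp]: "emeasure (P x) \<Omega> = 1"
  using P.emeasure_space_1[of x] by simp

lemma p_0_0: "0 \<le> t \<Longrightarrow> p t 0 0 = 1"
  using trap[of t] unfolding p_def by simp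

lemma AE_absorbed_pair:
  assumes "0 \<le> r" "r \<le> q"
  shows "AE \<omega> in P x. X r \<omega> = Some 0 \<longrightarrow> X q \<omega> = Some 0"
proof -
  have "measure (P x) {\<omega> \<in> \<Omega>. X r \<omega> = Some 0 \<and> X q \<omega> = Some 0} = measure (P x) {\<omega> \<in> \<Omega>. X r \<omega> = Some 0}"
    using markov_p_0[of r "q - r" x 0 0] p_0_0[of "q - r"] assms unfolding p_def by simp
  moreover have sub: "{\<omega> \<in> \<Omega>. X r \<omega> = Some 0 \<and> X q \<omega> = Some 0} = {\<omega> \<in> \<Omega>. X r \<omega> = Some 0} \<inter> {\<omega> \<in> \<Omega>. X q \<omega> = Some 0}"
    by auto
  ultimately have "measure (P x) ({\<omega> \<in> \<Omega>. X r \<omega> = Some 0} - {\<omega> \<in> \<Omega>. X r \<omega> = Some 0 \<and> X q \<omega> = Some 0}) = 0"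
    using assms by (subst P.finite_measure_Diff) (auto intro!: sets_X_eq sets.Int)
  then have "{\<omega> \<in> \<Omega>. X r \<omega> = Some 0} - {\<omega> \<in> \<Omega>. X r \<omega> = Some 0 \<and> X q \<omega> = Some 0} \<in> null_sets (P x)"
    unfolding sub using assms
    by (intro null_setsI) (auto intro!: sets_X_eq sets.Int sets.Diff simp: P.emeasure_eq_measure)
  then show ?thesis by (rule AE_I') auto
qed

text \<open>Countably many rational pairs give one null set. A visit to 0 at \<open>r\<close> lasts
  until a rational time, so the path is at 0 at all rational times after \<open>t\<close>; it is
  then alive at \<open>t\<close>, and right continuity identifies its state there.\<close>

lemma AE_absorbed: "AE \<omega> in P x. \<forall>r t. 0 \<le> r \<longrightarrow> r \<le> t \<longrightarrow> X r \<omega> = Some 0 \<longrightarrow> X t \<omega> = Some 0"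
proof -
  have "AE \<omega> in P x. \<forall>r\<in>\<rat> \<inter> {0..}. \<forall>q\<in>\<rat> \<inter> {r..}. X r \<omega> = Some 0 \<longrightarrow> X q \<omega> = Some 0"
    by (intro AE_ball_countable[THEN iffD2] ballI AE_absorbed_pair countable_Int1 countable_rat) auto
  then show ?thesis
  proof (rule AE_mp[OF _ AE_I2], intro impI allI)
    fix \<omega> r t
    assume \<omega>: "\<omega> \<in> space (P x)" and rat: "\<forall>r\<in>\<rat> \<inter> {0..}. \<forall>q\<in>\<rat> \<inter> {r..}. X r \<omega> = Some 0 \<longrightarrow> X q \<omega> = Some 0"
      and r: "0 \<le> r" "r \<le> t" "X r \<omega> = Some (0::nat)"
    have \<omega>': "\<omega> \<in> \<Omega>" using \<omega> by simp
    show "X t \<omega> = Some 0"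
    proof (cases "r = t")
      case False
      obtain r' where r': "r' \<in> \<rat>" "r < r'" "ereal r' < ereal t" "X r' \<omega> = X r \<omega>"
        using dense_time[OF \<omega>' r(1), of "{0}" "ereal t"] r False by auto
      have X0: "X q \<omega> = Some 0" if "q \<in> \<rat>" "t < q" for q
        using rat r' that r by auto
      obtain q where q: "q \<in> \<rat>" "t < q" using Rats_dense_in_real[of t "t + 1"] by auto
      obtain w where w: "X t \<omega> = Some w" using alive_before[OF \<omega>', of t q] X0[OF q] q r by auto
      obtain q' where "q' \<in> \<rat>" "t < q'" "X q' \<omega> = X t \<omega>"
        using dense_time[OF \<omega>', of t "{w}" "\<infinity>"] w r by auto
      then show ?thesis using X0[of q'] by simp
    qed (use r in simp)
  qed
qed

text \<open>The delicate case is a hitting time at most \<open>t\<close> with the path not at 0 at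
  \<open>t\<close>: it would be at 0 at all later times, hence alive at \<open>t\<close>,
  contradicting right continuity. The cemetery counts as not absorbed.\<close>

lemma AE_hitting_time_0:
  "AE \<omega> in P x. \<forall>t\<ge>0. ereal t < hitting_time X {0} \<omega> \<longleftrightarrow> X t \<omega> \<noteq> Some 0"
  using AE_absorbed[of x]
proof (rule AE_mp[OF _ AE_I2], intro impI allI)
  fix \<omega> t
  assume \<omega>: "\<omega> \<in> space (P x)" and abs: "\<forall>r t. 0 \<le> r \<longrightarrow> r \<le> t \<longrightarrow> X r \<omega> = Some 0 \<longrightarrow> X t \<omega> = Some 0"
    and t: "0 \<le> (t::real)"
  have \<omega>': "\<omega> \<in> \<Omega>" using \<omega> by simp
  show "ereal t < hitting_time X {0} \<omega> \<longleftrightarrow> X t \<omega> \<noteq> Some 0"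
  proof
    assume "ereal t < hitting_time X {0} \<omega>"
    then obtain s where s: "ereal t < ereal s" "ereal s < hitting_time X {0} \<omega>" using ereal_dense2 by blast
    show "X t \<omega> \<noteq> Some 0"
    proof
      assume "X t \<omega> = Some 0"
      then have "X s \<omega> = Some 0" using abs t s by auto
      then have "hitting_time X {0} \<omega> \<le> ereal s" using s t by (intro hitting_time_le) auto
      then show False using s by simp
    qed
  next
    assume not0: "X t \<omega> \<noteq> Some 0"
    show "ereal t < hitting_time X {0} \<omega>"
    proof (rule ccontr)
      assume "\<not> ereal t < hitting_time X {0} \<omega>"
      then have le: "hitting_time X {0} \<omega> \<le> ereal t" by simp
      have X0: "X s \<omega> = Some 0" if s: "t < s" for s
      proof -
        have "hitting_time X {0} \<omega> < ereal s" using le s by (intro le_less_trans[OF le]) simp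
        then obtain r where "0 < r" "ereal r < ereal s" "X r \<omega> \<in> Some ` {0}"
          using hitting_time_less_iff[OF \<omega>', of "{0}" "ereal s"] by auto
        then have "X r \<omega> = Some 0" "0 \<le> r" "r \<le> s" by auto
        then show ?thesis using abs by blast
      qed
      obtain w where w: "X t \<omega> = Some w" using alive_before[OF \<omega>', of t "t + 1"] X0[of "t + 1"] t by auto
      obtain e where "0 < e" "\<And>s. t \<le> s \<Longrightarrow> s < t + e \<Longrightarrow> X s \<omega> = Some w"
        using right_constant[OF \<omega>' t w] by blast
      then have "X (t + e / 2) \<omega> = Some w" by simp
      then show False using X0[of "t + e / 2"] \<open>0 < e\<close> w not0 by simp
    qed
  qed
qed

lemma measure_survival:
  assumes "0 \<le> t"
  shows "measure (P x) {\<omega> \<in> \<Omega>. ereal t < hitting_time X {0} \<omega>} = 1 - p t x 0"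
proof -
  have "measure (P x) {\<omega> \<in> \<Omega>. ereal t < hitting_time X {0} \<omega>} = measure (P x) (space (P x) - {\<omega> \<in> \<Omega>. X t \<omega> = Some 0})"
  proof (rule P.finite_measure_eq_AE)
    show "AE \<omega> in P x. (\<omega> \<in> {\<omega> \<in> \<Omega>. ereal t < hitting_time X {0} \<omega>}) = (\<omega> \<in> space (P x) - {\<omega> \<in> \<Omega>. X t \<omega> = Some 0})"
      using AE_hitting_time_0[of x] by eventually_elim (use assms in auto)
    have "{\<omega> \<in> space (P x). ereal t < hitting_time X {0} \<omega>} \<in> sets (P x)" by measurable
    then show "{\<omega> \<in> \<Omega>. ereal t < hitting_time X {0} \<omega>} \<in> sets (P x)" by simp
  qed (use assms in \<open>auto intro!: sets.Diff sets_X_eq\<close>)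
  also have "\<dots> = 1 - p t x 0"
    unfolding p_def using assms by (intro P.prob_compl sets_X_eq)
  finally show ?thesis .
qed

lemma p_absorbed_mono:
  assumes "0 \<le> s" "s \<le> t" shows "p s x 0 \<le> p t x 0"
  unfolding p_def
proof (rule P.finite_measure_mono_AE)
  show "AE \<omega> in P x. \<omega> \<in> {\<omega> \<in> \<Omega>. X s \<omega> = Some 0} \<longrightarrow> \<omega> \<in> {\<omega> \<in> \<Omega>. X t \<omega> = Some 0}"
    using AE_absorbed[of x] by eventually_elim (use assms in auto)
qed (use assms in \<open>auto intro: sets_X_eq\<close>)

lemma p_absorbed: "((\<lambda>t. p t x 0) \<longlongrightarrow> 1) at_top"
proof (rule order_tendstoI)
  fix a :: real assume a: "a < 1"
  define B where "B n = {\<omega> \<in> \<Omega>. hitting_time X {0} \<omega> < ereal (real n)}" for n :: nat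
  have "(\<lambda>n. measure (P x) (B n)) \<longlonglongrightarrow> measure (P x) (\<Union>n. B n)"
  proof (rule P.finite_Lim_measure_incseq)
    show "incseq B" unfolding B_def by (rule monoI) (auto intro: less_le_trans)
  qed (auto simp: B_def sets_hitting_time_less)
  also have "(\<Union>n. B n) = {\<omega> \<in> \<Omega>. hitting_time X {0} \<omega> < \<infinity>}"
  proof -
    have "(\<exists>n. y < ereal (real n)) \<longleftrightarrow> y < \<infinity>" if "0 \<le> y" for y
      using that by (cases y) (auto simp: reals_Archimedean2)
    then show ?thesis unfolding B_def using hitting_time_nonneg by auto
  qed
  also have "measure (P x) {\<omega> \<in> \<Omega>. hitting_time X {0} \<omega> < \<infinity>} = 1" using hits[of x] by simp
  finally have "\<forall>\<^sub>F n in sequentially. a < measure (P x) (B n)"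
    using a by (rule order_tendstoD(1))
  then obtain n where n: "a < measure (P x) (B n)" by (auto simp: eventually_at_top_linorder)
  have "measure (P x) (B n) \<le> p (real n) x 0"
    unfolding p_def
  proof (rule P.finite_measure_mono_AE)
    show "AE \<omega> in P x. \<omega> \<in> B n \<longrightarrow> \<omega> \<in> {\<omega> \<in> \<Omega>. X (real n) \<omega> = Some 0}"
      using AE_hitting_time_0[of x]
    proof eventually_elim
      case (elim \<omega>)
      then have "ereal (real n) < hitting_time X {0} \<omega> \<longleftrightarrow> X (real n) \<omega> \<noteq> Some 0" by auto
      then show ?case unfolding B_def by (auto dest: less_asym)
    qed
  qed (auto intro: sets_X_eq)
  then have "a < p t x 0" if "real n \<le> t" for t
    using n p_absorbed_mono[OF _ that, of x] by simp
  then show "\<forall>\<^sub>F t in at_top. a < p t x 0" unfolding eventually_at_top_linorder by blast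
next
  fix a :: real assume "1 < a"
  then have "p t x 0 < a" for t using p_le_1[of t x 0] by linarith
  then show "\<forall>\<^sub>F t in at_top. p t x 0 < a" by simp
qed

text \<open>A path sitting at 0 at a later time was alive at \<open>t\<close>; as that later time
  grows, the probability of this tends to 1.\<close>

lemma p_sums:
  assumes t: "0 \<le> t" shows "p t x sums 1"
proof -
  have "(\<lambda>y. p t x y) sums measure (P x) (\<Union>y. {\<omega> \<in> \<Omega>. X t \<omega> = Some y})"
    unfolding p_def using t by (intro P.finite_measure_UNION) (auto simp: disjoint_family_on_def intro: sets_X_eq)
  moreover have "1 \<le> measure (P x) (\<Union>y. {\<omega> \<in> \<Omega>. X t \<omega> = Some y})"
  proof (rule tendsto_upperbound[OF p_absorbed])
    have "p s x 0 \<le> measure (P x) (\<Union>y. {\<omega> \<in> \<Omega>. X t \<omega> = Some y})" if "t \<le> s" for s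
      unfolding p_def
    proof (rule P.finite_measure_mono)
      show "{\<omega> \<in> \<Omega>. X s \<omega> = Some 0} \<subseteq> (\<Union>y. {\<omega> \<in> \<Omega>. X t \<omega> = Some y})"
        using alive_before[OF _ t that] by auto
    qed (use t in \<open>auto intro: sets_X_eq\<close>)
    then show "\<forall>\<^sub>F s in at_top. p s x 0 \<le> measure (P x) (\<Union>y. {\<omega> \<in> \<Omega>. X t \<omega> = Some y})"
      unfolding eventually_at_top_linorder by blast
  qed simp
  then have "measure (P x) (\<Union>y. {\<omega> \<in> \<Omega>. X t \<omega> = Some y}) = 1"
    using P.prob_le_1 by (intro antisym)
  ultimately show ?thesis by simp
qed

lemma p_survival:
  assumes "0 \<le> s" "0 \<le> t" shows "p s x u * (1 - p t u 0) \<le> 1 - p (s + t) x 0"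
proof -
  have eq: "{\<omega> \<in> \<Omega>. X s \<omega> = Some u \<and> X (s + t) \<omega> = Some 0} = {\<omega> \<in> \<Omega>. X s \<omega> = Some u} \<inter> {\<omega> \<in> \<Omega>. X (s + t) \<omega> = Some 0}"
    by auto
  have "p s x u * (1 - p t u 0) = p s x u - measure (P x) {\<omega> \<in> \<Omega>. X s \<omega> = Some u \<and> X (s + t) \<omega> = Some 0}"
    using markov_p_0[OF assms] by (simp add: right_diff_distrib)
  also have "\<dots> = measure (P x) ({\<omega> \<in> \<Omega>. X s \<omega> = Some u} - {\<omega> \<in> \<Omega>. X s \<omega> = Some u \<and> X (s + t) \<omega> = Some 0})"
    unfolding p_def eq using assms by (intro P.finite_measure_Diff[symmetric]) (auto intro!: sets_X_eq sets.Int)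
  also have "\<dots> \<le> measure (P x) (space (P x) - {\<omega> \<in> \<Omega>. X (s + t) \<omega> = Some 0})"
    using assms by (intro P.finite_measure_mono) (auto intro!: sets_X_eq sets.Diff)
  also have "\<dots> = 1 - p (s + t) x 0"
    unfolding p_def using assms by (intro P.prob_compl sets_X_eq) auto
  finally show ?thesis .
qed

lemma p_irreducible:
  assumes "1 \<le> x" shows "\<exists>t\<ge>0. 0 < p t x y"
proof (rule ccontr)
  assume "\<not> (\<exists>t\<ge>0. 0 < p t x y)"
  then have zero: "p t x y = 0" if "0 \<le> t" for t using that p_nonneg[of t x y] by force
  define R where "R = {r \<in> \<rat>. 0 < (r::real)}"
  have "hitting_time X {y} \<omega> < \<infinity> \<longleftrightarrow> (\<exists>r\<in>R. X r \<omega> = Some y)" if "\<omega> \<in> \<Omega>" for \<omega>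
    unfolding hitting_time_less_iff[OF that] R_def by auto
  then have "{\<omega> \<in> \<Omega>. hitting_time X {y} \<omega> < \<infinity>} = (\<Union>r\<in>R. {\<omega> \<in> \<Omega>. X r \<omega> = Some y})"
    by blast
  also have "\<dots> \<in> null_sets (P x)"
  proof (rule null_sets_UN')
    show "countable R" unfolding R_def by (rule countable_subset[OF _ countable_rat]) auto
    show "{\<omega> \<in> \<Omega>. X r \<omega> = Some y} \<in> null_sets (P x)" if "r \<in> R" for r
      using that zero[of r] unfolding R_def p_def
      by (intro null_setsI) (auto intro: sets_X_eq simp: P.emeasure_eq_measure)
  qed
  finally have "measure (P x) {\<omega> \<in> \<Omega>. hitting_time X {y} \<omega> < \<infinity>} = 0"
    by (rule measure_eq_0_null_sets)
  then show False using irreducible[OF assms, of y] by simp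
qed

section \<open>Sign and irreducibility properties of the generator\<close>

lemma Q_off_diagonal:
  assumes "x \<noteq> y" shows "0 \<le> Q x y"
proof (rule tendsto_lowerbound[OF p_derivative])
  show "\<forall>\<^sub>F h in at_right 0. 0 \<le> (p h x y - (if x = y then 1 else 0)) / h"
    using eventually_at_right_less[of "0::real"] by eventually_elim (use assms p_nonneg in auto)
qed simp

lemma Q_row_0: "Q 0 y = 0"
proof -
  have p0: "p h 0 y - (if 0 = y then 1 else 0) = 0" if "0 \<le> h" for h
  proof (cases "y = 0")
    case False
    have "p h 0 0 + p h 0 y \<le> 1" using sum_p_le_1[OF that, of "{0, y}" 0] False by simp
    then show ?thesis using p_0_0[OF that] p_nonneg[of h 0 y] False by simp
  qed (use p_0_0[OF that] in simp)
  have "\<forall>\<^sub>F h in at_right (0::real). (p h 0 y - (if 0 = y then 1 else 0)) / h = 0"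
    using eventually_at_right_less[of "0::real"] by eventually_elim (simp only: p0 less_imp_le div_0)
  then have "((\<lambda>h::real. 0) \<longlongrightarrow> Q 0 y) (at_right 0)"
    by (rule Lim_transform_eventually[OF p_derivative])
  then show ?thesis using tendsto_unique[OF trivial_limit_at_right_real _ tendsto_const] by force
qed

text \<open>If the rate from \<open>z = Suc y\<close> to \<open>y\<close> were 0, no state from
  \<open>z\<close> on could move below \<open>z\<close>. Every row sum over columns below
  \<open>z\<close> is then nonpositive, so the mass below \<open>z\<close>, started at 0, cannot
  grow, against irreducibility.\<close>

lemma Q_down_pos: "0 < Q (Suc y) y"
proof (rule ccontr)
  define z where "z = Suc y"
  assume "\<not> 0 < Q (Suc y) y"
  then have Qz: "Q z y = 0" using Q_off_diagonal[of z y] unfolding z_def by simp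
  obtain t where t: "0 \<le> t" "0 < p t z y" using p_irreducible[of z y] unfolding z_def by auto
  have "\<forall>\<^sub>F N in sequentially. 0 < pN N t z y" using order_tendstoD(1)[OF pN_tendsto[OF t(1)] t(2)] .
  moreover have "\<forall>\<^sub>F N in sequentially. z < N" by (rule eventually_gt_at_top)
  ultimately have "\<forall>\<^sub>F N in sequentially. 0 < pN N t z y \<and> z < N" by eventually_elim simp
  then obtain N where N: "0 < pN N t z y" "z < N" by (auto simp: eventually_at_top_linorder)
  have rows: "(\<Sum>v<z. Q u v) \<le> 0" for u
  proof (cases "u < z")
    case True
    then show ?thesis using conservative[of u] by (intro partial_sum_nonpos Q_off_diagonal) auto
  next
    case False
    have "Q u v = 0" if "v < z" for v
    proof (cases "u = z \<and> v = y")
      case False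
      then show ?thesis using that \<open>\<not> u < z\<close> unfolding z_def by (intro skip_free) auto
    qed (use Qz in simp)
    then show ?thesis by (simp add: sum.neutral)
  qed
  define F where "F s = - (\<Sum>v<z. pN N s z v)" for s
  define F' where "F' s = - (\<Sum>u<N. pN N s z u * (\<Sum>v<z. Q u v))" for s
  have "F 0 \<le> F t"
  proof (rule nondecreasing_of_derivative_within[where f=F and f'=F' and a=0 and b=t])
    fix s assume s: "s \<in> {0..t}"
    have "(F has_real_derivative - (\<Sum>v<z. \<Sum>u<N. pN N s z u * Q u v)) (at s within {0..t})"
      unfolding F_def using s N
      by (intro DERIV_minus DERIV_sum DERIV_subset[OF pN_forward]) auto
    also have "(\<Sum>v<z. \<Sum>u<N. pN N s z u * Q u v) = (\<Sum>u<N. pN N s z u * (\<Sum>v<z. Q u v))"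
      by (subst sum.swap) (simp add: sum_distrib_left)
    finally show "(F has_real_derivative F' s) (at s within {0..t})" unfolding F'_def .
    have "(\<Sum>u<N. pN N s z u * (\<Sum>v<z. Q u v)) \<le> 0"
    proof (rule sum_nonpos)
      show "pN N s z u * (\<Sum>v<z. Q u v) \<le> 0" for u
        using pN_nonneg rows by (rule mult_nonneg_nonpos)
    qed
    then show "0 \<le> F' s" unfolding F'_def by simp
  qed (rule t)
  moreover have "F 0 = 0" unfolding F_def using N by (simp add: pN_0)
  moreover have "pN N t z y \<le> (\<Sum>v<z. pN N t z v)"
    unfolding z_def using pN_nonneg by (intro member_le_sum) auto
  ultimately show False using N(1) unfolding F_def by linarith
qed

sublocale gen: skip_free_generator Q
proof
  show "x \<noteq> y \<Longrightarrow> 0 \<le> Q x y" for x y by (rule Q_off_diagonal)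
qed (rule conservative skip_free Q_row_0 Q_down_pos; assumption?)+

section \<open>The decay parameter in terms of survival probabilities\<close>

lemma AE_finite_hitting_time: "AE \<omega> in P x. hitting_time X {0} \<omega> < \<infinity>"
proof -
  have "{\<omega> \<in> space (P x). hitting_time X {0} \<omega> < \<infinity>} \<in> sets (P x)" by measurable
  then show ?thesis by (rule iffD1[OF P.prob_Collect_eq_1 hits])
qed

lemma decay_parameter_nonneg: "0 \<le> decay_parameter P X"
  unfolding decay_parameter_def
proof (rule Sup_upper, clarify)
  have "(\<integral>\<^sup>+ \<omega>. exp_ereal (ereal 0 * hitting_time X {0} \<omega>) \<partial>P 1) = (\<integral>\<^sup>+ \<omega>. 1 \<partial>P 1)"
    by (simp add: exp_ereal_def zero_ereal_def[symmetric])
  also have "\<dots> < \<infinity>" by (simp add: P.emeasure_space_1)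
  finally show "\<exists>l. 0 = ereal l \<and> 0 \<le> l \<and> (\<exists>x\<ge>1. (\<integral>\<^sup>+ \<omega>. exp_ereal (ereal l * hitting_time X {0} \<omega>) \<partial>P x) < \<infinity>)"
    by (intro exI[of _ 0]) (auto simp: zero_ereal_def)
qed

text \<open>Markov's inequality for the exponential moment at some admissible \<open>k\<close> above
  \<open>l\<close>, which exists because the decay parameter is a supremum.\<close>

lemma decay_parameter_upper:
  assumes l: "0 \<le> l" "ereal l < decay_parameter P X"
  shows "\<exists>x\<ge>1. \<exists>C. \<forall>t\<ge>0. 1 - p t x 0 \<le> C * exp (- l * t)"
proof -
  obtain k x where k: "l < k" "1 \<le> x" "(\<integral>\<^sup>+ \<omega>. exp_ereal (ereal k * hitting_time X {0} \<omega>) \<partial>P x) < \<infinity>"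
    using l unfolding decay_parameter_def less_Sup_iff by auto
  define I where "I = (\<integral>\<^sup>+ \<omega>. exp_ereal (ereal k * hitting_time X {0} \<omega>) \<partial>P x)"
  obtain C where C: "0 \<le> C" "I = ennreal C" using k(3) unfolding I_def by (cases "\<integral>\<^sup>+ \<omega>. exp_ereal (ereal k * hitting_time X {0} \<omega>) \<partial>P x") auto
  have "1 - p t x 0 \<le> C * exp (- l * t)" if t: "0 \<le> t" for t
  proof -
    define S where "S = {\<omega> \<in> space (P x). ereal t < hitting_time X {0} \<omega>}"
    have S: "S \<in> sets (P x)" unfolding S_def by measurable
    have "ennreal (exp (k * t)) * emeasure (P x) S = (\<integral>\<^sup>+ \<omega>. ennreal (exp (k * t)) * indicator S \<omega> \<partial>P x)"
      using S by (simp add: nn_integral_cmult_indicator)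
    also have "\<dots> \<le> I"
      unfolding I_def
    proof (rule nn_integral_mono)
      fix \<omega>
      show "ennreal (exp (k * t)) * indicator S \<omega> \<le> exp_ereal (ereal k * hitting_time X {0} \<omega>)"
      proof (cases "\<omega> \<in> S")
        case True
        then show ?thesis
          unfolding S_def exp_ereal_def using k(1) l(1) t
          by (cases "hitting_time X {0} \<omega>") (auto intro!: ennreal_leI mult_left_mono)
      qed simp
    qed
    finally have "ennreal (exp (k * t) * measure (P x) S) \<le> ennreal C"
      unfolding C(2) P.emeasure_eq_measure by (simp add: ennreal_mult)
    then have "exp (k * t) * measure (P x) S \<le> C" using C(1) by (simp add: ennreal_le_iff)
    moreover have "measure (P x) S = 1 - p t x 0" using measure_survival[OF t, of x] unfolding S_def by simp
    ultimately have "1 - p t x 0 \<le> C * exp (- k * t)" by (simp add: exp_minus field_simps)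
    also have "\<dots> \<le> C * exp (- l * t)" using C(1) k(1) t by (intro mult_left_mono) (auto intro: mult_right_mono)
    finally show ?thesis .
  qed
  then show ?thesis using k(2) by blast
qed

text \<open>For \<open>k\<close> below \<open>l\<close> the exponential moment is dominated by a
  geometric series of ratio \<open>exp (k - l)\<close>.\<close>

lemma decay_parameter_lower:
  assumes l: "0 < l" and x: "1 \<le> x" and decay: "\<And>t. 0 \<le> t \<Longrightarrow> 1 - p t x 0 \<le> C * exp (- l * t)"
  shows "ereal l \<le> decay_parameter P X"
proof (rule dense_le)
  fix y assume y: "y < ereal l"
  show "y \<le> decay_parameter P X"
  proof (cases "y \<le> 0")
    case True
    then show ?thesis using decay_parameter_nonneg by simp
  next
    case False
    then obtain k where k: "y = ereal k" "0 < k" "k < l" using y by (cases y) auto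
    have C: "0 \<le> C" using decay[of 0] p_le_1[of 0 x 0] by simp
    \<comment> \<open>The term \<open>g n\<close> dominates the exponential when the hitting time
      lies in \<open>(n, n + 1]\<close>; the value 0 is covered by the extra summand 1 in
      \<open>bound\<close>.\<close>
    define g where "g n \<omega> = ennreal (exp (k * (real n + 1))) * indicator {\<omega> \<in> space (P x). ereal (real n) < hitting_time X {0} \<omega>} \<omega>" for n \<omega>
    have g_meas: "g n \<in> borel_measurable (P x)" for n unfolding g_def by measurable
    have bound: "exp_ereal (ereal k * hitting_time X {0} \<omega>) \<le> 1 + (\<Sum>n. g n \<omega>)"
      if \<omega>: "\<omega> \<in> space (P x)" and fin: "hitting_time X {0} \<omega> < \<infinity>" for \<omega>
    proof -
      obtain r where r: "hitting_time X {0} \<omega> = ereal r" "0 \<le> r"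
        using fin hitting_time_nonneg[of "{0}" \<omega>] by (cases "hitting_time X {0} \<omega>") auto
      show ?thesis
      proof (cases "r = 0")
        case True
        then show ?thesis using r by (simp add: exp_ereal_def)
      next
        case False
        obtain i :: nat where i: "r \<le> i * 1" "i * 1 < r + 1" using grid_point[of 1 r] r by auto
        have "0 < i" using i(1) r False by (cases i) auto
        then obtain n where n: "i = Suc n" using gr0_implies_Suc by blast
        have "exp_ereal (ereal k * hitting_time X {0} \<omega>) \<le> g n \<omega>"
          using r i n \<omega> k unfolding g_def exp_ereal_def
          by (auto intro!: ennreal_leI mult_left_mono simp: indicator_def)
        also have "\<dots> \<le> (\<Sum>n. g n \<omega>)"
          using sum_le_suminf[of "\<lambda>n. g n \<omega>" "{n}"] by (simp add: summableI)
        also have "\<dots> \<le> 1 + (\<Sum>n. g n \<omega>)" by simp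
        finally show ?thesis .
      qed
    qed
    have "(\<integral>\<^sup>+ \<omega>. exp_ereal (ereal k * hitting_time X {0} \<omega>) \<partial>P x) \<le> (\<integral>\<^sup>+ \<omega>. 1 + (\<Sum>n. g n \<omega>) \<partial>P x)"
    proof (rule nn_integral_mono_AE)
      show "AE \<omega> in P x. exp_ereal (ereal k * hitting_time X {0} \<omega>) \<le> 1 + (\<Sum>n. g n \<omega>)"
        using AE_finite_hitting_time[of x] AE_space by eventually_elim (rule bound)
    qed
    also have "\<dots> = 1 + (\<Sum>n. \<integral>\<^sup>+ \<omega>. g n \<omega> \<partial>P x)"
      using g_meas by (subst nn_integral_add) (auto simp: nn_integral_suminf P.emeasure_space_1)
    also have "(\<Sum>n. \<integral>\<^sup>+ \<omega>. g n \<omega> \<partial>P x) \<le> (\<Sum>n. ennreal (exp k * C * exp (k - l) ^ n))"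
    proof (intro suminf_le summableI)
      fix n
      define S where "S = {\<omega> \<in> space (P x). ereal (real n) < hitting_time X {0} \<omega>}"
      have S: "S \<in> sets (P x)" unfolding S_def by measurable
      have "(\<integral>\<^sup>+ \<omega>. g n \<omega> \<partial>P x) = ennreal (exp (k * (real n + 1))) * emeasure (P x) S"
        unfolding g_def S_def[symmetric] using S by (simp add: nn_integral_cmult_indicator)
      also have "\<dots> = ennreal (exp (k * (real n + 1)) * (1 - p (real n) x 0))"
        unfolding P.emeasure_eq_measure using measure_survival[of "real n" x] unfolding S_def by (simp add: ennreal_mult p_le_1)
      also have "\<dots> \<le> ennreal (exp (k * (real n + 1)) * (C * exp (- l * real n)))"
        using decay[of "real n"] by (intro ennreal_leI mult_left_mono) auto
      also have "exp (k * (real n + 1)) * (C * exp (- l * real n)) = exp k * C * exp (k - l) ^ n"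
      proof -
        have "exp (k * (real n + 1)) * exp (- l * real n) = exp k * exp (real n * (k - l))"
          by (simp add: mult_exp_exp algebra_simps)
        then show ?thesis by (simp add: exp_of_nat_mult mult_ac)
      qed
      finally show "(\<integral>\<^sup>+ \<omega>. g n \<omega> \<partial>P x) \<le> ennreal (exp k * C * exp (k - l) ^ n)" .
    qed
    also have "(\<Sum>n. ennreal (exp k * C * exp (k - l) ^ n)) < \<infinity>"
    proof -
      have "summable (\<lambda>n. exp k * C * exp (k - l) ^ n)"
        using k by (intro summable_mult summable_geometric) simp
      then have "(\<Sum>n. ennreal (exp k * C * exp (k - l) ^ n)) \<noteq> top"
        using C by (intro ennreal_suminf_neq_top) auto
      then show ?thesis by (simp add: less_top)
    qed
    finally have "(\<integral>\<^sup>+ \<omega>. exp_ereal (ereal k * hitting_time X {0} \<omega>) \<partial>P x) < \<infinity>"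
      by (simp add: ennreal_add_eq_top less_top)
    then show ?thesis unfolding decay_parameter_def k(1) using k(2) x
      by (intro Sup_upper) (auto intro!: exI[of _ k] exI[of _ x])
  qed
qed

end

section \<open>Downward crossings and excursions\<close>

lemma discrete_crossing:
  fixes f :: "nat \<Rightarrow> nat"
  assumes "i0 \<le> i1" "c < f i0" "f i1 < c" "\<And>i. i0 \<le> i \<Longrightarrow> i \<le> i1 \<Longrightarrow> f i \<noteq> c"
  shows "\<exists>i. i0 \<le> i \<and> i < i1 \<and> c < f i \<and> f (Suc i) < c"
proof (rule ccontr)
  assume no: "\<not> ?thesis"
  have "c < f i" if "i0 \<le> i" "i \<le> i1" for i
    using that
  proof (induction i rule: dec_induct)
    case (step i)
    then have "c < f i" by simp
    then have "\<not> f (Suc i) < c" using no step by auto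
    then show ?case using assms(4)[of "Suc i"] step by simp
  qed (use assms in simp)
  from this[of i1] show False using assms by simp
qed

context absorbed_chain
begin

text \<open>A jump across \<open>c\<close> between neighbouring grid times up to \<open>T\<close>.
  The level \<open>M\<close> keeps the union over starting states finite.\<close>

definition skips :: "nat \<Rightarrow> nat \<Rightarrow> nat \<Rightarrow> nat \<Rightarrow> 'w set" where
  "skips T M c m = {\<omega> \<in> \<Omega>. \<exists>i<T * 2 ^ m. \<exists>a\<in>{c<..<M}. \<exists>b<c.
     X (real i * (1 / 2 ^ m)) \<omega> = Some a \<and> X (real i * (1 / 2 ^ m) + 1 / 2 ^ m) \<omega> = Some b}"

text \<open>Union bound over \<open>T * 2 ^ m\<close> grid steps; the number of steps per unit time
  turns one-step probabilities into difference quotients.\<close>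

lemma skips_sets: "skips T M c m \<in> sets (P x)"
  and skips_measure: "measure (P x) (skips T M c m) \<le> real T * (\<Sum>a\<in>{c<..<M}. \<Sum>b<c. p (1 / 2 ^ m) a b / (1 / 2 ^ m))"
proof -
  define h :: real where "h = 1 / 2 ^ m"
  have h: "0 < h" unfolding h_def by simp
  define I where "I = {..<T * 2 ^ m} \<times> ({c<..<M} \<times> {..<c})"
  define B where "B = (\<lambda>(i, a, b). {\<omega> \<in> \<Omega>. X (real i * h) \<omega> = Some a \<and> X (real i * h + h) \<omega> = Some b})"
  have eq: "skips T M c m = (\<Union>q\<in>I. B q)"
    unfolding skips_def I_def B_def h_def by fastforce
  have B_sets: "B q \<in> sets (P x)" for q
  proof -
    obtain i a b where q: "q = (i, a, b)" by (cases q)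
    have "B q = {\<omega> \<in> \<Omega>. X (real i * h) \<omega> = Some a} \<inter> {\<omega> \<in> \<Omega>. X (real i * h + h) \<omega> = Some b}"
      unfolding q B_def by auto
    then show ?thesis using h by (auto intro!: sets.Int sets_X_eq)
  qed
  have fin: "finite I" unfolding I_def by simp
  show "skips T M c m \<in> sets (P x)" unfolding eq using B_sets fin by auto
  have "measure (P x) (skips T M c m) \<le> (\<Sum>q\<in>I. measure (P x) (B q))"
    unfolding eq using fin B_sets by (intro P.finite_measure_subadditive_finite) auto
  also have "\<dots> \<le> (\<Sum>(i, a, b)\<in>I. p h a b)"
  proof (rule sum_mono)
    fix q assume "q \<in> I"
    obtain i a b where q: "q = (i, a, b)" by (cases q)
    have "measure (P x) (B q) = p (real i * h) x a * p h a b"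
      unfolding q B_def using markov_p_0[of "real i * h" h x a b] h by simp
    also have "\<dots> \<le> p h a b" using p_nonneg p_le_1 by (intro mult_left_le_one_le) auto
    finally show "measure (P x) (B q) \<le> (case q of (i, a, b) \<Rightarrow> p h a b)" unfolding q by simp
  qed
  also have "\<dots> = (\<Sum>i<T * 2 ^ m. \<Sum>a\<in>{c<..<M}. \<Sum>b<c. p h a b)"
    unfolding I_def by (simp only: sum.cartesian_product[symmetric])
  also have "\<dots> = real T * (\<Sum>a\<in>{c<..<M}. \<Sum>b<c. p h a b / h)"
    unfolding h_def by (simp add: sum_distrib_left sum_distrib_right mult_ac)
  finally show "measure (P x) (skips T M c m) \<le> real T * (\<Sum>a\<in>{c<..<M}. \<Sum>b<c. p (1 / 2 ^ m) a b / (1 / 2 ^ m))"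
    unfolding h_def .
qed

text \<open>Since \<open>a\<close> and \<open>b\<close> lie on different sides of \<open>c\<close>,
  \<open>Q a b = 0\<close> and the union bound tends to 0. The event that all grids from
  \<open>k\<close> on skip is therefore null.\<close>

lemma AE_not_skips: "AE \<omega> in P x. \<forall>T M c k. \<exists>m\<ge>k. \<omega> \<notin> skips T M c m"
proof -
  have "AE \<omega> in P x. \<exists>m\<ge>k. \<omega> \<notin> skips T M c m" for T M c k
  proof -
    define N where "N = (\<Inter>m\<in>{k..}. skips T M c m)"
    have N: "N \<in> sets (P x)" unfolding N_def using skips_sets by (intro sets.countable_INT') auto
    have lim: "(\<lambda>m. real T * (\<Sum>a\<in>{c<..<M}. \<Sum>b<c. p (1 / 2 ^ m) a b / (1 / 2 ^ m))) \<longlonglongrightarrow>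
        real T * (\<Sum>a\<in>{c<..<M}. \<Sum>b<c. 0)"
    proof (intro tendsto_mult tendsto_sum tendsto_const)
      fix a b assume ab: "a \<in> {c<..<M}" "b \<in> {..<c}"
      then have "Q a b = 0" by (intro skip_free) auto
      then show "(\<lambda>m. p (1 / 2 ^ m) a b / (1 / 2 ^ m)) \<longlonglongrightarrow> 0"
        using filterlim_compose[OF p_derivative[of a b] filterlim_halving[of 1]] ab by auto
    qed
    have "measure (P x) N \<le> real T * (\<Sum>a\<in>{c<..<M}. \<Sum>b<c. 0)"
    proof (rule LIMSEQ_le_const[OF lim], intro exI[of _ k] allI impI)
      fix m assume "k \<le> m"
      then have "measure (P x) N \<le> measure (P x) (skips T M c m)"
        unfolding N_def by (intro P.finite_measure_mono skips_sets) auto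
      also note skips_measure
      finally show "measure (P x) N \<le> real T * (\<Sum>a\<in>{c<..<M}. \<Sum>b<c. p (1 / 2 ^ m) a b / (1 / 2 ^ m))" .
    qed
    then have "measure (P x) N = 0" using measure_nonneg[of "P x" N] by simp
    then have "N \<in> null_sets (P x)" using N by (intro null_setsI) (auto simp: P.emeasure_eq_measure)
    then show ?thesis by (rule AE_I') (auto simp: N_def)
  qed
  then show ?thesis by (simp add: AE_all_countable)
qed

definition crosses_down :: "'w \<Rightarrow> bool" where
  "crosses_down \<omega> \<longleftrightarrow> (\<forall>c s t a b. 0 \<le> s \<longrightarrow> s < t \<longrightarrow> X s \<omega> = Some a \<longrightarrow> c < a \<longrightarrow>
     X t \<omega> = Some b \<longrightarrow> b < c \<longrightarrow> (\<exists>r\<in>{s..t}. X r \<omega> = Some c))"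

text \<open>A path that gets from above \<open>c\<close> to below \<open>c\<close> without visiting
  it would be caught skipping \<open>c\<close> on every sufficiently fine grid.\<close>

lemma AE_crosses_down: "AE \<omega> in P x. crosses_down \<omega>"
  using AE_not_skips[of x]
proof (rule AE_mp[OF _ AE_I2], intro impI)
  fix \<omega> assume \<omega>: "\<omega> \<in> space (P x)" and ns: "\<forall>T M c k. \<exists>m\<ge>k. \<omega> \<notin> skips T M c m"
  have \<omega>': "\<omega> \<in> \<Omega>" using \<omega> by simp
  show "crosses_down \<omega>"
    unfolding crosses_down_def
  proof (intro allI impI)
    fix c s t a b
    assume st: "0 \<le> s" "s < t" and a: "X s \<omega> = Some a" "c < a" and b: "X t \<omega> = Some b" "b < c"
    show "\<exists>r\<in>{s..t}. X r \<omega> = Some c"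
    proof (rule ccontr)
      assume no: "\<not> (\<exists>r\<in>{s..t}. X r \<omega> = Some c)"
      obtain e1 where e1: "0 < e1" "\<And>r. s \<le> r \<Longrightarrow> r < s + e1 \<Longrightarrow> X r \<omega> = Some a"
        using right_constant[OF \<omega>' st(1) a(1)] by blast
      obtain e2 where e2: "0 < e2" "\<And>r. t \<le> r \<Longrightarrow> r < t + e2 \<Longrightarrow> X r \<omega> = Some b"
        using right_constant[OF \<omega>' _ b(1)] st by auto
      \<comment> \<open>The first grid point after \<open>t\<close> may lie beyond \<open>t\<close>;
        up to \<open>t'\<close> the path still sits at \<open>b\<close>, which differs from
        \<open>c\<close>.\<close>
      define t' where "t' = t + e2 / 2"
      have t': "X t' \<omega> = Some b" "0 \<le> t'" using e2(2)[of t'] e2(1) st unfolding t'_def by auto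
      obtain M where M: "\<And>r. 0 \<le> r \<Longrightarrow> r \<le> t' \<Longrightarrow> X r \<omega> \<in> Some ` {..<M}"
        using bounded_before[OF \<omega>' t'(2)] t'(1) by blast
      \<comment> \<open>These bounds keep the grid points next to \<open>s\<close> and
        \<open>t\<close> in the intervals of constancy, put them in the right order, and keep them
        below \<open>T\<close>.\<close>
      define e where "e = min (min e1 (e2 / 2)) (min (t - s) 1)"
      have e: "0 < e" "e \<le> e1" "e \<le> e2 / 2" "e \<le> t - s" "e \<le> 1" unfolding e_def using e1(1) e2(1) st by (auto simp: min_def)
      have "\<forall>\<^sub>F m in sequentially. 1 / 2 ^ m < e"
        using filterlim_halving[of 1] e(1) by (intro order_tendstoD(2)[of _ 0]) (auto simp: filterlim_at)
      then obtain k where k: "\<And>m. k \<le> m \<Longrightarrow> 1 / 2 ^ m < e" by (auto simp: eventually_at_top_linorder)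
      obtain T :: nat where T: "t + 1 \<le> real T" using real_arch_simple by blast
      obtain m where m: "k \<le> m" "\<omega> \<notin> skips T M c m" using ns by blast
      define h :: real where "h = 1 / 2 ^ m"
      have h: "0 < h" "h < e" unfolding h_def using k[OF m(1)] by auto
      obtain i0 :: nat where i0: "s \<le> i0 * h" "i0 * h < s + h" using grid_point[OF h(1) st(1)] by auto
      obtain i1 :: nat where i1: "t \<le> i1 * h" "i1 * h < t + h" using grid_point[OF h(1), of t] st by auto
      have X0: "X (i0 * h) \<omega> = Some a" using i0 h e by (intro e1(2)) auto
      have X1: "X (i1 * h) \<omega> = Some b" using i1 h e e2(1) by (intro e2(2)) auto
      have "i0 * h < i1 * h" using i0 i1 h e by linarith
      then have i01: "i0 < i1" using h(1) by (simp add: mult_less_cancel_right)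
      define f where "f i = the (X (real i * h) \<omega>)" for i :: nat
      have range: "s \<le> i * h \<and> i * h \<le> t'" if "i0 \<le> i" "i \<le> i1" for i :: nat
      proof -
        have "i0 * h \<le> i * h" "i * h \<le> i1 * h" using that h(1) by (auto intro!: mult_right_mono)
        then show ?thesis using i0 i1 h e unfolding t'_def by linarith
      qed
      have Xf: "X (i * h) \<omega> = Some (f i)" "f i < M" if "i0 \<le> i" "i \<le> i1" for i :: nat
        using M[of "i * h"] range[OF that] st(1) unfolding f_def by auto
      have "f i \<noteq> c" if "i0 \<le> i" "i \<le> i1" for i
      proof (cases "i * h \<le> t")
        case True
        then show ?thesis using Xf[OF that] range[OF that] no by auto
      next
        case False
        then have "X (i * h) \<omega> = Some b" using range[OF that] e2(1) unfolding t'_def by (intro e2(2)) auto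
        then show ?thesis using b unfolding f_def by simp
      qed
      then obtain i where i: "i0 \<le> i" "i < i1" "c < f i" "f (Suc i) < c"
        using discrete_crossing[of i0 i1 c f] i01 X0 X1 a b unfolding f_def by auto
      have "i * h < T" 
      proof -
        have "i * h < i1 * h" using i h(1) by simp
        then show ?thesis using i1 h e T by linarith
      qed
      then have "real i < real T * 2 ^ m" unfolding h_def by (simp add: field_simps)
      then have "i < T * 2 ^ m" by (metis of_nat_less_iff of_nat_mult of_nat_numeral of_nat_power)
      moreover have "real i * h + h = real (Suc i) * h" by (simp add: algebra_simps)
      then have "X (real i * h) \<omega> = Some (f i)" "X (real i * h + h) \<omega> = Some (f (Suc i))" "f i < M"
        using Xf[of i] Xf[of "Suc i"] i by auto
      ultimately have "\<omega> \<in> skips T M c m"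
        unfolding skips_def using \<omega>' i unfolding h_def by auto
      then show False using m by simp
    qed
  qed
qed

section \<open>Excursions observed on a grid\<close>

lemma hitting_time_ge:
  assumes "\<And>t. 0 < t \<Longrightarrow> t < s \<Longrightarrow> X t \<omega> \<notin> Some ` A"
  shows "ereal s \<le> hitting_time X A \<omega>"
  unfolding hitting_time_def
proof (rule Inf_greatest)
  fix y assume "y \<in> {ereal t |t. 0 < t \<and> X t \<omega> \<in> Some ` A}"
  then obtain t where "y = ereal t" "0 < t" "X t \<omega> \<in> Some ` A" by blast
  then show "ereal s \<le> y" using assms[of t] by (cases "t < s") auto
qed

text \<open>The pattern of a path from \<open>z\<close> that reaches \<open>x\<close> before
  returning to \<open>z\<close>. A path above \<open>z\<close> would have to pass through
  \<open>z\<close> on its way down, so all intermediate states lie strictly between.\<close>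

definition exc_sets :: "nat \<Rightarrow> nat \<Rightarrow> nat \<Rightarrow> nat \<Rightarrow> nat set list" where
  "exc_sets x z j k = replicate j {z} @ replicate k {x<..<z} @ [{x}]"

definition grid_exc :: "nat \<Rightarrow> nat \<Rightarrow> real \<Rightarrow> 'w \<Rightarrow> bool" where
  "grid_exc x z h \<omega> \<longleftrightarrow> (\<exists>j k. run h (exc_sets x z j k) 0 \<omega>)"

lemma run_exc_sets:
  "run h (exc_sets x z j k) 0 \<omega> \<longleftrightarrow>
    (\<forall>i\<in>{1..j}. X (real i * h) \<omega> = Some z) \<and> (\<forall>i\<in>{j<..j + k}. X (real i * h) \<omega> \<in> Some ` {x<..<z}) \<and>
    X (real (Suc (j + k)) * h) \<omega> = Some x"
proof -
  have nth: "exc_sets x z j k ! i = (if i < j then {z} else if i < j + k then {x<..<z} else {x})"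
    if "i < Suc (j + k)" for i
    unfolding exc_sets_def using that by (auto simp: nth_append)
  have len: "length (exc_sets x z j k) = Suc (j + k)" unfolding exc_sets_def by simp
  have "run h (exc_sets x z j k) 0 \<omega> \<longleftrightarrow> (\<forall>i<Suc (j + k). X (real (Suc i) * h) \<omega> \<in>
      Some ` (if i < j then {z} else if i < j + k then {x<..<z} else {x}))"
    unfolding run_iff len using nth by (simp add: add.commute)
  also have "\<dots> \<longleftrightarrow> (\<forall>i\<in>{1..Suc (j + k)}. X (real i * h) \<omega> \<in>
      Some ` (if i \<le> j then {z} else if i \<le> j + k then {x<..<z} else {x}))"
  proof (intro iffI allI ballI impI)
    fix i assume "\<forall>i<Suc (j + k). X (real (Suc i) * h) \<omega> \<in>
      Some ` (if i < j then {z} else if i < j + k then {x<..<z} else {x})" "i \<in> {1..Suc (j + k)}"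
    then show "X (real i * h) \<omega> \<in> Some ` (if i \<le> j then {z} else if i \<le> j + k then {x<..<z} else {x})"
      by (cases i) (auto simp: Suc_le_eq simp del: of_nat_Suc)
  next
    fix i assume "\<forall>i\<in>{1..Suc (j + k)}. X (real i * h) \<omega> \<in>
      Some ` (if i \<le> j then {z} else if i \<le> j + k then {x<..<z} else {x})" "i < Suc (j + k)"
    then show "X (real (Suc i) * h) \<omega> \<in> Some ` (if i < j then {z} else if i < j + k then {x<..<z} else {x})"
      by (auto simp: Suc_le_eq simp del: of_nat_Suc dest!: bspec[of _ _ "Suc i"])
  qed
  also have "\<dots> \<longleftrightarrow> (\<forall>i\<in>{1..j}. X (real i * h) \<omega> = Some z) \<and> (\<forall>i\<in>{j<..j + k}. X (real i * h) \<omega> \<in> Some ` {x<..<z}) \<and>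
    X (real (Suc (j + k)) * h) \<omega> = Some x"
  proof -
    have "{1..Suc (j + k)} = {1..j} \<union> {j<..j + k} \<union> {Suc (j + k)}" by auto
    then show ?thesis by (simp only: ball_Un) (auto simp del: of_nat_Suc)
  qed
  finally show ?thesis .
qed

text \<open>Let \<open>s\<close> be the exit time from \<open>z\<close> and \<open>q\<close> the
  first time after \<open>s\<close> at \<open>x\<close> or \<open>z\<close>; the state at
  \<open>q\<close> decides. Holding times at \<open>s\<close> and \<open>q\<close> are positive, so
  a fine grid sees the same decision.\<close>

lemma excursion_eventually_grid:
  assumes \<omega>: "\<omega> \<in> \<Omega>" and start: "X 0 \<omega> = Some z" and xz: "x < z" and T: "0 \<le> T" "X T \<omega> = Some 0"
    and cross: "crosses_down \<omega>"
  shows "\<exists>h0>0. \<forall>h. 0 < h \<longrightarrow> h < h0 \<longrightarrow>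
    (grid_exc x z h \<omega> \<longleftrightarrow> hitting_time X {x} \<omega> < return_time X z \<omega>)"
proof -
  obtain s where s: "0 \<le> s" "s \<le> T" "X s \<omega> \<in> Some ` (- {z})" "\<And>r. 0 \<le> r \<Longrightarrow> r < s \<Longrightarrow> X r \<omega> \<notin> Some ` (- {z})"
    using first_hit[OF \<omega>, of 0 T "- {z}"] T xz by auto
  have s0: "0 < s" using s(1,3) start by (cases "s = 0") auto
  have before_s: "X r \<omega> = Some z" if "0 \<le> r" "r < s" for r
    using s(4)[OF that] alive_before[OF \<omega>, of r T] that s T by auto
  \<comment> \<open>The path ends in 0, so it meets \<open>x\<close>, either as its end point or by
    crossing downwards.\<close>
  have "\<exists>T'\<ge>s. T' \<le> T \<and> X T' \<omega> \<in> Some ` {x, z}"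
  proof (cases "x = 0")
    case True
    then show ?thesis using T s by auto
  next
    case False
    have "0 \<noteq> T" using T start xz by auto
    then have "\<exists>r\<in>{0..T}. X r \<omega> = Some x"
      using cross start xz T False unfolding crosses_down_def
      by (metis less_eq_real_def neq0_conv order_refl)
    then obtain r where r: "0 \<le> r" "r \<le> T" "X r \<omega> = Some x" by auto
    then have "s \<le> r" using before_s[of r] xz by force
    then show ?thesis using r by auto
  qed
  then obtain T' where T': "s \<le> T'" "T' \<le> T" "X T' \<omega> \<in> Some ` {x, z}" by auto
  obtain q where q: "s \<le> q" "q \<le> T'" "X q \<omega> \<in> Some ` {x, z}" "\<And>r. s \<le> r \<Longrightarrow> r < q \<Longrightarrow> X r \<omega> \<notin> Some ` {x, z}"
    using first_hit[OF \<omega> s(1) T'(1,3)] by blast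
  have not_x: "X r \<omega> \<noteq> Some x" if "0 \<le> r" "r < q" for r
    using before_s[of r] q(4)[of r] that xz by (cases "r < s") auto
  have q0: "0 < q" using s0 q(1) by simp
  have hit_s: "hitting_time X (- {z}) \<omega> = ereal s"
  proof (rule antisym)
    show "hitting_time X (- {z}) \<omega> \<le> ereal s" using s0 s(3) by (rule hitting_time_le)
    show "ereal s \<le> hitting_time X (- {z}) \<omega>"
      by (rule hitting_time_ge) (use s(4) in simp)
  qed
  have hit_x_ge: "ereal q \<le> hitting_time X {x} \<omega>"
    by (rule hitting_time_ge) (use not_x in auto)
  obtain w where w: "X q \<omega> = Some w" "w = x \<or> w = z" using q(3) by auto
  obtain e where e: "0 < e" "\<And>r. q \<le> r \<Longrightarrow> r < q + e \<Longrightarrow> X r \<omega> = Some w"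
    using right_constant[OF \<omega> _ w(1)] q0 by auto
  show ?thesis
  proof (cases "w = x")
    case True
    have "hitting_time X {x} \<omega> \<le> ereal q" using q0 w True by (intro hitting_time_le) auto
    moreover have "ereal (q + e) \<le> return_time X z \<omega>"
      unfolding return_time_def hit_s
    proof (rule Inf_greatest, clarify)
      fix t assume t: "ereal s < ereal t" "X t \<omega> = Some z"
      then have "q \<le> t" using q(4)[of t] by force
      then show "ereal (q + e) \<le> ereal t" using e(2)[of t] t True xz by force
    qed
    ultimately have E: "hitting_time X {x} \<omega> < return_time X z \<omega>"
      using e(1) by (metis ereal_less(2) less_add_same_cancel1 less_ereal.simps(1) order.strict_trans1 order.strict_trans2)
    \<comment> \<open>A visit above \<open>z\<close> would force a passage through \<open>z\<close>
      before \<open>q\<close>, and one below \<open>x\<close> an earlier visit to \<open>x\<close>;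
      the choice of \<open>q\<close> excludes both.\<close>
    have mid: "X r \<omega> \<in> Some ` {x<..<z}" if r: "s \<le> r" "r < q" for r
    proof -
      obtain v where v: "X r \<omega> = Some v" using alive_before[OF \<omega>, of r q] r s w by auto
      have "v \<noteq> x" "v \<noteq> z" using q(4)[OF r] v by auto
      moreover have "\<not> z < v"
      proof
        assume "z < v"
        have "\<exists>r'\<in>{r..q}. X r' \<omega> = Some z"
          by (rule cross[unfolded crosses_down_def, rule_format, of r q v z w])
            (use r s(1) v w(1) True xz \<open>z < v\<close> in auto)
        then obtain r' where "r' \<in> {r..q}" "X r' \<omega> = Some z" by blast
        then show False using q(4)[of r'] r w True xz by (cases "r' = q") auto
      qed
      moreover have "\<not> v < x"
      proof
        assume "v < x"
        have "\<exists>r'\<in>{0..r}. X r' \<omega> = Some x"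
          by (rule cross[unfolded crosses_down_def, rule_format, of 0 r z x v])
            (use r s0 v start xz \<open>v < x\<close> in auto)
        then obtain r' where "r' \<in> {0..r}" "X r' \<omega> = Some x" by blast
        then show False using not_x[of r'] r by auto
      qed
      ultimately show ?thesis using v by auto
    qed
    have "grid_exc x z h \<omega>" if h: "0 < h" "h < e" for h
    proof -
      obtain n :: nat where n: "q \<le> n * h" "n * h < q + h" "\<And>i. i < n \<Longrightarrow> i * h < q"
        using grid_point[OF h(1), of q] q0 by auto
      obtain m :: nat where m: "s \<le> m * h" "m * h < s + h" "\<And>i. i < m \<Longrightarrow> i * h < s"
        using grid_point[OF h(1), of s] s0 by auto
      have m0: "0 < m" using m(1) s0 by (cases m) auto
      have mn: "m \<le> n" using m(3)[of n] n(1) q(1) by (cases "n < m") auto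
      have "run h (exc_sets x z (m - 1) (n - m)) 0 \<omega>"
        unfolding run_exc_sets
      proof (intro conjI ballI)
        fix i assume "i \<in> {1..m - 1}"
        then show "X (real i * h) \<omega> = Some z" using m(3)[of i] h m0 by (intro before_s) auto
      next
        fix i assume i: "i \<in> {m - 1<..m - 1 + (n - m)}"
        then have "real m * h \<le> real i * h" using h by (intro mult_right_mono) auto
        then show "X (real i * h) \<omega> \<in> Some ` {x<..<z}" using m(1) n(3)[of i] i mn m0 by (intro mid) auto
      next
        have "Suc (m - 1 + (n - m)) = n" using m0 mn by simp
        then show "X (real (Suc (m - 1 + (n - m))) * h) \<omega> = Some x"
          using e(2)[of "n * h"] n h True by simp
      qed
      then show ?thesis unfolding grid_exc_def by blast
    qed
    then show ?thesis using E e(1) by blast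
  next
    case False
    then have wz: "w = z" using w by simp
    have sq: "s < q" using q(1) s(3) w wz by (cases "s = q") auto
    have "return_time X z \<omega> \<le> ereal q"
      unfolding return_time_def hit_s using sq w wz by (intro Inf_lower) auto
    then have E: "\<not> hitting_time X {x} \<omega> < return_time X z \<omega>"
      using hit_x_ge by (auto simp: not_less)
    obtain v where v: "X s \<omega> = Some v" "v \<noteq> z" using s(3) by auto
    obtain e' where e': "0 < e'" "\<And>r. s \<le> r \<Longrightarrow> r < s + e' \<Longrightarrow> X r \<omega> = Some v"
      using right_constant[OF \<omega> s(1) v(1)] by blast
    \<comment> \<open>The grid sees \<open>v\<close> after \<open>s\<close>, which ends the initial
      stay at \<open>z\<close>, and then \<open>z\<close> again after \<open>q\<close> before it has
      seen \<open>x\<close>; no pattern allows this.\<close>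
    have "\<not> grid_exc x z h \<omega>" if h: "0 < h" "h < min e e'" for h
    proof
      assume "grid_exc x z h \<omega>"
      then obtain j k where "run h (exc_sets x z j k) 0 \<omega>" unfolding grid_exc_def by blast
      then have jk: "\<And>i. 1 \<le> i \<Longrightarrow> i \<le> j \<Longrightarrow> X (real i * h) \<omega> = Some z"
        "\<And>i. j < i \<Longrightarrow> i \<le> j + k \<Longrightarrow> X (real i * h) \<omega> \<in> Some ` {x<..<z}"
        "X (real (Suc (j + k)) * h) \<omega> = Some x"
        unfolding run_exc_sets by auto
      obtain i1 :: nat where i1: "s \<le> i1 * h" "i1 * h < s + h" using grid_point[OF h(1) s(1)] by auto
      obtain i2 :: nat where i2: "q \<le> i2 * h" "i2 * h < q + h" "\<And>i. i < i2 \<Longrightarrow> i * h < q"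
        using grid_point[OF h(1), of q] q0 by auto
      have X1: "X (i1 * h) \<omega> = Some v" using i1 h by (intro e'(2)) auto
      have X2: "X (i2 * h) \<omega> = Some z" using e(2)[of "i2 * h"] i2 h wz by simp
      have "1 \<le> i1" using i1(1) s0 by (cases i1) auto
      then have ji1: "j < i1" using jk(1)[of i1] X1 v by (cases "i1 \<le> j") auto
      have "i1 * h < q"
      proof (rule ccontr)
        assume "\<not> i1 * h < q"
        then have "X q \<omega> = Some v" using i1 h q(1) by (intro e'(2)) auto
        then show False using w wz v by simp
      qed
      then have "i1 * h < i2 * h" using i2(1) by simp
      then have "i1 < i2" using h(1) by (simp add: mult_less_cancel_right)
      have "\<not> Suc (j + k) < i2" using i2(3)[of "Suc (j + k)"] not_x[of "real (Suc (j + k)) * h"] jk(3) h by auto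
      moreover have "i2 \<noteq> Suc (j + k)" using jk(3) X2 xz by auto
      ultimately have "i2 \<le> j + k" by simp
      then show False using jk(2)[of i2] X2 ji1 \<open>i1 < i2\<close> by auto
    qed
    then show ?thesis using E e(1) e'(1) by (intro exI[of _ "min e e'"]) auto
  qed
qed

end

section \<open>The scale function as the inverse of the generator\<close>

context absorbed_chain
begin

text \<open>The grid chain reaches \<open>x\<close> through states strictly between \<open>x\<close>
  and \<open>z\<close>. The start \<open>y\<close> is unrestricted, so \<open>y = z\<close>
  describes an excursion that leaves \<open>z\<close> in its first step.\<close>

definition exc_prob :: "real \<Rightarrow> nat \<Rightarrow> nat \<Rightarrow> nat \<Rightarrow> real" where
  "exc_prob h x z y = (\<Sum>k. cyl h (exc_sets x z 0 k) y)"

lemma exc_sets_finite: "S \<in> set (exc_sets x z j k) \<Longrightarrow> finite S"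
  unfolding exc_sets_def by auto

lemma cyl_exc_sums:
  assumes h: "0 \<le> h" and xz: "x < z"
  shows "(\<lambda>k. cyl h (exc_sets x z j k) y) sums measure (P y) {\<omega> \<in> \<Omega>. X 0 \<omega> = Some y \<and> (\<exists>k. run h (exc_sets x z j k) 0 \<omega>)}"
proof -
  define B where "B k = {\<omega> \<in> \<Omega>. X 0 \<omega> = Some y \<and> run h (exc_sets x z j k) 0 \<omega>}" for k
  have "B k = {\<omega> \<in> \<Omega>. X 0 \<omega> = Some y} \<inter> {\<omega> \<in> \<Omega>. run h (exc_sets x z j k) 0 \<omega>}" for k
    unfolding B_def by auto
  then have sets: "B k \<in> sets (P y)" for k
    using h by (auto intro!: sets.Int sets_X_eq sets_run)
  have neq: False if k: "k < k'" and "\<omega> \<in> B k" "\<omega> \<in> B k'" for k k' \<omega>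
  proof -
    have "X (real (Suc (j + k)) * h) \<omega> = Some x"
      using that unfolding B_def run_exc_sets by blast
    moreover have "X (real (Suc (j + k)) * h) \<omega> \<in> Some ` {x<..<z}"
    proof -
      have "Suc (j + k) \<in> {j<..j + k'}" using k by auto
      then show ?thesis using that unfolding B_def run_exc_sets by blast
    qed
    ultimately show False by auto
  qed
  have "disjoint_family B"
    unfolding disjoint_family_on_def using neq by (metis disjoint_iff linorder_neqE_nat)
  then have "(\<lambda>k. measure (P y) (B k)) sums measure (P y) (\<Union>k. B k)"
    using sets by (intro P.finite_measure_UNION) auto
  moreover have "(\<Union>k. B k) = {\<omega> \<in> \<Omega>. X 0 \<omega> = Some y \<and> (\<exists>k. run h (exc_sets x z j k) 0 \<omega>)}"
    unfolding B_def by auto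
  moreover have "measure (P y) (B k) = cyl h (exc_sets x z j k) y" for k
    unfolding B_def using h exc_sets_finite by (rule cylinder_0)
  ultimately show ?thesis by simp
qed

lemma exc_prob_bounds:
  assumes "0 \<le> h" "x < z" shows "0 \<le> exc_prob h x z y" "exc_prob h x z y \<le> 1"
  using cyl_exc_sums[OF assms, of 0 y] unfolding exc_prob_def by (auto simp: sums_iff)

lemma exc_prob_step:
  assumes h: "0 \<le> h" and xz: "x < z"
  shows "exc_prob h x z y = p h y x + (\<Sum>v\<in>{x<..<z}. p h y v * exc_prob h x z v)"
proof -
  have s: "summable (\<lambda>k. cyl h (exc_sets x z 0 k) y)" for y
    using cyl_exc_sums[OF h xz, of 0 y] by (rule sums_summable)
  have Suc: "cyl h (exc_sets x z 0 (Suc k)) y = (\<Sum>v\<in>{x<..<z}. p h y v * cyl h (exc_sets x z 0 k) v)" for k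
    unfolding exc_sets_def by simp
  have "(\<lambda>k. \<Sum>v\<in>{x<..<z}. p h y v * cyl h (exc_sets x z 0 k) v) sums
      (\<Sum>v\<in>{x<..<z}. p h y v * exc_prob h x z v)"
    unfolding exc_prob_def by (intro sums_sum sums_mult summable_sums s)
  then have "(\<Sum>k. cyl h (exc_sets x z 0 (Suc k)) y) = (\<Sum>v\<in>{x<..<z}. p h y v * exc_prob h x z v)"
    unfolding Suc by (simp add: sums_iff)
  moreover have "cyl h (exc_sets x z 0 0) y = p h y x" unfolding exc_sets_def by simp
  ultimately show ?thesis
    unfolding exc_prob_def using suminf_split_head[OF s, of y] by simp
qed

lemma cyl_exc_sets: "cyl h (exc_sets x z j k) z = p h z z ^ j * cyl h (exc_sets x z 0 k) z"
  unfolding exc_sets_def by (induction j) auto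

lemma sets_run_exc: "0 \<le> h \<Longrightarrow> {\<omega> \<in> \<Omega>. \<exists>k. run h (exc_sets x z j k) 0 \<omega>} \<in> sets (P y)"
proof -
  assume h: "0 \<le> h"
  have "{\<omega> \<in> \<Omega>. \<exists>k. run h (exc_sets x z j k) 0 \<omega>} = (\<Union>k. {\<omega> \<in> \<Omega>. run h (exc_sets x z j k) 0 \<omega>})" by auto
  then show ?thesis using h by (auto intro!: sets.countable_UN sets_run)
qed

lemma sets_grid_exc: "0 \<le> h \<Longrightarrow> {\<omega> \<in> \<Omega>. grid_exc x z h \<omega>} \<in> sets (P y)"
proof -
  assume h: "0 \<le> h"
  have "{\<omega> \<in> \<Omega>. grid_exc x z h \<omega>} = (\<Union>j. {\<omega> \<in> \<Omega>. \<exists>k. run h (exc_sets x z j k) 0 \<omega>})"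
    unfolding grid_exc_def by auto
  then show ?thesis using h by (auto intro!: sets.countable_UN sets_run_exc)
qed

text \<open>Geometric series over the number of grid steps spent at \<open>z\<close> before
  leaving.\<close>

lemma measure_grid_exc:
  assumes h: "0 \<le> h" and xz: "x < z" and p: "p h z z < 1"
  shows "measure (P z) {\<omega> \<in> \<Omega>. grid_exc x z h \<omega>} = exc_prob h x z z / (1 - p h z z)"
proof -
  define B where "B j = {\<omega> \<in> \<Omega>. X 0 \<omega> = Some z \<and> (\<exists>k. run h (exc_sets x z j k) 0 \<omega>)}" for j
  have "B j = {\<omega> \<in> \<Omega>. X 0 \<omega> = Some z} \<inter> {\<omega> \<in> \<Omega>. \<exists>k. run h (exc_sets x z j k) 0 \<omega>}" for j
    unfolding B_def by auto
  then have sets: "B j \<in> sets (P z)" for j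
    using h by (auto intro!: sets.Int sets_X_eq sets_run_exc)
  have neq: False if j: "j < j'" and B: "\<omega> \<in> B j" "\<omega> \<in> B j'" for j j' \<omega>
  proof -
    have "Suc j \<in> {1..j'}" using j by auto
    then have 1: "X (real (Suc j) * h) \<omega> = Some z"
      using that unfolding B_def run_exc_sets by blast
    obtain k where k: "run h (exc_sets x z j k) 0 \<omega>" using B unfolding B_def by blast
    show False
    proof (cases "k = 0")
      case True
      then show False using 1 k xz unfolding run_exc_sets by auto
    next
      case False
      then have "Suc j \<in> {j<..j + k}" by auto
      then have "X (real (Suc j) * h) \<omega> \<in> Some ` {x<..<z}" using k unfolding run_exc_sets by blast
      then show False using 1 by auto
    qed
  qed
  have "disjoint_family B"
    unfolding disjoint_family_on_def using neq by (metis disjoint_iff linorder_neqE_nat)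
  then have "(\<lambda>j. measure (P z) (B j)) sums measure (P z) (\<Union>j. B j)"
    using sets by (intro P.finite_measure_UNION) auto
  moreover have "measure (P z) (B j) = p h z z ^ j * exc_prob h x z z" for j
  proof -
    have "(\<lambda>k. p h z z ^ j * cyl h (exc_sets x z 0 k) z) sums measure (P z) (B j)"
      using cyl_exc_sums[OF h xz, of j z] unfolding B_def cyl_exc_sets[of h x z j] .
    moreover have "(\<lambda>k. p h z z ^ j * cyl h (exc_sets x z 0 k) z) sums (p h z z ^ j * exc_prob h x z z)"
      unfolding exc_prob_def using cyl_exc_sums[OF h xz, of 0 z] by (intro sums_mult summable_sums) (rule sums_summable)
    ultimately show ?thesis by (rule sums_unique2)
  qed
  ultimately have "(\<lambda>j. p h z z ^ j * exc_prob h x z z) sums measure (P z) (\<Union>j. B j)" by simp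
  moreover have "(\<lambda>j. p h z z ^ j * exc_prob h x z z) sums (1 / (1 - p h z z) * exc_prob h x z z)"
    using p p_nonneg[of h z z] by (intro sums_mult2 geometric_sums) auto
  ultimately have "measure (P z) (\<Union>j. B j) = exc_prob h x z z / (1 - p h z z)"
    using sums_unique2 by fastforce
  moreover have "(\<Union>j. B j) = {\<omega> \<in> \<Omega>. X 0 \<omega> = Some z \<and> grid_exc x z h \<omega>}"
    unfolding B_def grid_exc_def by auto
  ultimately show ?thesis
    using measure_start[of h "grid_exc x z h" z] h sets_grid_exc[OF h, of x z z] by simp
qed

text \<open>The identity \<open>W Q = I\<close> applied to a vector supported below
  \<open>z\<close>; rows beyond \<open>z\<close> of \<open>Q\<close> have no entries in those
  columns.\<close>

lemma W_harmonic_inverse: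
  assumes e: "\<And>v. z \<le> v \<Longrightarrow> e v = 0"
  shows "(\<Sum>w\<le>z. gen.W x w * (\<Sum>v<z. Q w v * e v)) = e x"
proof -
  have "(\<Sum>w\<le>z. gen.W x w * (\<Sum>v<z. Q w v * e v)) = (\<Sum>v<z. (\<Sum>w\<le>z. gen.W x w * Q w v) * e v)"
    unfolding sum_distrib_left sum_distrib_right by (subst sum.swap) (simp add: mult.assoc)
  also have "\<dots> = (\<Sum>v<z. if x = v then e v else 0)"
  proof (rule sum.cong[OF refl])
    fix v assume v: "v \<in> {..<z}"
    have "(\<Sum>w\<le>z. gen.W x w * Q w v) = (\<Sum>w\<le>Suc v. gen.W x w * Q w v)"
      using v by (intro sum.mono_neutral_right) (auto simp: skip_free)
    then show "(\<Sum>w\<le>z. gen.W x w * Q w v) * e v = (if x = v then e v else 0)"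
      unfolding gen.W_Q by simp
  qed
  also have "\<dots> = e x" using e[of x] by (cases "x < z") auto
  finally show ?thesis .
qed

text \<open>The hitting probabilities of the grid chain are harmonic for \<open>(p h - I) / h\<close>, so they are
  almost harmonic for \<open>Q\<close>; applying the inverse matrix \<open>W\<close> to them yields their limit.\<close>

lemma measure_excursion:
  assumes xz: "x < z"
  shows "- Q z z * measure (P z) {\<omega> \<in> \<Omega>. hitting_time X {x} \<omega> < return_time X z \<omega>} = 1 / gen.W x z"
proof -
  define h :: "nat \<Rightarrow> real" where "h m = 1 / 2 ^ m" for m
  have h: "0 < h m" for m unfolding h_def by simp
  have h_lim: "filterlim h (at_right 0) sequentially" unfolding h_def by (rule filterlim_halving) simp
  define D where "D m w v = (p (h m) w v - (if w = v then 1 else 0)) / h m" for m w v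
  have D_lim: "(\<lambda>m. D m w v) \<longlonglongrightarrow> Q w v" for w v
    unfolding D_def using filterlim_compose[OF p_derivative h_lim] .
  \<comment> \<open>Boundary value 1 at \<open>x\<close> and 0 at \<open>z\<close>; the zeros below
    \<open>x\<close> match the fact that grid excursions never go there.\<close>
  define e where "e m v = (if v = x then 1 else if x < v \<and> v < z then exc_prob (h m) x z v else 0)" for m v
  have e_abs: "\<bar>e m v\<bar> \<le> 1" for m v
    unfolding e_def using exc_prob_bounds[OF less_imp_le[OF h] xz] by auto
  have err: "(\<lambda>m. (\<Sum>v<z. D m w v * e m v) - (\<Sum>v<z. Q w v * e m v)) \<longlonglongrightarrow> 0" for w
  proof (rule Lim_null_comparison)
    show "\<forall>\<^sub>F m in sequentially. norm ((\<Sum>v<z. D m w v * e m v) - (\<Sum>v<z. Q w v * e m v)) \<le> (\<Sum>v<z. \<bar>D m w v - Q w v\<bar>)"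
    proof (rule always_eventually, rule allI)
      fix m
      show "norm ((\<Sum>v<z. D m w v * e m v) - (\<Sum>v<z. Q w v * e m v)) \<le> (\<Sum>v<z. \<bar>D m w v - Q w v\<bar>)"
        unfolding sum_subtractf[symmetric] left_diff_distrib[symmetric] real_norm_def
      proof (rule order_trans[OF sum_abs], rule sum_mono)
        fix v
        show "\<bar>(D m w v - Q w v) * e m v\<bar> \<le> \<bar>D m w v - Q w v\<bar>"
          unfolding abs_mult using e_abs[of m v] by (intro mult_left_le) auto
      qed
    qed
    have "(\<lambda>m. \<Sum>v<z. \<bar>D m w v - Q w v\<bar>) \<longlonglongrightarrow> (\<Sum>v<z. \<bar>Q w v - Q w v\<bar>)"
      by (intro tendsto_intros D_lim)
    then show "(\<lambda>m. \<Sum>v<z. \<bar>D m w v - Q w v\<bar>) \<longlonglongrightarrow> 0" by simp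
  qed
  have step: "(\<Sum>v<z. p (h m) w v * e m v) = exc_prob (h m) x z w" for m w
  proof -
    have "(\<Sum>v<z. p (h m) w v * e m v) = (\<Sum>v\<in>insert x {x<..<z}. p (h m) w v * e m v)"
      using xz by (intro sum.mono_neutral_right) (auto simp: e_def)
    also have "\<dots> = p (h m) w x + (\<Sum>v\<in>{x<..<z}. p (h m) w v * exc_prob (h m) x z v)"
      by (simp add: e_def)
    also have "\<dots> = exc_prob (h m) x z w" by (rule exc_prob_step[OF less_imp_le[OF h] xz, symmetric])
    finally show ?thesis .
  qed
  have D_sum: "(\<Sum>v<z. D m w v * e m v) = (exc_prob (h m) x z w - (if w < z then e m w else 0)) / h m" for m w
  proof -
    have "(\<Sum>v<z. D m w v * e m v) = ((\<Sum>v<z. p (h m) w v * e m v) - (\<Sum>v<z. if w = v then e m v else 0)) / h m"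
      unfolding D_def sum_subtractf[symmetric] sum_divide_distrib
      by (intro sum.cong) (auto simp: algebra_simps diff_divide_distrib)
    also have "(\<Sum>v<z. if w = v then e m v else 0) = (if w < z then e m w else 0)" by simp
    finally show ?thesis unfolding step .
  qed
  have harmonic: "(\<lambda>m. \<Sum>v<z. Q w v * e m v) \<longlonglongrightarrow> 0" if w: "x < w" "w < z" for w
  proof -
    have "(\<Sum>v<z. D m w v * e m v) = 0" for m
      unfolding D_sum using w by (simp add: e_def)
    then have "(\<lambda>m. - (\<Sum>v<z. Q w v * e m v)) \<longlonglongrightarrow> 0" using err[of w] by simp
    then show ?thesis using tendsto_minus_cancel[of "\<lambda>m. \<Sum>v<z. Q w v * e m v" 0] by simp
  qed
  have W0: "0 < gen.W x z" using gen.W_pos[OF xz] .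
  \<comment> \<open>In \<open>W_harmonic_inverse\<close> at \<open>x\<close>, the rows strictly
    between \<open>x\<close> and \<open>z\<close> vanish in the limit, so only row \<open>z\<close>
    with coefficient \<open>W x z\<close> remains.\<close>
  have Qz: "(\<lambda>m. \<Sum>v<z. Q z v * e m v) \<longlonglongrightarrow> 1 / gen.W x z"
  proof -
    have "(\<lambda>m. (1 - (\<Sum>w\<in>{x<..<z}. gen.W x w * (\<Sum>v<z. Q w v * e m v))) / gen.W x z) \<longlonglongrightarrow>
        (1 - (\<Sum>w\<in>{x<..<z}. gen.W x w * 0)) / gen.W x z"
      using W0 by (intro tendsto_intros harmonic) auto
    moreover have "(1 - (\<Sum>w\<in>{x<..<z}. gen.W x w * (\<Sum>v<z. Q w v * e m v))) / gen.W x z = (\<Sum>v<z. Q z v * e m v)" for m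
    proof -
      have "1 = (\<Sum>w\<le>z. gen.W x w * (\<Sum>v<z. Q w v * e m v))"
        using W_harmonic_inverse[of z "e m" x] xz by (simp add: e_def)
      also have "\<dots> = (\<Sum>w\<in>insert z {x<..<z}. gen.W x w * (\<Sum>v<z. Q w v * e m v))"
        using xz by (intro sum.mono_neutral_right) (auto simp: not_less)
      finally show ?thesis using W0 by (simp add: field_simps)
    qed
    ultimately show ?thesis by simp
  qed
  \<comment> \<open>In row \<open>z\<close> nothing is subtracted in \<open>D_sum\<close>, because
    \<open>e m\<close> is 0 at \<open>z\<close>.\<close>
  have Dz: "(\<lambda>m. exc_prob (h m) x z z / h m) \<longlonglongrightarrow> 1 / gen.W x z"
    using tendsto_add[OF err[of z] Qz] unfolding D_sum by simp
  obtain y where y: "z = Suc y" using xz by (cases z) auto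
  have Qzz: "Q z z < 0"
  proof -
    have "(\<Sum>v\<in>{y, z}. Q z v) \<le> (\<Sum>v<Suc z. Q z v)"
      unfolding y by (intro sum_mono2) (auto intro: Q_off_diagonal)
    also have "\<dots> \<le> 0" by (rule gen.row_partial_sum_nonpos) simp
    finally show ?thesis using Q_down_pos[of y] unfolding y by simp
  qed
  have p_less: "\<forall>\<^sub>F m in sequentially. p (h m) z z < 1"
  proof -
    have "\<forall>\<^sub>F m in sequentially. D m z z < 0" using D_lim[of z z] Qzz by (rule order_tendstoD(2))
    then show ?thesis by eventually_elim (use h in \<open>auto simp: D_def divide_less_0_iff dest: less_asym\<close>)
  qed
  have "(\<lambda>m. (exc_prob (h m) x z z / h m) / (- D m z z)) \<longlonglongrightarrow> (1 / gen.W x z) / (- Q z z)"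
    using Qzz by (intro tendsto_intros Dz D_lim) auto
  moreover have "\<forall>\<^sub>F m in sequentially. (exc_prob (h m) x z z / h m) / (- D m z z) =
      measure (P z) {\<omega> \<in> \<Omega>. grid_exc x z (h m) \<omega>}"
    using p_less
  proof eventually_elim
    case (elim m)
    have "- D m z z = (1 - p (h m) z z) / h m" unfolding D_def by (simp add: minus_divide_left)
    then show ?case using measure_grid_exc[OF less_imp_le[OF h] xz elim] h[of m] by simp
  qed
  ultimately have lim1: "(\<lambda>m. measure (P z) {\<omega> \<in> \<Omega>. grid_exc x z (h m) \<omega>}) \<longlonglongrightarrow> (1 / gen.W x z) / (- Q z z)"
    by (rule Lim_transform_eventually)
  define E where "E = {\<omega> \<in> \<Omega>. hitting_time X {x} \<omega> < return_time X z \<omega>}"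
  have E: "E \<in> sets (P z)"
  proof -
    have "{\<omega> \<in> space (P z). hitting_time X {x} \<omega> < return_time X z \<omega>} \<in> sets (P z)" by measurable
    then show ?thesis unfolding E_def by simp
  qed
  \<comment> \<open>For almost every path the grid event and the true event agree on all
    sufficiently fine meshes.\<close>
  have "(\<lambda>m. \<integral>\<omega>. indicat_real {\<omega> \<in> \<Omega>. grid_exc x z (h m) \<omega>} \<omega> \<partial>P z) \<longlonglongrightarrow> (\<integral>\<omega>. indicat_real E \<omega> \<partial>P z)"
  proof (rule integral_dominated_convergence[where w="\<lambda>_. 1"])
    show "AE \<omega> in P z. (\<lambda>m. indicat_real {\<omega> \<in> \<Omega>. grid_exc x z (h m) \<omega>} \<omega>) \<longlonglongrightarrow> indicat_real E \<omega>"
      using AE_start[of z] AE_crosses_down[of z] AE_hitting_time_0[of z] AE_finite_hitting_time[of z] AE_space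
    proof eventually_elim
      case (elim \<omega>)
      then have \<omega>: "\<omega> \<in> \<Omega>" by simp
      obtain T where T: "hitting_time X {0} \<omega> = ereal T" "0 \<le> T"
        using elim(4) hitting_time_nonneg[of "{0}" \<omega>] by (cases "hitting_time X {0} \<omega>") auto
      have "X T \<omega> = Some 0" using elim(3) T by force
      then obtain h0 where h0: "0 < h0" "\<And>g. 0 < g \<Longrightarrow> g < h0 \<Longrightarrow>
          grid_exc x z g \<omega> \<longleftrightarrow> hitting_time X {x} \<omega> < return_time X z \<omega>"
        using excursion_eventually_grid[OF \<omega> elim(1) xz T(2) _ elim(2)] by blast
      have "\<forall>\<^sub>F m in sequentially. h m < h0"
        using h_lim h0(1) by (intro order_tendstoD(2)[of _ 0]) (auto simp: filterlim_at)
      then have "\<forall>\<^sub>F m in sequentially. indicat_real E \<omega> = indicat_real {\<omega> \<in> \<Omega>. grid_exc x z (h m) \<omega>} \<omega>"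
        by eventually_elim (use h0(2)[OF h] \<omega> in \<open>auto simp: E_def indicator_def\<close>)
      then show ?case by (rule Lim_transform_eventually[OF tendsto_const])
    qed
  qed (use E sets_grid_exc[OF less_imp_le[OF h]] in auto)
  then have "(\<lambda>m. measure (P z) {\<omega> \<in> \<Omega>. grid_exc x z (h m) \<omega>}) \<longlonglongrightarrow> measure (P z) E"
    using E sets_grid_exc[OF less_imp_le[OF h]] sets.sets_into_space[OF E]
    by (simp add: Int_absorb2)
  then have "measure (P z) E = (1 / gen.W x z) / (- Q z z)" using lim1 by (rule LIMSEQ_unique)
  then show ?thesis unfolding E_def using Qzz by simp
qed

text \<open>Only \<open>q = 0\<close> has to be matched with excursions, since \<open>scale\<close>
  at every other parameter is built from the powers of this one matrix.\<close>

lemma scale_nonneg_eq_W: "scale_nonneg P X Q 0 = gen.W"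
proof (intro ext)
  fix x z
  show "scale_nonneg P X Q 0 x z = gen.W x z"
  proof (cases "x < z")
    case True
    define E where "E = {\<omega>. hitting_time X {x} \<omega> < return_time X z \<omega>}"
    have "(\<integral>\<omega>. indicat_real E \<omega> \<partial>P z) = measure (P z) {\<omega> \<in> \<Omega>. hitting_time X {x} \<omega> < return_time X z \<omega>}"
      unfolding integral_indicator E_def by (simp add: Int_def conj_commute)
    then have "excursion_laplace P X Q 0 z x = 1 / gen.W x z"
      using measure_excursion[OF True] unfolding excursion_laplace_def E_def by simp
    then show ?thesis using True unfolding scale_nonneg_def by simp
  qed (simp add: scale_nonneg_def)
qed

end

section \<open>Initial distributions and the main theorem\<close>

context absorbed_chain
begin

sublocale trans: skip_free_transitions Q p pN "decay_parameter P X"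
proof
  show "0 \<le> pN N t x y" if "0 \<le> t" for N t x y by (rule pN_nonneg)
  show "\<exists>t\<ge>0. 0 < p t x y" if "1 \<le> x" for x y using that by (rule p_irreducible)
  show "((\<lambda>t. p t x 0) \<longlongrightarrow> 1) at_top" for x by (rule p_absorbed)
  show "0 \<le> decay_parameter P X" by (rule decay_parameter_nonneg)
qed (rule pN_0 pN_forward pN_backward pN_tendsto pN_le p_sums p_survival decay_parameter_upper decay_parameter_lower;
  assumption)+

section \<open>Initial distributions as sequences of mass one\<close>

lemma pmf_sums: "pmf \<nu> sums 1" for \<nu> :: "nat pmf"
proof -
  have one: "(\<Sum>x. ennreal (pmf \<nu> x)) = 1"
    using nn_integral_pmf[of UNIV \<nu>] by (simp add: nn_integral_count_space_nat)
  have s: "summable (pmf \<nu>)"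
    by (rule summable_suminf_not_top) (use one in simp_all)
  have "ennreal (suminf (pmf \<nu>)) = ennreal 1"
    using suminf_ennreal2[of "pmf \<nu>"] s one by simp
  then have "suminf (pmf \<nu>) = 1"
    by (subst (asm) ennreal_inj) (auto intro: suminf_nonneg s)
  then show ?thesis using s by (simp add: sums_iff)
qed

lemma P_measurable: "P \<in> measurable (measure_pmf \<nu>) (subprob_algebra (P 0))"
  using sets_P P.subprob_space_axioms by (auto simp: space_subprob_algebra)

lemma space_initial_law [simp]: "space (initial_law P \<nu>) = \<Omega>"
  unfolding initial_law_def by (subst space_bind[where N="P 0", OF sets_P]) simp_all

lemma measure_initial_law:
  assumes "B \<in> sets (P 0)"
  shows "measure (initial_law P \<nu>) B = (\<Sum>x. pmf \<nu> x * measure (P x) B)"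
proof -
  have s: "summable (\<lambda>x. pmf \<nu> x * measure (P x) B)"
  proof (rule summable_comparison_test'[of "pmf \<nu>"])
    show "summable (pmf \<nu>)" using pmf_sums by (rule sums_summable)
    show "norm (pmf \<nu> x * measure (P x) B) \<le> pmf \<nu> x" for x
      using P.prob_le_1[of x B] by (simp add: mult_left_le)
  qed
  have "emeasure (initial_law P \<nu>) B = (\<integral>\<^sup>+ x. emeasure (P x) B \<partial>measure_pmf \<nu>)"
    unfolding initial_law_def by (rule emeasure_bind[OF _ P_measurable assms]) simp
  also have "\<dots> = (\<Sum>x. ennreal (pmf \<nu> x * measure (P x) B))"
    by (simp add: nn_integral_measure_pmf nn_integral_count_space_nat P.emeasure_eq_measure ennreal_mult)
  also have "\<dots> = ennreal (\<Sum>x. pmf \<nu> x * measure (P x) B)"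
    using s by (intro suminf_ennreal2) auto
  finally have "emeasure (initial_law P \<nu>) B = ennreal (\<Sum>x. pmf \<nu> x * measure (P x) B)" .
  moreover have "0 \<le> (\<Sum>x. pmf \<nu> x * measure (P x) B)" using s by (rule suminf_nonneg) simp
  ultimately show ?thesis by (rule measure_eq_emeasure_eq_ennreal[rotated])
qed

lemma measure_alive_at:
  assumes t: "0 \<le> t"
  shows "measure (P x) {\<omega> \<in> \<Omega>. X t \<omega> = Some y \<and> ereal t < hitting_time X {0} \<omega>} = (if y = 0 then 0 else p t x y)"
    and "{\<omega> \<in> \<Omega>. X t \<omega> = Some y \<and> ereal t < hitting_time X {0} \<omega>} \<in> sets (P x)"
proof -
  have eq: "{\<omega> \<in> \<Omega>. X t \<omega> = Some y \<and> ereal t < hitting_time X {0} \<omega>} =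
      {\<omega> \<in> \<Omega>. X t \<omega> = Some y} \<inter> {\<omega> \<in> space (P x). ereal t < hitting_time X {0} \<omega>}" by auto
  have "{\<omega> \<in> space (P x). ereal t < hitting_time X {0} \<omega>} \<in> sets (P x)" by measurable
  then show sets: "{\<omega> \<in> \<Omega>. X t \<omega> = Some y \<and> ereal t < hitting_time X {0} \<omega>} \<in> sets (P x)"
    unfolding eq using t by (intro sets.Int sets_X_eq)
  have "measure (P x) {\<omega> \<in> \<Omega>. X t \<omega> = Some y \<and> ereal t < hitting_time X {0} \<omega>} =
      measure (P x) (if y = 0 then {} else {\<omega> \<in> \<Omega>. X t \<omega> = Some y})"
  proof (rule P.finite_measure_eq_AE)
    show "AE \<omega> in P x. (\<omega> \<in> {\<omega> \<in> \<Omega>. X t \<omega> = Some y \<and> ereal t < hitting_time X {0} \<omega>}) =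
        (\<omega> \<in> (if y = 0 then {} else {\<omega> \<in> \<Omega>. X t \<omega> = Some y}))"
      using AE_hitting_time_0[of x] by eventually_elim (use t in auto)
  qed (use sets t in \<open>auto intro: sets_X_eq\<close>)
  then show "measure (P x) {\<omega> \<in> \<Omega>. X t \<omega> = Some y \<and> ereal t < hitting_time X {0} \<omega>} = (if y = 0 then 0 else p t x y)"
    unfolding p_def by simp
qed

lemma quasi_stationary_iff: "\<nu> \<in> quasi_stationary P X \<longleftrightarrow> trans.qsd (pmf \<nu>)"
proof -
  have surv: "\<P>(\<omega> in initial_law P \<nu>. ereal t < hitting_time X {0} \<omega>) = trans.survival (pmf \<nu>) t"
    if t: "0 \<le> t" for t
  proof -
    have "{\<omega> \<in> space (P 0). ereal t < hitting_time X {0} \<omega>} \<in> sets (P 0)" by measurable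
    then show ?thesis
      by (simp add: measure_initial_law measure_survival t trans.survival_def)
  qed
  have joint: "\<P>(\<omega> in initial_law P \<nu>. X t \<omega> = Some y \<and> ereal t < hitting_time X {0} \<omega>) =
      (if y = 0 then 0 else trans.mix (pmf \<nu>) t y)" if t: "0 \<le> t" for t y
    using measure_alive_at[OF t]
    by (simp add: measure_initial_law trans.mix_def)
  have "\<nu> \<in> quasi_stationary P X \<longleftrightarrow> (\<forall>t\<ge>0. 0 < trans.survival (pmf \<nu>) t \<and>
      (\<forall>y. pmf \<nu> y = (if y = 0 then 0 else trans.mix (pmf \<nu>) t y) / trans.survival (pmf \<nu>) t))"
    unfolding quasi_stationary_def cond_prob_def mem_Collect_eq
    by (intro all_cong1 imp_cong refl) (simp only: surv joint)
  also have "\<dots> \<longleftrightarrow> (\<forall>t\<ge>0. 0 < trans.survival (pmf \<nu>) t \<and>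
      (\<forall>y. pmf \<nu> y * trans.survival (pmf \<nu>) t = (if y = 0 then 0 else trans.mix (pmf \<nu>) t y)))"
    by (intro all_cong1 imp_cong refl conj_cong) (auto simp: eq_divide_eq)
  finally show ?thesis unfolding trans.qsd_def using pmf_sums[of \<nu>] by simp
qed

lemma pmf_quasi_stationary: "pmf ` quasi_stationary P X = Collect trans.qsd"
proof (intro equalityI subsetI)
  fix v assume "v \<in> Collect trans.qsd"
  then have v: "trans.qsd v" "\<And>x. 0 \<le> v x" "v sums 1" unfolding trans.qsd_def by auto
  have "(\<Sum>x. ennreal (v x)) = ennreal (suminf v)"
    using v(2) sums_summable[OF v(3)] by (rule suminf_ennreal2)
  also have "suminf v = 1" using v(3) by (rule sums_unique[symmetric])
  finally have "(\<Sum>x. ennreal (v x)) = 1" by simp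
  then have "pmf (embed_pmf v) x = v x" for x
    by (intro pmf_embed_pmf v(2)) (simp add: nn_integral_count_space_nat)
  then have "pmf (embed_pmf v) = v" by auto
  then show "v \<in> pmf ` quasi_stationary P X"
    using quasi_stationary_iff[of "embed_pmf v"] v(1) by (metis imageI)
qed (auto simp: quasi_stationary_iff)

lemma nu_eq: "nu P X Q l = (\<lambda>x. l * power_scale gen.W (- l) 0 x)"
  unfolding nu_def scale_def power_scale_def scale_nonneg_eq_W by simp

lemma entrance_iff: "entrance_boundary P X Q \<longleftrightarrow> summable (gen.W 0)"
proof
  assume "entrance_boundary P X Q"
  then have "(\<Sum>y. ennreal (gen.W 0 y)) \<noteq> top"
    unfolding entrance_boundary_def scale_nonneg_eq_W by simp
  then show "summable (gen.W 0)" by (rule summable_suminf_not_top[OF gen.W_nonneg])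
next
  assume "summable (gen.W 0)"
  then have "(\<Sum>y. ennreal (gen.W 0 y)) \<noteq> top"
    by (rule ennreal_suminf_neq_top) (rule gen.W_nonneg)
  then show "entrance_boundary P X Q"
    unfolding entrance_boundary_def scale_nonneg_eq_W by (simp add: less_top)
qed

lemma non_entrance_iff: "non_entrance_boundary P X Q \<longleftrightarrow> \<not> summable (gen.W 0)"
  using entrance_iff unfolding entrance_boundary_def non_entrance_boundary_def
  by (auto simp: less_top[symmetric])

end

theorem theorem1p2:
  fixes P :: "nat \<Rightarrow> 'w measure"
    and X :: "real \<Rightarrow> 'w \<Rightarrow> nat option"
    and Q :: "nat \<Rightarrow> nat \<Rightarrow> real"
  assumes chain: "skip_free_chain P X Q"
    and hits: "\<And>x. \<P>(\<omega> in P x. hitting_time X {0} \<omega> < \<infinity>) = 1"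
  shows "(entrance_boundary P X Q \<longrightarrow>
            (\<exists>l0::real. decay_parameter P X = ereal l0 \<and> 0 < l0 \<and>
               pmf ` quasi_stationary P X = {nu P X Q l0})) \<and>
         (non_entrance_boundary P X Q \<and> 0 < decay_parameter P X \<longrightarrow>
            pmf ` quasi_stationary P X =
              nu P X Q ` {l. 0 < l \<and> ereal l \<le> decay_parameter P X})"
proof -
  interpret skip_free_chain P X Q by (rule chain)
  interpret absorbed_chain P X Q by unfold_locales (rule hits)
  have nu: "nu P X Q = (\<lambda>l x. l * power_scale gen.W (- l) 0 x)" using nu_eq by auto
  show ?thesis
  proof (intro conjI impI)
    assume "entrance_boundary P X Q"
    then interpret entrance_transitions Q p pN "decay_parameter P X"
      by unfold_locales (simp add: entrance_iff)
    show "\<exists>l0::real. decay_parameter P X = ereal l0 \<and> 0 < l0 \<and> pmf ` quasi_stationary P X = {nu P X Q l0}"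
      using qsd_entrance unfolding pmf_quasi_stationary nu .
  next
    assume "non_entrance_boundary P X Q \<and> 0 < decay_parameter P X"
    then show "pmf ` quasi_stationary P X = nu P X Q ` {l. 0 < l \<and> ereal l \<le> decay_parameter P X}"
      unfolding pmf_quasi_stationary nu non_entrance_iff by (intro trans.qsd_non_entrance) simp
  qed
qed

end
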